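(* Let $K$ be a (not necessarily finite) group, $\Gamma$ a finite set, $H\le\operatorname{Sym}(\Gamma)$ and $W=K\wr_\Gamma H$. Let $w=(f,h)\in W$ be in sparse disjoint wreath cycle decomposition, and let $B_w$ and the bijection $\Phi:B_w\times\operatorname{Stab}_{C_H(h)}(\mathcal{P}(w))\to C_W(w)$ be as defined in the context. Then \[ \{1\}\to B_w\xrightarrow{\ \iota\ }C_W(w)\xrightarrow{\ \rho\ }\operatorname{Stab}_{C_H(h)}(\mathcal{P}(w))\to\{1\} \] is a short exact sequence of groups, where $\iota:B_w\to C_W(w)$, $c\mapsto[(c,1_H)]\Phi$, and $\rho:C_W(w)\to\operatorname{Stab}_{C_H(h)}(\mathcal{P}(w))$, $(s,t)\mapsto t$. In particular, if $B_w=\langle X\rangle$ and $\operatorname{Stab}_{C_H(h)}(\mathcal{P}(w))=\langle Y\rangle$, then \[ C_W(w)=\left\langle [X]\iota\cup\{[(1,t)]\Phi: t\in Y\}\right\rangle . \]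
   Context: All groups act from the right; $x^y=y^{-1}xy$; $x^K$ is the $K$-conjugacy class of $x$. $K^\Gamma$ is the group of functions $\Gamma\to K$ under pointwise multiplication, $[\gamma]f$ is the image of $\gamma$ under $f$, and $\operatorname{Sym}(\Gamma)$ acts on $K^\Gamma$ by $[\gamma]f^h=[\gamma^{h^{-1}}]f$. $S=K\wr_\Gamma\operatorname{Sym}(\Gamma)=K^\Gamma\rtimes\operatorname{Sym}(\Gamma)$ consists of pairs $(f,h)$ with $(f,h)(e,g)=(f\cdot e^{h^{-1}},hg)$, and $W=K\wr_\Gamma H=\{(f,h)\in S:h\in H\}$. In $(f,h)$, $h$ is the top component. $C_W(w)=\{b\in W: bw=wb\}$ and $C_H(h)=\{t\in H:th=ht\}$. $\operatorname{supp}(h)$ is the set of moved points of $h$. The territory of $w=(f,h)\in S$ is $\operatorname{terr}(w)=\operatorname{supp}(h)\cup\{\gamma:[\gamma]f\ne1_K\}$. $w=(f,h)$ is a wreath cycle if either $h=1$ and $|\operatorname{terr}(w)|=1$, or $h$ is a single non-trivial cycle and $\operatorname{terr}(w)=\operatorname{supp}(h)$; it is sparse if there is $\gamma_0\in\Gamma$ with $[\gamma]f=1_K$ for all $\gamma\ne\gamma_0$. Elements are disjoint if their territories are disjoint. Every $w\in S$ is a product of pairwise disjoint wreath cycles in $S$, uniquely up to order; $\mathcal{C}(w)$ is the set of these wreath cycles. $w$ is in sparse disjoint wreath cycle decomposition if all elements of $\mathcal{C}(w)$ are sparse. For a wreath cycle $w=(f,h)$ and $\gamma\in\Gamma$ put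 $[\gamma,w]\operatorname{Yade}=\prod_{i=0}^{|h|-1}[\gamma^{h^i}]f$ (ordered product, $|h|$ the order of $h$). Its load is $\operatorname{ld}(w)=(([\alpha,w]\operatorname{Yade})^K,|h|)$ for any $\alpha\in\operatorname{terr}(w)$ (independent of $\alpha$). For $w\in S$: $\mathcal{L}(w)=\{\operatorname{ld}(z):z\in\mathcal{C}(w)\}$, $\mathcal{C}(L,w)=\{z\in\mathcal{C}(w):\operatorname{ld}(z)=L\}$. The territory decomposition $\mathcal{P}(w)$ is the family, indexed by $L\in\mathcal{L}(w)$, of the sets $\{\operatorname{terr}(z):z\in\mathcal{C}(L,w)\}$; $\mathcal{P}(w)^t$ replaces each $\operatorname{terr}(z)$ by $\operatorname{terr}(z)^t$, keeping the indexing, and stabilisers are with respect to this action. Choices for $w=(f,h)$ in sparse disjoint wreath cycle decomposition: write $z=(f_z,h_z)$ for $z\in\mathcal{C}(w)$. For each $z\in\mathcal{C}(w)$ fix $\gamma_z\in\operatorname{terr}(z)$ with $[\gamma]f=1_K$ for all $\gamma\in\operatorname{terr}(z)\setminus\{\gamma_z\}$. For each $L\in\mathcal{L}(w)$ fix a representative $z_L\in\mathcal{C}(L,w)$ and put $\gamma_L:=\gamma_{z_L}$, $x_{z_L}:=1_K$; for every other $z\in\mathcal{C}(L,w)$ fix $x_z\in K$ with $[\gamma_z]f=x_z^{-1}\cdot[\gamma_L]f\cdot x_z$. For $\sigma\in\operatorname{Sym}(\mathcal{C}(L,w))$ let $[\sigma]\Psi_L\in\operatorname{Sym}(\Gamma)$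 map $\gamma_z^{h_z^j}$ to $\gamma_{[z]\sigma}^{h_{[z]\sigma}^{j}}$ for $z\in\mathcal{C}(L,w)$, $j\in\mathbb{Z}$, and fix all other points. Each $t\in\operatorname{Stab}_{C_{\operatorname{Sym}(\Gamma)}(h)}(\mathcal{P}(w))$ can be written uniquely as $t=\left(\prod_{L}\left(\prod_{z\in\mathcal{C}(L,w)}h_z^{e_z}\right)\cdot[\sigma_L]\Psi_L\right)\cdot\pi_0$ with $e_z\in\{0,\dots,|h_z|-1\}$, $\sigma_L\in\operatorname{Sym}(\mathcal{C}(L,w))$ and $\pi_0\in\operatorname{Sym}(\Gamma\setminus\operatorname{terr}(w))$ (extended by the identity). Every $\gamma\in\operatorname{terr}(w)$ is uniquely $\gamma_z^{h^{j-e_z}}$ with $z\in\mathcal{C}(w)$, $0\le j<|h_z|$. $B_w:=\prod_{L\in\mathcal{L}(w)}C_K([\gamma_L]f)^{\{\operatorname{terr}(z):z\in\mathcal{C}(L,w)\}}\times K^{\Gamma\setminus\operatorname{terr}(w)}$, a direct product of groups with elements $c=((c_{L,z})_{L,z},c_0)$, where $c_{L,z}\in C_K([\gamma_L]f)$ is the component at $\operatorname{terr}(z)$. The bijection $\Phi:B_w\times\operatorname{Stab}_{C_H(h)}(\mathcal{P}(w))\to C_W(w)$ sends $(c,t)$, with $t$ written uniquely as $t=\left(\prod_{L\in\mathcal{L}(w)}\left(\prod_{z\in\mathcal{C}(L,w)}h_z^{e_z}\right)\cdot[\sigma_L]\Psi_L\right)\cdot\pi_0$ where $e_z\in\{0,\dots,|h_z|-1\}$,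 $\sigma_L\in\operatorname{Sym}(\mathcal{C}(L,w))$ and $\pi_0\in\operatorname{Sym}(\Gamma\setminus\operatorname{terr}(w))$, to $(s,t)$ where: $[\gamma]s=x_z^{-1}c_{L,z}x_{[z]\sigma_L}$ if $\gamma=\gamma_z^{h^{j-e_z}}\in\operatorname{terr}(w)$ with $z\in\mathcal{C}(L,w)$ and either $j=0$ or $e_z<j<|h_z|$; $[\gamma]s=x_z^{-1}c_{L,z}x_{[z]\sigma_L}\cdot[\gamma_{[z]\sigma_L}]f$ if $\gamma=\gamma_z^{h^{j-e_z}}$ with $1\le j\le e_z$; and $[\gamma]s=[\gamma]c_0$ if $\gamma\notin\operatorname{terr}(w)$. *)

theory Defs
  imports "HOL-Algebra.Algebra" "HOL-Combinatorics.Combinatorics"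
begin

text \<open>
  Throughout, groups act from the right. A permutation of \<open>\<Gamma>\<close> is a function \<open>p\<close> with
  \<open>p permutes \<Gamma>\<close>, the image of a point \<open>\<gamma>\<close> under \<open>p\<close> is \<open>p \<gamma>\<close>, and the product \<open>p q\<close> means
  first \<open>p\<close>, then \<open>q\<close>. Consequently the multiplication below is the opposite of the one used by
  \<open>BijGroup\<close> and \<open>sym_group\<close>.
\<close>

definition Sym :: "'g set \<Rightarrow> ('g \<Rightarrow> 'g) monoid" where
  "Sym \<Gamma> = \<lparr>carrier = {p. p permutes \<Gamma>}, monoid.mult = (\<lambda>p q. q \<circ> p), one = id\<rparr>"

definition supp :: "('g \<Rightarrow> 'g) \<Rightarrow> 'g set" where
  "supp h = {\<gamma>. h \<gamma> \<noteq> \<gamma>}"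

definition conj_class :: "('a, 'm) monoid_scheme \<Rightarrow> 'a \<Rightarrow> 'a set" where
  "conj_class G x = {inv\<^bsub>G\<^esub> y \<otimes>\<^bsub>G\<^esub> x \<otimes>\<^bsub>G\<^esub> y | y. y \<in> carrier G}"

definition centraliser :: "('a, 'm) monoid_scheme \<Rightarrow> 'a \<Rightarrow> 'a set" where
  "centraliser G x = {b \<in> carrier G. b \<otimes>\<^bsub>G\<^esub> x = x \<otimes>\<^bsub>G\<^esub> b}"

definition list_prod :: "('a, 'm) monoid_scheme \<Rightarrow> 'a list \<Rightarrow> 'a" where
  "list_prod G xs = foldr (monoid.mult G) xs \<one>\<^bsub>G\<^esub>"

text \<open>
  Product over a finite set in an unspecified order. This is only used for pairwise commuting factors,
  where the order is irrelevant; \<open>finprod\<close> is not used since its theory requires a commutative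
  monoid.
\<close>

definition set_prod :: "('a, 'm) monoid_scheme \<Rightarrow> ('i \<Rightarrow> 'a) \<Rightarrow> 'i set \<Rightarrow> 'a" where
  "set_prod G u A = list_prod G (map u (SOME xs. distinct xs \<and> set xs = A))"

definition short_exact ::
  "('a, 'm) monoid_scheme \<Rightarrow> ('b, 'n) monoid_scheme \<Rightarrow> ('c, 'o) monoid_scheme \<Rightarrow>
    ('a \<Rightarrow> 'b) \<Rightarrow> ('b \<Rightarrow> 'c) \<Rightarrow> bool"
  \<comment> \<open>\<open>short_exact_sequence\<close> of the library forces all groups to have the same element type.\<close>
where
  "short_exact A B C i p \<longleftrightarrow>
     group_hom A B i \<and> group_hom B C p \<and>
     kernel A B i = {\<one>\<^bsub>A\<^esub>} \<and> i ` carrier A = kernel B C p \<and> p ` carrier B = carrier C"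


subsection \<open>Wreath products\<close>

type_synonym ('k, 'g) wr = "('g \<Rightarrow> 'k) \<times> ('g \<Rightarrow> 'g)"
type_synonym 'k ld = "'k set \<times> nat"

abbreviation base_group :: "('k, 'm) monoid_scheme \<Rightarrow> 'g set \<Rightarrow> ('g \<Rightarrow> 'k) monoid" where
  "base_group K \<Gamma> \<equiv> product_group \<Gamma> (\<lambda>_. K)"

definition base_act :: "'g set \<Rightarrow> ('g \<Rightarrow> 'k) \<Rightarrow> ('g \<Rightarrow> 'g) \<Rightarrow> 'g \<Rightarrow> 'k" where
  "base_act \<Gamma> f h = (\<lambda>\<gamma>\<in>\<Gamma>. f ((inv\<^bsub>Sym \<Gamma>\<^esub> h) \<gamma>))"

definition wreath_full :: "('k, 'm) monoid_scheme \<Rightarrow> 'g set \<Rightarrow> ('k, 'g) wr monoid" where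
  "wreath_full K \<Gamma> =
     \<lparr>carrier = carrier (base_group K \<Gamma>) \<times> carrier (Sym \<Gamma>),
      monoid.mult = (\<lambda>(f, h) (e, g).
        (f \<otimes>\<^bsub>base_group K \<Gamma>\<^esub> base_act \<Gamma> e (inv\<^bsub>Sym \<Gamma>\<^esub> h), h \<otimes>\<^bsub>Sym \<Gamma>\<^esub> g)),
      one = (\<one>\<^bsub>base_group K \<Gamma>\<^esub>, \<one>\<^bsub>Sym \<Gamma>\<^esub>)\<rparr>"

definition wreath ::
  "('k, 'm) monoid_scheme \<Rightarrow> 'g set \<Rightarrow> ('g \<Rightarrow> 'g) set \<Rightarrow> ('k, 'g) wr monoid" where
  "wreath K \<Gamma> H =
     (wreath_full K \<Gamma>)\<lparr>carrier := {(f, h). (f, h) \<in> carrier (wreath_full K \<Gamma>) \<and> h \<in> H}\<rparr>"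

definition terr :: "('k, 'm) monoid_scheme \<Rightarrow> 'g set \<Rightarrow> ('k, 'g) wr \<Rightarrow> 'g set" where
  "terr K \<Gamma> w = supp (snd w) \<union> {\<gamma> \<in> \<Gamma>. fst w \<gamma> \<noteq> \<one>\<^bsub>K\<^esub>}"


subsection \<open>Wreath cycles\<close>

definition single_cycle :: "('g \<Rightarrow> 'g) \<Rightarrow> bool" where
  "single_cycle h \<longleftrightarrow> (\<exists>cs. distinct cs \<and> length cs \<ge> 2 \<and> h = cycle_of_list cs)"

definition wreath_cycle :: "('k, 'm) monoid_scheme \<Rightarrow> 'g set \<Rightarrow> ('k, 'g) wr \<Rightarrow> bool" where
  "wreath_cycle K \<Gamma> w \<longleftrightarrow> w \<in> carrier (wreath_full K \<Gamma>) \<and>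
     (snd w = \<one>\<^bsub>Sym \<Gamma>\<^esub> \<and> card (terr K \<Gamma> w) = 1 \<or>
      single_cycle (snd w) \<and> terr K \<Gamma> w = supp (snd w))"

definition sparse :: "('k, 'm) monoid_scheme \<Rightarrow> 'g set \<Rightarrow> ('k, 'g) wr \<Rightarrow> bool" where
  "sparse K \<Gamma> w \<longleftrightarrow> (\<exists>\<gamma>0\<in>\<Gamma>. \<forall>\<gamma>\<in>\<Gamma>. \<gamma> \<noteq> \<gamma>0 \<longrightarrow> fst w \<gamma> = \<one>\<^bsub>K\<^esub>)"

definition cycles :: "('k, 'm) monoid_scheme \<Rightarrow> 'g set \<Rightarrow> ('k, 'g) wr \<Rightarrow> ('k, 'g) wr set" where
  "cycles K \<Gamma> w = (THE D. finite D \<and> (\<forall>z\<in>D. wreath_cycle K \<Gamma> z) \<and>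
     pairwise (\<lambda>z z'. disjnt (terr K \<Gamma> z) (terr K \<Gamma> z')) D \<and>
     set_prod (wreath_full K \<Gamma>) (\<lambda>z. z) D = w)"

definition sparse_decomposition ::
  "('k, 'm) monoid_scheme \<Rightarrow> 'g set \<Rightarrow> ('k, 'g) wr \<Rightarrow> bool" where
  "sparse_decomposition K \<Gamma> w \<longleftrightarrow> (\<forall>z\<in>cycles K \<Gamma> w. sparse K \<Gamma> z)"

abbreviation top_ord :: "'g set \<Rightarrow> ('k, 'g) wr \<Rightarrow> nat" where
  "top_ord \<Gamma> z \<equiv> group.ord (Sym \<Gamma>) (snd z)"

definition yade :: "('k, 'm) monoid_scheme \<Rightarrow> 'g set \<Rightarrow> 'g \<Rightarrow> ('k, 'g) wr \<Rightarrow> 'k" where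
  "yade K \<Gamma> \<gamma> w =
     list_prod K (map (\<lambda>i. fst w ((snd w [^]\<^bsub>Sym \<Gamma>\<^esub> i) \<gamma>)) [0..<top_ord \<Gamma> w])"

definition load :: "('k, 'm) monoid_scheme \<Rightarrow> 'g set \<Rightarrow> ('k, 'g) wr \<Rightarrow> 'k ld" where
  "load K \<Gamma> z =
     (conj_class K (yade K \<Gamma> (SOME \<alpha>. \<alpha> \<in> terr K \<Gamma> z) z), top_ord \<Gamma> z)"

definition loads :: "('k, 'm) monoid_scheme \<Rightarrow> 'g set \<Rightarrow> ('k, 'g) wr \<Rightarrow> 'k ld set" where
  "loads K \<Gamma> w = load K \<Gamma> ` cycles K \<Gamma> w"

definition cycles_of_load ::
  "('k, 'm) monoid_scheme \<Rightarrow> 'g set \<Rightarrow> 'k ld \<Rightarrow> ('k, 'g) wr \<Rightarrow> ('k, 'g) wr set" where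
  "cycles_of_load K \<Gamma> L w = {z \<in> cycles K \<Gamma> w. load K \<Gamma> z = L}"


subsection \<open>The territory decomposition and its stabiliser\<close>

definition terr_decomp ::
  "('k, 'm) monoid_scheme \<Rightarrow> 'g set \<Rightarrow> ('k, 'g) wr \<Rightarrow> 'k ld \<Rightarrow> 'g set set" where
  "terr_decomp K \<Gamma> w = (\<lambda>L\<in>loads K \<Gamma> w. terr K \<Gamma> ` cycles_of_load K \<Gamma> L w)"

definition family_act ::
  "'k ld set \<Rightarrow> ('g \<Rightarrow> 'g) \<Rightarrow> ('k ld \<Rightarrow> 'g set set) \<Rightarrow> 'k ld \<Rightarrow> 'g set set" where
  "family_act I t P = (\<lambda>L\<in>I. (\<lambda>T. t ` T) ` P L)"

definition cent_group :: "('a, 'm) monoid_scheme \<Rightarrow> 'a \<Rightarrow> ('a, 'm) monoid_scheme" where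
  "cent_group G x = G\<lparr>carrier := centraliser G x\<rparr>"

definition stab_group ::
  "('k, 'm) monoid_scheme \<Rightarrow> 'g set \<Rightarrow> ('g \<Rightarrow> 'g) set \<Rightarrow> ('k, 'g) wr \<Rightarrow> ('g \<Rightarrow> 'g) monoid" where
  "stab_group K \<Gamma> H w =
     (let C = cent_group ((Sym \<Gamma>)\<lparr>carrier := H\<rparr>) (snd w)
      in C\<lparr>carrier := stabilizer C (family_act (loads K \<Gamma> w)) (terr_decomp K \<Gamma> w)\<rparr>)"


subsection \<open>The parametrisation of the centraliser\<close>

text \<open>
  In the following, \<open>pt z\<close> is the chosen point of the territory of the wreath cycle \<open>z\<close>, \<open>rep L\<close> is
  the chosen representative among the wreath cycles of load \<open>L\<close>, and \<open>x z\<close> is the chosen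
  conjugating element, so that the distinguished point belonging to \<open>L\<close> is \<open>pt (rep L)\<close>.
\<close>

definition admissible_choices ::
  "('k, 'm) monoid_scheme \<Rightarrow> 'g set \<Rightarrow> ('k, 'g) wr \<Rightarrow>
    (('k, 'g) wr \<Rightarrow> 'g) \<Rightarrow> ('k ld \<Rightarrow> ('k, 'g) wr) \<Rightarrow> (('k, 'g) wr \<Rightarrow> 'k) \<Rightarrow> bool" where
  "admissible_choices K \<Gamma> w pt rep x \<longleftrightarrow>
     (\<forall>z\<in>cycles K \<Gamma> w. pt z \<in> terr K \<Gamma> z \<and>
        (\<forall>\<gamma>\<in>terr K \<Gamma> z - {pt z}. fst w \<gamma> = \<one>\<^bsub>K\<^esub>)) \<and>
     (\<forall>L\<in>loads K \<Gamma> w. rep L \<in> cycles_of_load K \<Gamma> L w \<and> x (rep L) = \<one>\<^bsub>K\<^esub> \<and>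
        (\<forall>z\<in>cycles_of_load K \<Gamma> L w - {rep L}. x z \<in> carrier K \<and>
           fst w (pt z) = inv\<^bsub>K\<^esub> x z \<otimes>\<^bsub>K\<^esub> fst w (pt (rep L)) \<otimes>\<^bsub>K\<^esub> x z))"

definition B_group ::
  "('k, 'm) monoid_scheme \<Rightarrow> 'g set \<Rightarrow> ('k, 'g) wr \<Rightarrow>
    (('k, 'g) wr \<Rightarrow> 'g) \<Rightarrow> ('k ld \<Rightarrow> ('k, 'g) wr) \<Rightarrow>
    (('k ld \<Rightarrow> 'g set \<Rightarrow> 'k) \<times> ('g \<Rightarrow> 'k)) monoid" where
  "B_group K \<Gamma> w pt rep =
     product_group (loads K \<Gamma> w)
       (\<lambda>L. product_group (terr K \<Gamma> ` cycles_of_load K \<Gamma> L w)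
              (\<lambda>_. cent_group K (fst w (pt (rep L))))) \<times>\<times>
     base_group K (\<Gamma> - terr K \<Gamma> w)"

definition Psi ::
  "('k, 'm) monoid_scheme \<Rightarrow> 'g set \<Rightarrow> ('k, 'g) wr \<Rightarrow> (('k, 'g) wr \<Rightarrow> 'g) \<Rightarrow>
    'k ld \<Rightarrow> (('k, 'g) wr \<Rightarrow> ('k, 'g) wr) \<Rightarrow> 'g \<Rightarrow> 'g" where
  "Psi K \<Gamma> w pt L \<sigma> = (THE p. p \<in> carrier (Sym \<Gamma>) \<and>
     (\<forall>z\<in>cycles_of_load K \<Gamma> L w. \<forall>j::int.
        p ((snd z [^]\<^bsub>Sym \<Gamma>\<^esub> j) (pt z)) = (snd (\<sigma> z) [^]\<^bsub>Sym \<Gamma>\<^esub> j) (pt (\<sigma> z))) \<and>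
     (\<forall>\<gamma>. (\<forall>z\<in>cycles_of_load K \<Gamma> L w. \<forall>j::int. \<gamma> \<noteq> (snd z [^]\<^bsub>Sym \<Gamma>\<^esub> j) (pt z))
        \<longrightarrow> p \<gamma> = \<gamma>))"

definition top_factors ::
  "('k, 'm) monoid_scheme \<Rightarrow> 'g set \<Rightarrow> ('k, 'g) wr \<Rightarrow> (('k, 'g) wr \<Rightarrow> 'g) \<Rightarrow> ('g \<Rightarrow> 'g) \<Rightarrow>
    (('k, 'g) wr \<Rightarrow> nat) \<times> ('k ld \<Rightarrow> ('k, 'g) wr \<Rightarrow> ('k, 'g) wr) \<times> ('g \<Rightarrow> 'g)" where
  "top_factors K \<Gamma> w pt t = (THE (e, \<sigma>, \<pi>0).
     e \<in> (\<Pi>\<^sub>E z\<in>cycles K \<Gamma> w. {0..<top_ord \<Gamma> z}) \<and>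
     \<sigma> \<in> (\<Pi>\<^sub>E L\<in>loads K \<Gamma> w. carrier (Sym (cycles_of_load K \<Gamma> L w))) \<and>
     \<pi>0 \<in> carrier (Sym (\<Gamma> - terr K \<Gamma> w)) \<and>
     t = set_prod (Sym \<Gamma>)
           (\<lambda>L. set_prod (Sym \<Gamma>) (\<lambda>z. snd z [^]\<^bsub>Sym \<Gamma>\<^esub> e z) (cycles_of_load K \<Gamma> L w)
                  \<otimes>\<^bsub>Sym \<Gamma>\<^esub> Psi K \<Gamma> w pt L (\<sigma> L))
           (loads K \<Gamma> w) \<otimes>\<^bsub>Sym \<Gamma>\<^esub> \<pi>0)"

definition Phi ::
  "('k, 'm) monoid_scheme \<Rightarrow> 'g set \<Rightarrow> ('k, 'g) wr \<Rightarrow>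
    (('k, 'g) wr \<Rightarrow> 'g) \<Rightarrow> ('k ld \<Rightarrow> ('k, 'g) wr) \<Rightarrow> (('k, 'g) wr \<Rightarrow> 'k) \<Rightarrow>
    (('k ld \<Rightarrow> 'g set \<Rightarrow> 'k) \<times> ('g \<Rightarrow> 'k)) \<times> ('g \<Rightarrow> 'g) \<Rightarrow> ('k, 'g) wr" where
  "Phi K \<Gamma> w pt rep x = (\<lambda>((c, c0), t).
     let (e, \<sigma>, \<pi>0) = top_factors K \<Gamma> w pt t in
     (\<lambda>\<gamma>\<in>\<Gamma>.
        if \<gamma> \<in> terr K \<Gamma> w then
          (let (z, j) = (THE (z, j). z \<in> cycles K \<Gamma> w \<and> j < top_ord \<Gamma> z \<and>
                           \<gamma> = (snd w [^]\<^bsub>Sym \<Gamma>\<^esub> (int j - int (e z))) (pt z));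
               L = load K \<Gamma> z;
               z' = \<sigma> L z;
               a = inv\<^bsub>K\<^esub> x z \<otimes>\<^bsub>K\<^esub> c L (terr K \<Gamma> z) \<otimes>\<^bsub>K\<^esub> x z'
           in if j = 0 \<or> e z < j then a else a \<otimes>\<^bsub>K\<^esub> fst w (pt z'))
        else c0 \<gamma>,
      t))"

end

theory Submission
  imports Defs
begin

text \<open>
  The centraliser of \<open>w = (f, h)\<close> is described in coordinates. The top component \<open>h\<close> splits the
  territory of \<open>w\<close> into orbits, one for each wreath cycle \<open>z\<close>, and a point of the territory is
  uniquely \<open>\<gamma>\<^sub>z\<close> moved by \<open>h\<^sup>j\<close>, where \<open>j\<close> matters modulo the order of \<open>z\<close> (\<open>coord_eq_iff\<close>). In
  these coordinates \<open>h\<close> is \<open>j \<mapsto> j + 1\<close>, sparseness says that \<open>f\<close> is non-trivial at most for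
  \<open>j = 0\<close>, and an element \<open>t\<close> of the stabiliser sends \<open>(z, j)\<close> to \<open>(\<sigma> z, j + e z)\<close>. The
  factorisation of \<open>t\<close> into powers of cycles, a permutation of the cycles of each load and a
  permutation outside the territory just records \<open>e\<close>, \<open>\<sigma>\<close> and the remainder; both can be read off
  the images of the points \<open>\<gamma>\<^sub>z\<close>, which gives existence and uniqueness (\<open>top_factors_eq\<close>).

  An element \<open>(s, t)\<close> centralises \<open>w\<close> if and only if \<open>t\<close> commutes with \<open>h\<close> and
  \<open>s(\<gamma>) f(t \<gamma>) = f(\<gamma>) s(h \<gamma>)\<close> for every point \<open>\<gamma>\<close>. Along a cycle \<open>z\<close> this equation forces \<open>s\<close>
  to be constant except for a jump by the entry of \<open>f\<close> at \<open>\<gamma>\<^bsub>\<sigma> z\<^esub>\<close> after \<open>\<gamma>\<close> has passed the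
  preimage of that point and a jump by the entry at \<open>\<gamma>\<^sub>z\<close> after it has passed \<open>\<gamma>\<^sub>z\<close>. Three facts
  follow.

  \<^item> The values of \<open>s\<close> prescribed by \<open>\<Phi>\<close> have precisely these two jumps. They cancel around the
    cycle because \<open>x\<^sub>z\<^sup>-\<^sup>1 c x\<^bsub>\<sigma> z\<^esub>\<close> conjugates the entry of \<open>z\<close> into that of \<open>\<sigma> z\<close>
    (\<open>transport_base\<close>). So \<open>\<Phi>\<close> takes values in the centraliser (\<open>Phi_Cent\<close>), and \<open>\<rho>\<close> is onto.
  \<^item> Multiplying the equation over one turn around \<open>z\<close>, the values of \<open>s\<close> telescope and the Yades
    of \<open>z\<close> and of its image under \<open>t\<close> are conjugate. So \<open>t\<close> respects loads (\<open>Cent_top_St\<close>), and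
    \<open>\<rho>\<close> maps into the stabiliser.
  \<^item> For \<open>t = 1\<close> both jumps sit at \<open>\<gamma>\<^sub>z\<close>, so \<open>s\<close> is constant on the cycle and commutes with the
    entry of \<open>z\<close> (\<open>Cent_id_constant\<close>). Conjugating by \<open>x\<^sub>z\<close> identifies these constants with the
    components of an element of \<open>B\<^sub>w\<close>, so the image of \<open>\<iota>\<close> is the kernel of \<open>\<rho>\<close> (\<open>image_iota\<close>).

  The statement on generators holds for every short exact sequence once preimages of the generators
  of the quotient are chosen (\<open>short_exact_generate\<close>).
\<close>


section \<open>Permutations acting from the right\<close>

lemma carrier_Sym [simp]: "carrier (Sym \<Gamma>) = {p. p permutes \<Gamma>}"
  and mult_Sym [simp]: "p \<otimes>\<^bsub>Sym \<Gamma>\<^esub> q = q \<circ> p"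
  and one_Sym [simp]: "\<one>\<^bsub>Sym \<Gamma>\<^esub> = id"
  by (simp_all add: Sym_def)

lemma group_Sym: "group (Sym \<Gamma>)"
proof (rule groupI)
  fix p assume "p \<in> carrier (Sym \<Gamma>)"
  then show "\<exists>q\<in>carrier (Sym \<Gamma>). q \<otimes>\<^bsub>Sym \<Gamma>\<^esub> p = \<one>\<^bsub>Sym \<Gamma>\<^esub>"
    by (intro bexI[of _ "inv_into UNIV p"]) (auto simp: permutes_inv permutes_inv_o)
qed (auto simp: permutes_compose permutes_id o_assoc)

lemma inv_Sym: "p permutes \<Gamma> \<Longrightarrow> inv\<^bsub>Sym \<Gamma>\<^esub> p = inv_into UNIV p"
  by (rule group.inv_equality[OF group_Sym]) (auto simp: permutes_inv permutes_inv_o)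

lemma nat_pow_Sym: "p [^]\<^bsub>Sym \<Gamma>\<^esub> (n::nat) = p ^^ n"
  by (induction n) (simp_all add: nat_pow_def)

context
  fixes \<Gamma> :: "'g set" and p :: "'g \<Rightarrow> 'g"
  assumes p: "p permutes \<Gamma>"
begin

lemma int_pow_Sym_permutes: "(p [^]\<^bsub>Sym \<Gamma>\<^esub> (j::int)) permutes \<Gamma>"
  using group.int_pow_closed[OF group_Sym, of p \<Gamma> j] p by simp

lemma int_pow_Sym_add:
  "(p [^]\<^bsub>Sym \<Gamma>\<^esub> (i + j::int)) \<gamma> = (p [^]\<^bsub>Sym \<Gamma>\<^esub> j) ((p [^]\<^bsub>Sym \<Gamma>\<^esub> i) \<gamma>)"
  using group.int_pow_mult[OF group_Sym, of p \<Gamma> i j] p by simp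

lemma int_pow_Sym_one: "p [^]\<^bsub>Sym \<Gamma>\<^esub> (1::int) = p"
  using group.int_pow_1[OF group_Sym, of p \<Gamma>] p by simp

lemma int_pow_Sym_Suc: "(p [^]\<^bsub>Sym \<Gamma>\<^esub> (j + 1::int)) \<gamma> = p ((p [^]\<^bsub>Sym \<Gamma>\<^esub> j) \<gamma>)"
  by (simp add: int_pow_Sym_add int_pow_Sym_one)

text \<open>
  Taking \<open>\<phi> = id\<close> compares the powers of two permutations that agree on an invariant set, and
  \<open>T = UNIV\<close>, \<open>q = p\<close> moves powers of \<open>p\<close> past a permutation \<open>\<phi>\<close> commuting with \<open>p\<close>.
\<close>

lemma int_pow_Sym_intertwine:
  assumes q: "q permutes \<Delta>"
    and inv: "\<And>\<gamma>. p \<gamma> \<in> T \<longleftrightarrow> \<gamma> \<in> T"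
    and \<phi>: "\<And>\<gamma>. \<gamma> \<in> T \<Longrightarrow> \<phi> (p \<gamma>) = q (\<phi> \<gamma>)"
    and \<gamma>: "\<gamma> \<in> T"
  shows "(p [^]\<^bsub>Sym \<Gamma>\<^esub> (j::int)) \<gamma> \<in> T \<and>
    \<phi> ((p [^]\<^bsub>Sym \<Gamma>\<^esub> j) \<gamma>) = (q [^]\<^bsub>Sym \<Delta>\<^esub> j) (\<phi> \<gamma>)"
proof (induction j rule: int_induct[where k = 0])
  case base
  then show ?case using \<gamma> by simp
next
  case (step1 j)
  have "(q [^]\<^bsub>Sym \<Delta>\<^esub> (j + 1)) (\<phi> \<gamma>) = q ((q [^]\<^bsub>Sym \<Delta>\<^esub> j) (\<phi> \<gamma>))"
    using group.int_pow_mult[OF group_Sym, of q \<Delta> j 1] group.int_pow_1[OF group_Sym, of q \<Delta>] q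
    by simp
  then show ?case
    using step1 by (simp add: int_pow_Sym_Suc inv \<phi>)
next
  case (step2 j)
  let ?\<delta> = "(p [^]\<^bsub>Sym \<Gamma>\<^esub> (j - 1)) \<gamma>"
  have p\<delta>: "p ?\<delta> = (p [^]\<^bsub>Sym \<Gamma>\<^esub> j) \<gamma>"
    using int_pow_Sym_Suc[of "j - 1" \<gamma>] by simp
  then have \<delta>: "?\<delta> \<in> T"
    using step2 inv by metis
  have "(q [^]\<^bsub>Sym \<Delta>\<^esub> j) (\<phi> \<gamma>) = q ((q [^]\<^bsub>Sym \<Delta>\<^esub> (j - 1)) (\<phi> \<gamma>))"
    using group.int_pow_mult[OF group_Sym, of q \<Delta> "j - 1" 1]
      group.int_pow_1[OF group_Sym, of q \<Delta>] q by simp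
  moreover have "q (\<phi> ?\<delta>) = (q [^]\<^bsub>Sym \<Delta>\<^esub> j) (\<phi> \<gamma>)"
    using \<phi>[OF \<delta>] p\<delta> step2 by simp
  ultimately show ?case
    using \<delta> permutes_inj[OF q] by (simp add: inj_eq)
qed

end

lemma ord_Sym_pos:
  assumes "finite \<Gamma>" "p permutes \<Gamma>" shows "0 < group.ord (Sym \<Gamma>) p"
  using group.ord_ge_1[OF group_Sym, of \<Gamma> p] assms finite_permutations[OF assms(1)] by simp

lemma list_prod_Sym_Cons: "list_prod (Sym \<Gamma>) (p # ps) = list_prod (Sym \<Gamma>) ps \<circ> p"
  and list_prod_Sym_Nil: "list_prod (Sym \<Gamma>) [] = id"
  by (simp_all add: list_prod_def)

lemma set_prod_eq_list_prod:
  assumes "finite A"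
  obtains xs where "distinct xs" "set xs = A" "set_prod G u A = list_prod G (map u xs)"
proof -
  let ?xs = "SOME xs. distinct xs \<and> set xs = A"
  have xs: "distinct ?xs \<and> set ?xs = A"
    by (rule someI_ex) (use finite_distinct_list[OF assms] in blast)
  show thesis
    by (rule that[of ?xs]) (use xs in \<open>auto simp only: set_prod_def\<close>)
qed

text \<open>
  Permutations that live on disjoint blocks commute, so their product can be read off block by block,
  whatever the order of the factors.
\<close>

lemma set_prod_Sym_blocks:
  assumes fin: "finite A"
    and perm: "\<And>a. a \<in> A \<Longrightarrow> u a permutes \<Gamma>"
    and block: "\<And>a \<gamma>. a \<in> A \<Longrightarrow> \<gamma> \<in> B a \<Longrightarrow> u a \<gamma> \<in> B a"
    and off: "\<And>a \<gamma>. a \<in> A \<Longrightarrow> \<gamma> \<notin> B a \<Longrightarrow> u a \<gamma> = \<gamma>"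
    and disj: "\<And>a b. a \<in> A \<Longrightarrow> b \<in> A \<Longrightarrow> a \<noteq> b \<Longrightarrow> B a \<inter> B b = {}"
  shows "set_prod (Sym \<Gamma>) u A permutes \<Gamma>"
    and "a \<in> A \<Longrightarrow> \<gamma> \<in> B a \<Longrightarrow> set_prod (Sym \<Gamma>) u A \<gamma> = u a \<gamma>"
    and "(\<And>a. a \<in> A \<Longrightarrow> \<gamma> \<notin> B a) \<Longrightarrow> set_prod (Sym \<Gamma>) u A \<gamma> = \<gamma>"
proof -
  have main: "list_prod (Sym \<Gamma>) (map u xs) permutes \<Gamma> \<and>
      (\<forall>a\<in>set xs. \<forall>\<gamma>\<in>B a. list_prod (Sym \<Gamma>) (map u xs) \<gamma> = u a \<gamma>) \<and>
      (\<forall>\<gamma>. (\<forall>a\<in>set xs. \<gamma> \<notin> B a) \<longrightarrow> list_prod (Sym \<Gamma>) (map u xs) \<gamma> = \<gamma>)"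
    if "distinct xs" "set xs \<subseteq> A" for xs
    using that
  proof (induction xs)
    case Nil
    show ?case using permutes_id[of \<Gamma>] by (simp add: list_prod_Sym_Nil id_def)
  next
    case (Cons b xs)
    then have b: "b \<in> A" and "distinct xs" "set xs \<subseteq> A" "b \<notin> set xs" by auto
    note IH = Cons.IH[OF this(2,3)]
    have other: "\<gamma> \<notin> B a" if "a \<in> set xs" "\<gamma> \<in> B b" for a \<gamma>
      using disj[of a b] b that \<open>set xs \<subseteq> A\<close> \<open>b \<notin> set xs\<close> by blast
    show ?case
      unfolding list.map list_prod_Sym_Cons
    proof (intro conjI allI ballI impI)
      show "(list_prod (Sym \<Gamma>) (map u xs) \<circ> u b) permutes \<Gamma>"
        using IH perm[OF b] by (simp add: permutes_compose)
    next
      fix a \<gamma> assume a: "a \<in> set (b # xs)" and \<gamma>: "\<gamma> \<in> B a"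
      show "(list_prod (Sym \<Gamma>) (map u xs) \<circ> u b) \<gamma> = u a \<gamma>"
      proof (cases "a = b")
        case True
        then have "u b \<gamma> \<notin> B a'" if "a' \<in> set xs" for a'
          using other block[OF b] \<gamma> that by blast
        then show ?thesis using IH True by simp
      next
        case False
        then have "a \<in> set xs" using a by simp
        moreover have "u b \<gamma> = \<gamma>"
          using other off[OF b] \<gamma> \<open>a \<in> set xs\<close> by blast
        ultimately show ?thesis using IH \<gamma> by simp
      qed
    next
      fix \<gamma> assume "\<forall>a\<in>set (b # xs). \<gamma> \<notin> B a"
      then show "(list_prod (Sym \<Gamma>) (map u xs) \<circ> u b) \<gamma> = \<gamma>"
        using IH off[OF b] by simp
    qed
  qed
  obtain xs where xs: "distinct xs" "set xs = A"
    "set_prod (Sym \<Gamma>) u A = list_prod (Sym \<Gamma>) (map u xs)"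
    using set_prod_eq_list_prod[OF fin] by metis
  show "set_prod (Sym \<Gamma>) u A permutes \<Gamma>"
    and "a \<in> A \<Longrightarrow> \<gamma> \<in> B a \<Longrightarrow> set_prod (Sym \<Gamma>) u A \<gamma> = u a \<gamma>"
    and "(\<And>a. a \<in> A \<Longrightarrow> \<gamma> \<notin> B a) \<Longrightarrow> set_prod (Sym \<Gamma>) u A \<gamma> = \<gamma>"
    using main[OF xs(1)] xs by auto
qed


section \<open>The wreath product\<close>

lemma carrier_wreath_full:
  "carrier (wreath_full K \<Gamma>) = (\<Gamma> \<rightarrow>\<^sub>E carrier K) \<times> {p. p permutes \<Gamma>}"
  by (simp add: wreath_full_def)

lemma one_wreath_full: "\<one>\<^bsub>wreath_full K \<Gamma>\<^esub> = (\<lambda>\<gamma>\<in>\<Gamma>. \<one>\<^bsub>K\<^esub>, id)"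
  by (simp add: wreath_full_def)

text \<open>
  The action of \<open>Sym \<Gamma>\<close> on the base group enters the multiplication through \<open>h\<^sup>-\<^sup>1\<close>, so the
  two inverses cancel: the second factor is evaluated at the image point \<open>h \<gamma>\<close>.
\<close>

lemma mult_wreath_full:
  assumes "h permutes \<Gamma>"
  shows "(f, h) \<otimes>\<^bsub>wreath_full K \<Gamma>\<^esub> (e, g) = (\<lambda>\<gamma>\<in>\<Gamma>. f \<gamma> \<otimes>\<^bsub>K\<^esub> e (h \<gamma>), g \<circ> h)"
  using assms permutes_inv[OF assms]
  by (auto simp: wreath_full_def base_act_def inv_Sym permutes_inv permutes_inv_inv restrict_def)

lemma group_wreath_full:
  assumes "group K" shows "group (wreath_full K \<Gamma>)"
proof (rule groupI)
  interpret K: group K by fact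
  fix a b c
  assume a: "a \<in> carrier (wreath_full K \<Gamma>)" and b: "b \<in> carrier (wreath_full K \<Gamma>)"
  obtain f h where fh: "a = (f, h)" "f \<in> \<Gamma> \<rightarrow>\<^sub>E carrier K" "h permutes \<Gamma>"
    using a by (auto simp: carrier_wreath_full)
  obtain e g where eg: "b = (e, g)" "e \<in> \<Gamma> \<rightarrow>\<^sub>E carrier K" "g permutes \<Gamma>"
    using b by (auto simp: carrier_wreath_full)
  have hin: "h \<gamma> \<in> \<Gamma>" if "\<gamma> \<in> \<Gamma>" for \<gamma>
    using fh(3) that by (simp add: permutes_in_image)
  have gin: "g \<gamma> \<in> \<Gamma>" if "\<gamma> \<in> \<Gamma>" for \<gamma>
    using eg(3) that by (simp add: permutes_in_image)
  show "a \<otimes>\<^bsub>wreath_full K \<Gamma>\<^esub> b \<in> carrier (wreath_full K \<Gamma>)"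
    using fh eg hin
    by (auto simp: mult_wreath_full carrier_wreath_full permutes_compose intro!: K.m_closed)
  show "\<one>\<^bsub>wreath_full K \<Gamma>\<^esub> \<otimes>\<^bsub>wreath_full K \<Gamma>\<^esub> a = a"
    using fh by (auto simp: one_wreath_full mult_wreath_full permutes_id fun_eq_iff PiE_iff
        extensional_def restrict_def)
  show "\<exists>y\<in>carrier (wreath_full K \<Gamma>). y \<otimes>\<^bsub>wreath_full K \<Gamma>\<^esub> a = \<one>\<^bsub>wreath_full K \<Gamma>\<^esub>"
  proof
    let ?y = "(\<lambda>\<gamma>\<in>\<Gamma>. inv\<^bsub>K\<^esub> f (inv_into UNIV h \<gamma>), inv_into UNIV h)"
    have hin': "inv_into UNIV h \<gamma> \<in> \<Gamma>" if "\<gamma> \<in> \<Gamma>" for \<gamma>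
      using permutes_inv[OF fh(3)] that by (simp add: permutes_in_image)
    then show "?y \<in> carrier (wreath_full K \<Gamma>)"
      using fh by (auto simp: carrier_wreath_full permutes_inv intro!: K.inv_closed)
    show "?y \<otimes>\<^bsub>wreath_full K \<Gamma>\<^esub> a = \<one>\<^bsub>wreath_full K \<Gamma>\<^esub>"
      unfolding fh(1) mult_wreath_full[OF permutes_inv[OF fh(3)]] one_wreath_full
      using fh hin' by (auto simp: permutes_inv_o fun_eq_iff restrict_def intro!: K.l_inv)
  qed
  assume c: "c \<in> carrier (wreath_full K \<Gamma>)"
  obtain d k where dk: "c = (d, k)" "d \<in> \<Gamma> \<rightarrow>\<^sub>E carrier K" "k permutes \<Gamma>"
    using c by (auto simp: carrier_wreath_full)
  show "a \<otimes>\<^bsub>wreath_full K \<Gamma>\<^esub> b \<otimes>\<^bsub>wreath_full K \<Gamma>\<^esub> c =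
    a \<otimes>\<^bsub>wreath_full K \<Gamma>\<^esub> (b \<otimes>\<^bsub>wreath_full K \<Gamma>\<^esub> c)"
    using fh eg dk hin gin
    by (auto simp: mult_wreath_full permutes_compose o_assoc fun_eq_iff restrict_def
        intro!: K.m_assoc)
qed (auto simp: carrier_wreath_full one_wreath_full permutes_id assms group.is_monoid)

lemma terr_off:
  assumes "z \<in> carrier (wreath_full K \<Gamma>)" "\<gamma> \<notin> terr K \<Gamma> z"
  shows "snd z \<gamma> = \<gamma>" and "\<gamma> \<in> \<Gamma> \<Longrightarrow> fst z \<gamma> = \<one>\<^bsub>K\<^esub>"
  using assms by (auto simp: terr_def supp_def)

lemma terr_subset: "z \<in> carrier (wreath_full K \<Gamma>) \<Longrightarrow> terr K \<Gamma> z \<subseteq> \<Gamma>"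
  by (auto simp: terr_def supp_def carrier_wreath_full permutes_def)

lemma terr_invariant:
  assumes "z \<in> carrier (wreath_full K \<Gamma>)"
  shows "snd z \<gamma> \<in> terr K \<Gamma> z \<longleftrightarrow> \<gamma> \<in> terr K \<Gamma> z"
proof -
  have "snd z permutes \<Gamma>"
    using assms by (auto simp: carrier_wreath_full)
  then show ?thesis
    by (cases "snd z \<gamma> = \<gamma>") (auto simp: terr_def supp_def dest: permutes_inj injD)
qed

text \<open>
  The product of elements with disjoint territories coincides on each territory with the
  corresponding factor; this is why a disjoint decomposition is determined by its territories.
\<close>

lemma set_prod_wreath_full:
  assumes K: "group K" and fin: "finite D"
    and D: "D \<subseteq> carrier (wreath_full K \<Gamma>)"
    and disj: "pairwise (\<lambda>z z'. disjnt (terr K \<Gamma> z) (terr K \<Gamma> z')) D"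
  defines "w \<equiv> set_prod (wreath_full K \<Gamma>) (\<lambda>z. z) D"
  shows "w \<in> carrier (wreath_full K \<Gamma>)"
    and "z \<in> D \<Longrightarrow> \<gamma> \<in> terr K \<Gamma> z \<Longrightarrow> fst w \<gamma> = fst z \<gamma> \<and> snd w \<gamma> = snd z \<gamma>"
    and "(\<And>z. z \<in> D \<Longrightarrow> \<gamma> \<notin> terr K \<Gamma> z) \<Longrightarrow> \<gamma> \<in> \<Gamma> \<Longrightarrow> fst w \<gamma> = \<one>\<^bsub>K\<^esub>"
    and "(\<And>z. z \<in> D \<Longrightarrow> \<gamma> \<notin> terr K \<Gamma> z) \<Longrightarrow> snd w \<gamma> = \<gamma>"
proof -
  interpret K: group K by fact
  interpret W: group "wreath_full K \<Gamma>" by (rule group_wreath_full[OF K])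
  have main: "list_prod (wreath_full K \<Gamma>) zs \<in> carrier (wreath_full K \<Gamma>) \<and>
      (\<forall>z\<in>set zs. \<forall>\<gamma>\<in>terr K \<Gamma> z. fst (list_prod (wreath_full K \<Gamma>) zs) \<gamma> = fst z \<gamma> \<and>
         snd (list_prod (wreath_full K \<Gamma>) zs) \<gamma> = snd z \<gamma>) \<and>
      (\<forall>\<gamma>. (\<forall>z\<in>set zs. \<gamma> \<notin> terr K \<Gamma> z) \<longrightarrow>
         (\<gamma> \<in> \<Gamma> \<longrightarrow> fst (list_prod (wreath_full K \<Gamma>) zs) \<gamma> = \<one>\<^bsub>K\<^esub>) \<and>
         snd (list_prod (wreath_full K \<Gamma>) zs) \<gamma> = \<gamma>)"
    if "distinct zs" "set zs \<subseteq> D" for zs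
    using that
  proof (induction zs)
    case Nil
    then show ?case
      using W.one_closed by (auto simp: list_prod_def one_wreath_full)
  next
    case (Cons z zs)
    let ?P = "list_prod (wreath_full K \<Gamma>) zs"
    have z: "z \<in> D" "z \<in> carrier (wreath_full K \<Gamma>)" and zs: "distinct zs" "set zs \<subseteq> D" "z \<notin> set zs"
      using Cons.prems D by auto
    note IH = Cons.IH[OF zs(1,2)]
    have zperm: "snd z permutes \<Gamma>" and zin: "\<And>\<gamma>. \<gamma> \<in> \<Gamma> \<Longrightarrow> fst z \<gamma> \<in> carrier K"
      using z(2) by (auto simp: carrier_wreath_full)
    have Pin: "fst ?P \<gamma> \<in> carrier K" if "\<gamma> \<in> \<Gamma>" for \<gamma>
      using IH that by (auto simp: carrier_wreath_full)
    have prod: "list_prod (wreath_full K \<Gamma>) (z # zs) =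
        (\<lambda>\<gamma>\<in>\<Gamma>. fst z \<gamma> \<otimes>\<^bsub>K\<^esub> fst ?P (snd z \<gamma>), snd ?P \<circ> snd z)"
      using mult_wreath_full[OF zperm, of K "fst z" "fst ?P" "snd ?P"] by (simp add: list_prod_def)
    have other: "\<gamma> \<notin> terr K \<Gamma> z'" if "z' \<in> set zs" "\<gamma> \<in> terr K \<Gamma> z" for z' \<gamma>
    proof -
      have "z' \<in> D" "z \<noteq> z'" using that zs by auto
      then have "disjnt (terr K \<Gamma> z) (terr K \<Gamma> z')" by (rule pairwiseD[OF disj z(1)])
      then show ?thesis using that(2) by (simp only: disjnt_iff) blast
    qed
    show ?case
    proof (intro conjI allI ballI impI)
      show "list_prod (wreath_full K \<Gamma>) (z # zs) \<in> carrier (wreath_full K \<Gamma>)"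
        using W.m_closed[OF z(2), of ?P] IH by (simp add: list_prod_def)
    next
      fix y \<gamma> assume y: "y \<in> set (z # zs)" and \<gamma>: "\<gamma> \<in> terr K \<Gamma> y"
      have "y \<in> carrier (wreath_full K \<Gamma>)" using y Cons.prems D by auto
      then have \<gamma>in: "\<gamma> \<in> \<Gamma>" using \<gamma> terr_subset by fast
      have "fst (list_prod (wreath_full K \<Gamma>) (z # zs)) \<gamma> = fst y \<gamma> \<and>
        snd (list_prod (wreath_full K \<Gamma>) (z # zs)) \<gamma> = snd y \<gamma>"
      proof (cases "y = z")
        case True
        then have "\<And>z'. z' \<in> set zs \<Longrightarrow> snd z \<gamma> \<notin> terr K \<Gamma> z'"
          using other terr_invariant[OF z(2)] \<gamma> by blast
        moreover have "snd z \<gamma> \<in> \<Gamma>"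
          using \<gamma>in zperm by (simp add: permutes_in_image)
        ultimately show ?thesis
          using IH True \<gamma>in zin by (simp add: prod)
      next
        case False
        then have "y \<in> set zs" using y by simp
        then have "\<gamma> \<notin> terr K \<Gamma> z" using other \<gamma> by blast
        moreover have "fst ?P \<gamma> = fst y \<gamma>" "snd ?P \<gamma> = snd y \<gamma>" "fst y \<gamma> \<in> carrier K"
          using IH \<open>y \<in> set zs\<close> \<gamma> Pin[OF \<gamma>in] by auto
        ultimately show ?thesis
          using \<gamma>in terr_off[OF z(2)] by (simp add: prod)
      qed
      then show "fst (list_prod (wreath_full K \<Gamma>) (z # zs)) \<gamma> = fst y \<gamma>"
        and "snd (list_prod (wreath_full K \<Gamma>) (z # zs)) \<gamma> = snd y \<gamma>" by simp_all
    next
      fix \<gamma> assume \<gamma>: "\<forall>z\<in>set (z # zs). \<gamma> \<notin> terr K \<Gamma> z"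
      then have z\<gamma>: "snd z \<gamma> = \<gamma>" "\<gamma> \<in> \<Gamma> \<Longrightarrow> fst z \<gamma> = \<one>\<^bsub>K\<^esub>"
        using terr_off[OF z(2)] by auto
      then show "snd (list_prod (wreath_full K \<Gamma>) (z # zs)) \<gamma> = \<gamma>"
        using IH \<gamma> by (simp add: prod)
      show "fst (list_prod (wreath_full K \<Gamma>) (z # zs)) \<gamma> = \<one>\<^bsub>K\<^esub>" if "\<gamma> \<in> \<Gamma>"
        using IH \<gamma> z\<gamma> that by (simp add: prod)
    qed
  qed
  obtain zs where zs: "distinct zs" "set zs = D" "w = list_prod (wreath_full K \<Gamma>) zs"
    using set_prod_eq_list_prod[OF fin, of "wreath_full K \<Gamma>" "\<lambda>z. z"] unfolding w_def
    by (metis map_ident)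
  show "w \<in> carrier (wreath_full K \<Gamma>)"
    and "z \<in> D \<Longrightarrow> \<gamma> \<in> terr K \<Gamma> z \<Longrightarrow> fst w \<gamma> = fst z \<gamma> \<and> snd w \<gamma> = snd z \<gamma>"
    and "(\<And>z. z \<in> D \<Longrightarrow> \<gamma> \<notin> terr K \<Gamma> z) \<Longrightarrow> \<gamma> \<in> \<Gamma> \<Longrightarrow> fst w \<gamma> = \<one>\<^bsub>K\<^esub>"
    and "(\<And>z. z \<in> D \<Longrightarrow> \<gamma> \<notin> terr K \<Gamma> z) \<Longrightarrow> snd w \<gamma> = \<gamma>"
    using main[OF zs(1)] zs by auto
qed


section \<open>Disjoint wreath cycle decompositions\<close>

lemma cyclic_on_cycle_of_list:
  assumes "distinct cs" "cs \<noteq> []" shows "cyclic_on (cycle_of_list cs) (set cs)"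
proof (rule cyclic_on_singleI)
  let ?p = "cycle_of_list cs"
  show hd: "hd cs \<in> set cs" using assms by simp
  have pow: "(?p ^^ i) (hd cs) = cs ! i" if "i < length cs" for i
  proof -
    have "map (?p ^^ i) cs ! 0 = rotate i cs ! 0"
      by (simp add: cyclic_rotation[OF assms(1)])
    then show ?thesis
      using that assms by (simp add: nth_rotate hd_conv_nth)
  qed
  have "(?p ^^ length cs) (hd cs) = hd cs"
    by (simp add: cycle_is_id_root[OF assms(1)])
  then have "orbit ?p (hd cs) = {(?p ^^ m) (hd cs) | m. m < length cs}"
    using assms by (intro orbit_altdef_bounded) auto
  also have "\<dots> = set cs"
    using pow by (auto simp: set_conv_nth) metis
  finally show "set cs = orbit ?p (hd cs)" ..
qed

lemma supp_cycle_of_list: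
  assumes "distinct cs" "2 \<le> length cs" shows "supp (cycle_of_list cs) = set cs"
proof -
  have cyc: "cyclic_on (cycle_of_list cs) (set cs)"
    using assms by (intro cyclic_on_cycle_of_list) auto
  have "card (set cs) \<noteq> 1"
    using assms by (simp add: distinct_card)
  then have "cycle_of_list cs a \<noteq> a" if "a \<in> set cs" for a
    using eq_on_cyclic_on_iff1[OF cyc that] by metis
  then show ?thesis
    using id_outside_supp[of _ cs] by (auto simp: supp_def)
qed

text \<open>
  This merges the two kinds of wreath cycle: a trivial top component with a one-point territory is
  the case of an orbit of length one.
\<close>

lemma wreath_cycle_iff_cyclic_on:
  assumes fin: "finite \<Gamma>" and z: "z \<in> carrier (wreath_full K \<Gamma>)"
  shows "wreath_cycle K \<Gamma> z \<longleftrightarrow> cyclic_on (snd z) (terr K \<Gamma> z)"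
proof
  assume "wreath_cycle K \<Gamma> z"
  then consider "snd z = id" "card (terr K \<Gamma> z) = 1"
    | "single_cycle (snd z)" "terr K \<Gamma> z = supp (snd z)"
    by (auto simp: wreath_cycle_def)
  then show "cyclic_on (snd z) (terr K \<Gamma> z)"
  proof cases
    case 1
    then obtain \<gamma> where "terr K \<Gamma> z = {\<gamma>}" by (auto simp: card_1_singleton_iff)
    then show ?thesis
      using 1 orbit_eq_singleton_iff[of id \<gamma>] by (auto simp: cyclic_on_def)
  next
    case 2
    then obtain cs where cs: "distinct cs" "2 \<le> length cs" "snd z = cycle_of_list cs"
      by (auto simp: single_cycle_def)
    then have "cs \<noteq> []" by auto
    then show ?thesis
      using 2 cs cyclic_on_cycle_of_list supp_cycle_of_list by metis
  qed
next
  assume cyc: "cyclic_on (snd z) (terr K \<Gamma> z)"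
  have zperm: "snd z permutes \<Gamma>" using z by (auto simp: carrier_wreath_full)
  then have perm: "permutation (snd z)" using fin by (rule permutes_imp_permutation[rotated])
  obtain \<gamma> where \<gamma>: "\<gamma> \<in> terr K \<Gamma> z" and orb: "terr K \<Gamma> z = orbit (snd z) \<gamma>"
    using cyc by (auto simp: cyclic_on_def)
  show "wreath_cycle K \<Gamma> z"
  proof (cases "snd z \<gamma> = \<gamma>")
    case True
    then have terr: "terr K \<Gamma> z = {\<gamma>}"
      using orb orbit_eq_singleton_iff by metis
    have "snd z \<delta> = \<delta>" for \<delta>
      using terr_off(1)[OF z, of \<delta>] True terr by (cases "\<delta> = \<gamma>") auto
    then show ?thesis
      using z terr by (auto simp: wreath_cycle_def)
  next
    case False
    let ?cs = "support (snd z) \<gamma>"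
    have set_cs: "set ?cs = terr K \<Gamma> z"
      unfolding support_set[OF perm] orb orbit_altdef_permutation[OF perm] by auto
    have "snd z \<delta> = cycle_of_list ?cs \<delta>" for \<delta>
    proof (cases "\<delta> \<in> terr K \<Gamma> z")
      case True
      then show ?thesis using cycle_restrict[OF perm] set_cs by blast
    next
      case False
      then show ?thesis
        using terr_off(1)[OF z False] id_outside_supp[of \<delta> ?cs] set_cs by metis
    qed
    then have "snd z = cycle_of_list ?cs" by (rule ext)
    moreover have "2 \<le> length ?cs"
      using least_power_gt_one[OF perm False] by simp
    ultimately have "single_cycle (snd z)"
      unfolding single_cycle_def using cycle_of_permutation[OF perm] by blast
    moreover have "card (terr K \<Gamma> z) \<noteq> 1"
      using False eq_on_cyclic_on_iff1[OF cyc \<gamma>] by metis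
    then have "terr K \<Gamma> z \<subseteq> supp (snd z)"
      using eq_on_cyclic_on_iff1[OF cyc] unfolding supp_def by blast
    then have "terr K \<Gamma> z = supp (snd z)"
      by (auto simp: terr_def)
    ultimately show ?thesis
      using z by (simp add: wreath_cycle_def)
  qed
qed

definition wreath_restrict ::
  "('k, 'm) monoid_scheme \<Rightarrow> 'g set \<Rightarrow> ('k, 'g) wr \<Rightarrow> 'g set \<Rightarrow> ('k, 'g) wr" where
  "wreath_restrict K \<Gamma> w T =
     (\<lambda>\<gamma>\<in>\<Gamma>. if \<gamma> \<in> T then fst w \<gamma> else \<one>\<^bsub>K\<^esub>, perm_restrict (snd w) T)"

text \<open>
  The property that singles out \<open>cycles K \<Gamma> w\<close>, named so that existence and uniqueness can be
  stated separately.
\<close>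

definition disjoint_cycle_decomposition ::
  "('k, 'm) monoid_scheme \<Rightarrow> 'g set \<Rightarrow> ('k, 'g) wr \<Rightarrow> ('k, 'g) wr set \<Rightarrow> bool" where
  "disjoint_cycle_decomposition K \<Gamma> w D \<longleftrightarrow> finite D \<and> (\<forall>z\<in>D. wreath_cycle K \<Gamma> z) \<and>
     pairwise (\<lambda>z z'. disjnt (terr K \<Gamma> z) (terr K \<Gamma> z')) D \<and>
     set_prod (wreath_full K \<Gamma>) (\<lambda>z. z) D = w"

lemma wreath_ext:
  assumes "z \<in> carrier (wreath_full K \<Gamma>)" "z' \<in> carrier (wreath_full K \<Gamma>)"
    and "\<And>\<gamma>. \<gamma> \<in> \<Gamma> \<Longrightarrow> fst z \<gamma> = fst z' \<gamma>" and "\<And>\<gamma>. snd z \<gamma> = snd z' \<gamma>"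
  shows "z = z'"
proof (rule prod_eqI)
  show "fst z = fst z'"
    using assms by (intro PiE_ext[of _ \<Gamma> "\<lambda>_. carrier K"]) (auto simp: carrier_wreath_full)
qed (use assms in auto)

context
  fixes K :: "('k, 'm) monoid_scheme" and \<Gamma> :: "'g set" and w :: "('k, 'g) wr"
  assumes K: "group K" and fin: "finite \<Gamma>" and w: "w \<in> carrier (wreath_full K \<Gamma>)"
begin

lemma top_permutes: "snd w permutes \<Gamma>"
  using w by (auto simp: carrier_wreath_full)

lemma top_permutation: "permutation (snd w)"
  using top_permutes fin by (rule permutes_imp_permutation[rotated])

lemma orbit_subset_terr:
  assumes "\<gamma> \<in> terr K \<Gamma> w" shows "orbit (snd w) \<gamma> \<subseteq> terr K \<Gamma> w"
proof
  fix \<delta> assume "\<delta> \<in> orbit (snd w) \<gamma>"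
  then show "\<delta> \<in> terr K \<Gamma> w"
    by induct (simp_all add: terr_invariant[OF w] assms)
qed

text \<open>
  Every orbit inside the territory cuts a wreath cycle out of \<open>w\<close>. For an orbit of length one the
  hypothesis matters: a fixed point of the top component lies in the territory only because the base
  component is non-trivial there.
\<close>

lemma wreath_restrict_orbit:
  assumes \<gamma>: "\<gamma> \<in> terr K \<Gamma> w"
  defines "z \<equiv> wreath_restrict K \<Gamma> w (orbit (snd w) \<gamma>)"
  shows "z \<in> carrier (wreath_full K \<Gamma>)"
    and "terr K \<Gamma> z = orbit (snd w) \<gamma>"
    and "wreath_cycle K \<Gamma> z"
proof -
  interpret K: group K by (rule K)
  let ?O = "orbit (snd w) \<gamma>"
  have cyc: "cyclic_on (snd w) ?O"
    by (rule cyclic_on_orbit[OF top_permutes fin])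
  have sub: "?O \<subseteq> \<Gamma>"
    using orbit_subset_terr[OF \<gamma>] terr_subset[OF w] by blast
  have "perm_restrict (snd w) ?O permutes ?O"
  proof -
    have "\<Gamma> - (\<Gamma> - ?O) = ?O" using sub by blast
    moreover have "snd w permutes \<Gamma>" by (rule top_permutes)
    moreover have "bij_betw (snd w) ?O ?O"
      unfolding bij_betw_def
    proof
      show inj: "inj_on (snd w) ?O" using permutes_inj[OF top_permutes] inj_on_subset by blast
      show "snd w ` ?O = ?O"
        using inj cyclic_on_inI[OF cyc] finite_cyclic_on[OF cyc]
        by (intro endo_inj_surj) auto
    qed
    then have "bij_betw (perm_restrict (snd w) ?O) ?O ?O"
      by (rule bij_betw_cong[THEN iffD1, rotated]) (simp add: perm_restrict_simps)
    then show ?thesis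
      by (rule bij_imp_permutes) (simp add: perm_restrict_simps)
  qed
  then have "perm_restrict (snd w) ?O permutes \<Gamma>"
    using sub by (rule permutes_subset)
  then show car: "z \<in> carrier (wreath_full K \<Gamma>)"
    using w by (auto simp: z_def wreath_restrict_def carrier_wreath_full)
  show terr: "terr K \<Gamma> z = ?O"
  proof
    show "terr K \<Gamma> z \<subseteq> ?O"
      by (auto simp: terr_def z_def wreath_restrict_def supp_def perm_restrict_def split: if_splits)
    show "?O \<subseteq> terr K \<Gamma> z"
    proof
      fix \<delta> assume \<delta>: "\<delta> \<in> ?O"
      then have "\<delta> \<in> terr K \<Gamma> w" "\<delta> \<in> \<Gamma>" using orbit_subset_terr[OF \<gamma>] sub by auto
      then show "\<delta> \<in> terr K \<Gamma> z"
        using \<delta> by (auto simp: terr_def z_def wreath_restrict_def supp_def perm_restrict_def)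
    qed
  qed
  have "snd z = perm_restrict (snd w) ?O" by (simp add: z_def wreath_restrict_def)
  then show "wreath_cycle K \<Gamma> z"
    using wreath_cycle_iff_cyclic_on[OF fin car] terr cyc cyclic_on_perm_restrict by metis
qed

text \<open>
  On the territory of a factor \<open>z\<close> the element \<open>w\<close> and \<open>z\<close> agree, so this territory is an orbit of
  the top component of \<open>w\<close> and \<open>z\<close> is the restriction of \<open>w\<close> to it.
\<close>

lemma disjoint_cycle_decomposition_eq:
  assumes D: "disjoint_cycle_decomposition K \<Gamma> w D"
  shows "D = (\<lambda>\<gamma>. wreath_restrict K \<Gamma> w (orbit (snd w) \<gamma>)) ` terr K \<Gamma> w"
proof -
  have cyc: "\<And>z. z \<in> D \<Longrightarrow> wreath_cycle K \<Gamma> z"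
    and finD: "finite D" and disj: "pairwise (\<lambda>z z'. disjnt (terr K \<Gamma> z) (terr K \<Gamma> z')) D"
    and prod: "w = set_prod (wreath_full K \<Gamma>) (\<lambda>z. z) D"
    using D by (auto simp: disjoint_cycle_decomposition_def)
  then have car: "D \<subseteq> carrier (wreath_full K \<Gamma>)"
    by (auto simp: wreath_cycle_def)
  note P = set_prod_wreath_full[OF K finD car disj, folded prod]
  have restr: "z = wreath_restrict K \<Gamma> w (orbit (snd w) \<gamma>)" "\<gamma> \<in> terr K \<Gamma> w"
    if z: "z \<in> D" and \<gamma>: "\<gamma> \<in> terr K \<Gamma> z" for z \<gamma>
  proof -
    have zc: "z \<in> carrier (wreath_full K \<Gamma>)" using car z by blast
    then have cyc': "cyclic_on (snd z) (terr K \<Gamma> z)"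
      using wreath_cycle_iff_cyclic_on[OF fin] cyc[OF z] by blast
    have cyclic: "cyclic_on (snd w) (terr K \<Gamma> z) = cyclic_on (snd z) (terr K \<Gamma> z)"
      by (rule cyclic_cong) (use P(2)[OF z] in auto)
    then have orb: "orbit (snd w) \<gamma> = terr K \<Gamma> z"
      using orbit_cyclic_eq3[OF _ \<gamma>] cyc' by blast
    have "\<gamma> \<in> \<Gamma>" using \<gamma> terr_subset[OF zc] by blast
    then show \<gamma>w: "\<gamma> \<in> terr K \<Gamma> w"
      using P(2)[OF z \<gamma>] \<gamma> by (auto simp: terr_def supp_def)
    show "z = wreath_restrict K \<Gamma> w (orbit (snd w) \<gamma>)"
    proof (rule wreath_ext[OF zc wreath_restrict_orbit(1)[OF \<gamma>w]])
      show "fst z \<delta> = fst (wreath_restrict K \<Gamma> w (orbit (snd w) \<gamma>)) \<delta>" if "\<delta> \<in> \<Gamma>" for \<delta>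
        using that P(2)[OF z] terr_off[OF zc] unfolding orb by (auto simp: wreath_restrict_def)
      show "snd z \<delta> = snd (wreath_restrict K \<Gamma> w (orbit (snd w) \<gamma>)) \<delta>" for \<delta>
        using P(2)[OF z] terr_off[OF zc] unfolding orb
        by (auto simp: wreath_restrict_def perm_restrict_def)
    qed
  qed
  show ?thesis
  proof (rule subset_antisym; rule subsetI)
    fix z assume z: "z \<in> D"
    then have "cyclic_on (snd z) (terr K \<Gamma> z)"
      using wreath_cycle_iff_cyclic_on[OF fin] cyc car by blast
    then obtain \<gamma> where "\<gamma> \<in> terr K \<Gamma> z" by (auto simp: cyclic_on_def)
    then show "z \<in> (\<lambda>\<gamma>. wreath_restrict K \<Gamma> w (orbit (snd w) \<gamma>)) ` terr K \<Gamma> w"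
      using restr[OF z] by blast
  next
    fix z assume "z \<in> (\<lambda>\<gamma>. wreath_restrict K \<Gamma> w (orbit (snd w) \<gamma>)) ` terr K \<Gamma> w"
    then obtain \<gamma> where \<gamma>: "\<gamma> \<in> terr K \<Gamma> w"
      and z: "z = wreath_restrict K \<Gamma> w (orbit (snd w) \<gamma>)" by blast
    have "\<exists>y\<in>D. \<gamma> \<in> terr K \<Gamma> y"
    proof (rule ccontr)
      assume "\<not> (\<exists>y\<in>D. \<gamma> \<in> terr K \<Gamma> y)"
      then have "\<gamma> \<notin> terr K \<Gamma> w"
        using P(3,4)[of \<gamma>] by (auto simp: terr_def supp_def)
      then show False using \<gamma> by blast
    qed
    then show "z \<in> D" using restr z by metis
  qed
qed

lemma disjoint_cycle_decomposition_orbits: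
  "disjoint_cycle_decomposition K \<Gamma> w
     ((\<lambda>\<gamma>. wreath_restrict K \<Gamma> w (orbit (snd w) \<gamma>)) ` terr K \<Gamma> w)"
proof -
  let ?z = "\<lambda>\<gamma>. wreath_restrict K \<Gamma> w (orbit (snd w) \<gamma>)"
  let ?D = "?z ` terr K \<Gamma> w"
  have finD: "finite ?D"
    using terr_subset[OF w] fin by (intro finite_imageI) (rule finite_subset)
  have car: "?D \<subseteq> carrier (wreath_full K \<Gamma>)"
    using wreath_restrict_orbit(1) by blast
  have cyc: "wreath_cycle K \<Gamma> z" if "z \<in> ?D" for z
    using that wreath_restrict_orbit(3) by blast
  have disj: "pairwise (\<lambda>z z'. disjnt (terr K \<Gamma> z) (terr K \<Gamma> z')) ?D"
  proof (rule pairwiseI)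
    fix z z' assume "z \<in> ?D" "z' \<in> ?D" "z \<noteq> z'"
    then obtain \<gamma> \<gamma>' where z: "\<gamma> \<in> terr K \<Gamma> w" "z = ?z \<gamma>" "\<gamma>' \<in> terr K \<Gamma> w" "z' = ?z \<gamma>'" by blast
    then have ne: "orbit (snd w) \<gamma> \<noteq> orbit (snd w) \<gamma>'" using \<open>z \<noteq> z'\<close> by auto
    have "disjnt (orbit (snd w) \<gamma>) (orbit (snd w) \<gamma>')"
    proof (rule ccontr)
      assume "\<not> disjnt (orbit (snd w) \<gamma>) (orbit (snd w) \<gamma>')"
      then obtain \<delta> where "\<delta> \<in> orbit (snd w) \<gamma>" "\<delta> \<in> orbit (snd w) \<gamma>'"
        by (auto simp: disjnt_def)
      then show False
        using ne orbit_cyclic_eq3[OF cyclic_on_orbit[OF top_permutes fin]] by metis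
    qed
    then show "disjnt (terr K \<Gamma> z) (terr K \<Gamma> z')"
      using z wreath_restrict_orbit(2) by simp
  qed
  note P = set_prod_wreath_full[OF K finD car disj]
  have "set_prod (wreath_full K \<Gamma>) (\<lambda>z. z) ?D = w"
  proof (rule wreath_ext[OF P(1) w])
    have on: "fst (set_prod (wreath_full K \<Gamma>) (\<lambda>z. z) ?D) \<gamma> = fst w \<gamma> \<and>
        snd (set_prod (wreath_full K \<Gamma>) (\<lambda>z. z) ?D) \<gamma> = snd w \<gamma>" if \<gamma>: "\<gamma> \<in> terr K \<Gamma> w" for \<gamma>
    proof -
      have self: "\<gamma> \<in> orbit (snd w) \<gamma>"
        by (rule permutation_self_in_orbit[OF top_permutation])
      have "\<gamma> \<in> \<Gamma>" using \<gamma> terr_subset[OF w] by blast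
      then show ?thesis
        using P(2)[of "?z \<gamma>" \<gamma>] \<gamma> self wreath_restrict_orbit(2)[OF \<gamma>]
        by (simp add: wreath_restrict_def perm_restrict_simps)
    qed
    have off: "\<gamma> \<notin> terr K \<Gamma> z" if "\<gamma> \<notin> terr K \<Gamma> w" "z \<in> ?D" for \<gamma> z
      using that wreath_restrict_orbit(2) orbit_subset_terr by blast
    show "fst (set_prod (wreath_full K \<Gamma>) (\<lambda>z. z) ?D) \<gamma> = fst w \<gamma>" if "\<gamma> \<in> \<Gamma>" for \<gamma>
    proof (cases "\<gamma> \<in> terr K \<Gamma> w")
      case True then show ?thesis using on by blast
    next
      case False
      then show ?thesis using P(3)[OF off[OF False]] terr_off(2)[OF w False] that by simp
    qed
    show "snd (set_prod (wreath_full K \<Gamma>) (\<lambda>z. z) ?D) \<gamma> = snd w \<gamma>" for \<gamma>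
    proof (cases "\<gamma> \<in> terr K \<Gamma> w")
      case True then show ?thesis using on by blast
    next
      case False
      then show ?thesis using P(4)[OF off[OF False]] terr_off(1)[OF w False] by simp
    qed
  qed
  then show ?thesis
    unfolding disjoint_cycle_decomposition_def using finD cyc disj by blast
qed

lemma cycles_eq:
  "cycles K \<Gamma> w = (\<lambda>\<gamma>. wreath_restrict K \<Gamma> w (orbit (snd w) \<gamma>)) ` terr K \<Gamma> w"
proof -
  have "cycles K \<Gamma> w = (THE D. disjoint_cycle_decomposition K \<Gamma> w D)"
    by (simp add: cycles_def disjoint_cycle_decomposition_def)
  then show ?thesis
    using the_equality[of "disjoint_cycle_decomposition K \<Gamma> w",
        OF disjoint_cycle_decomposition_orbits disjoint_cycle_decomposition_eq] by simp
qed

lemma finite_cycles: "finite (cycles K \<Gamma> w)"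
  unfolding cycles_eq using terr_subset[OF w] fin by (intro finite_imageI) (rule finite_subset)

lemma cycles_carrier: "z \<in> cycles K \<Gamma> w \<Longrightarrow> z \<in> carrier (wreath_full K \<Gamma>)"
  unfolding cycles_eq using wreath_restrict_orbit(1) by blast

lemma terr_cycle_orbit:
  assumes "z \<in> cycles K \<Gamma> w" "\<gamma> \<in> terr K \<Gamma> z"
  shows "terr K \<Gamma> z = orbit (snd w) \<gamma>"
  using assms wreath_restrict_orbit(2) orbit_cyclic_eq3[OF cyclic_on_orbit[OF top_permutes fin]]
  unfolding cycles_eq by auto

lemma cycle_agrees:
  assumes "z \<in> cycles K \<Gamma> w" "\<gamma> \<in> terr K \<Gamma> z"
  shows "fst z \<gamma> = fst w \<gamma>" and "snd z \<gamma> = snd w \<gamma>"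
  using assms wreath_restrict_orbit(1,2) terr_subset unfolding cycles_eq
  by (fastforce simp: wreath_restrict_def perm_restrict_simps)+

lemma cycle_through:
  assumes "\<gamma> \<in> terr K \<Gamma> w" obtains z where "z \<in> cycles K \<Gamma> w" "\<gamma> \<in> terr K \<Gamma> z"
  using that[of "wreath_restrict K \<Gamma> w (orbit (snd w) \<gamma>)"] assms
    wreath_restrict_orbit(2)[OF assms] permutation_self_in_orbit[OF top_permutation]
  unfolding cycles_eq by blast

lemma cycle_eqI:
  assumes "z \<in> cycles K \<Gamma> w" "z' \<in> cycles K \<Gamma> w" "\<gamma> \<in> terr K \<Gamma> z" "\<gamma> \<in> terr K \<Gamma> z'"
  shows "z = z'"
proof -
  have terr: "terr K \<Gamma> z = terr K \<Gamma> z'"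
    using terr_cycle_orbit assms by metis
  show ?thesis
  proof (rule wreath_ext[OF assms(1,2)[THEN cycles_carrier]])
    show "fst z \<delta> = fst z' \<delta>" if "\<delta> \<in> \<Gamma>" for \<delta>
      using cycle_agrees(1) terr_off(2)[OF cycles_carrier] assms(1,2) that terr
      by (cases "\<delta> \<in> terr K \<Gamma> z") auto
    show "snd z \<delta> = snd z' \<delta>" for \<delta>
      using cycle_agrees(2) terr_off(1)[OF cycles_carrier] assms(1,2) terr
      by (cases "\<delta> \<in> terr K \<Gamma> z") auto
  qed
qed

lemma terr_cycle_subset: "z \<in> cycles K \<Gamma> w \<Longrightarrow> terr K \<Gamma> z \<subseteq> terr K \<Gamma> w"
  unfolding cycles_eq using wreath_restrict_orbit(2) orbit_subset_terr by auto

lemma inj_on_terr: "inj_on (terr K \<Gamma>) (cycles K \<Gamma> w)"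
proof (rule inj_onI)
  fix z z' assume *: "z \<in> cycles K \<Gamma> w" "z' \<in> cycles K \<Gamma> w" "terr K \<Gamma> z = terr K \<Gamma> z'"
  then obtain \<gamma> where "\<gamma> \<in> terr K \<Gamma> w" "z = wreath_restrict K \<Gamma> w (orbit (snd w) \<gamma>)"
    unfolding cycles_eq by blast
  then have "\<gamma> \<in> terr K \<Gamma> z"
    using wreath_restrict_orbit(2) permutation_self_in_orbit[OF top_permutation] by metis
  then show "z = z'" using * cycle_eqI by metis
qed

end


section \<open>Coordinates along the cycles\<close>

text \<open>
  Sparseness makes all factors but one of a Yade trivial; this evaluates such a product in a group
  that need not be commutative.
\<close>

lemma list_prod_single:
  assumes "group G" "distinct xs" "a \<in> set xs" "u a \<in> carrier G"
    and one: "\<And>b. b \<in> set xs \<Longrightarrow> b \<noteq> a \<Longrightarrow> u b = \<one>\<^bsub>G\<^esub>"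
  shows "list_prod G (map u xs) = u a"
proof -
  interpret group G by fact
  have "list_prod G (map u xs) = (if a \<in> set xs then u a else \<one>\<^bsub>G\<^esub>)"
    using \<open>distinct xs\<close> one
  proof (induction xs)
    case Nil
    then show ?case by (simp add: list_prod_def)
  next
    case (Cons b xs)
    then have "list_prod G (map u xs) = (if a \<in> set xs then u a else \<one>\<^bsub>G\<^esub>)" by auto
    then show ?case
      using Cons.prems assms(4) by (cases "b = a") (auto simp: list_prod_def)
  qed
  then show ?thesis using assms(3) by simp
qed

lemma conj_class_conjugate:
  fixes G (structure)
  assumes "group G" "a \<in> carrier G" "y \<in> carrier G" "b = inv y \<otimes> a \<otimes> y"
  shows "conj_class G b = conj_class G a"
proof -
  interpret group G by fact
  have b: "b \<in> carrier G" using assms(2-4) by simp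
  have "conj_class G b \<subseteq> conj_class G a"
  proof
    fix d assume "d \<in> conj_class G b"
    then obtain v where v: "v \<in> carrier G" "d = inv v \<otimes> b \<otimes> v"
      by (auto simp: conj_class_def)
    then have "d = inv (y \<otimes> v) \<otimes> a \<otimes> (y \<otimes> v)"
      using assms by (simp add: inv_mult_group m_assoc)
    then show "d \<in> conj_class G a"
      using v assms unfolding conj_class_def by blast
  qed
  moreover have "conj_class G a \<subseteq> conj_class G b"
  proof
    fix d assume "d \<in> conj_class G a"
    then obtain v where v: "v \<in> carrier G" "d = inv v \<otimes> a \<otimes> v"
      by (auto simp: conj_class_def)
    have "y \<otimes> b \<otimes> inv y = (y \<otimes> inv y) \<otimes> a \<otimes> (y \<otimes> inv y)"
      using assms(2-4) by (simp only: m_assoc inv_closed m_closed)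
    then have "a = y \<otimes> b \<otimes> inv y" using assms(2,3) by simp
    have "d = inv v \<otimes> (y \<otimes> b \<otimes> inv y) \<otimes> v"
      using v(2) \<open>a = y \<otimes> b \<otimes> inv y\<close> by simp
    also have "\<dots> = inv (inv y \<otimes> v) \<otimes> b \<otimes> (inv y \<otimes> v)"
      using assms(2,3) v(1) b by (simp only: inv_mult_group inv_closed m_closed inv_inv m_assoc)
    finally have "d = inv (inv y \<otimes> v) \<otimes> b \<otimes> (inv y \<otimes> v)" .
    then show "d \<in> conj_class G b"
      using v assms unfolding conj_class_def by blast
  qed
  ultimately show ?thesis by blast
qed

locale sparse_wreath =
  fixes K :: "('k, 'm) monoid_scheme" and \<Gamma> :: "'g set" and H :: "('g \<Rightarrow> 'g) set"
    and w :: "('k, 'g) wr"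
    and pt :: "('k, 'g) wr \<Rightarrow> 'g" and rep :: "'k ld \<Rightarrow> ('k, 'g) wr" and x :: "('k, 'g) wr \<Rightarrow> 'k"
  assumes group_K: "group K"
    and finite_\<Gamma>: "finite \<Gamma>"
    and subgroup_H: "subgroup H (Sym \<Gamma>)"
    and w_wreath: "w \<in> carrier (wreath K \<Gamma> H)"
    and choices: "admissible_choices K \<Gamma> w pt rep x"
begin

sublocale K: group K by (rule group_K)

abbreviation f where "f \<equiv> fst w"
abbreviation h where "h \<equiv> snd w"
abbreviation cyc where "cyc \<equiv> cycles K \<Gamma> w"
abbreviation ld where "ld \<equiv> load K \<Gamma>"
abbreviation cyc_ld where "cyc_ld L \<equiv> cycles_of_load K \<Gamma> L w"
abbreviation ord where "ord z \<equiv> top_ord \<Gamma> z"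
abbreviation base where "base z \<equiv> f (pt z)"

text \<open>
  Powers of \<open>h\<close> are used instead of powers of the single cycles, so that moving along several cycles
  at once, as a permutation commuting with \<open>h\<close> does, needs no change of notation.
\<close>

definition coord :: "('k, 'g) wr \<Rightarrow> int \<Rightarrow> 'g" where
  "coord z j = (h [^]\<^bsub>Sym \<Gamma>\<^esub> j) (pt z)"

lemma w_full: "w \<in> carrier (wreath_full K \<Gamma>)"
  using w_wreath by (auto simp: wreath_def)

lemma h_permutes: "h permutes \<Gamma>"
  by (rule top_permutes[OF group_K finite_\<Gamma> w_full])

lemma f_carrier: "\<gamma> \<in> \<Gamma> \<Longrightarrow> f \<gamma> \<in> carrier K"
  using w_full by (auto simp: carrier_wreath_full)

lemma H_permutes: "t \<in> H \<Longrightarrow> t permutes \<Gamma>"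
  using subgroup.subset[OF subgroup_H] by auto

lemmas cycle_full = cycles_carrier[OF group_K finite_\<Gamma> w_full]
  and finite_cyc = finite_cycles[OF group_K finite_\<Gamma> w_full]

lemma cycle_permutes_\<Gamma>: "z \<in> cyc \<Longrightarrow> snd z permutes \<Gamma>"
  using cycle_full[of z] by (auto simp: carrier_wreath_full)

lemma ord_pos: "z \<in> cyc \<Longrightarrow> 0 < ord z"
  by (rule ord_Sym_pos[OF finite_\<Gamma> cycle_permutes_\<Gamma>])

lemma pt_terr: "z \<in> cyc \<Longrightarrow> pt z \<in> terr K \<Gamma> z"
  using choices by (auto simp: admissible_choices_def)

lemma terr_in_\<Gamma>: "\<gamma> \<in> terr K \<Gamma> w \<Longrightarrow> \<gamma> \<in> \<Gamma>"
  using terr_subset[OF w_full] by blast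

lemma terr_cycle_in_terr: "z \<in> cyc \<Longrightarrow> \<gamma> \<in> terr K \<Gamma> z \<Longrightarrow> \<gamma> \<in> terr K \<Gamma> w"
  using terr_cycle_subset[OF group_K finite_\<Gamma> w_full] by blast

lemma cycle_pow:
  assumes z: "z \<in> cyc" and \<gamma>: "\<gamma> \<in> terr K \<Gamma> z"
  shows "(snd z [^]\<^bsub>Sym \<Gamma>\<^esub> (j::int)) \<gamma> \<in> terr K \<Gamma> z"
    and "(snd z [^]\<^bsub>Sym \<Gamma>\<^esub> j) \<gamma> = (h [^]\<^bsub>Sym \<Gamma>\<^esub> j) \<gamma>"
  using int_pow_Sym_intertwine[OF cycle_permutes_\<Gamma>[OF z] h_permutes, of "terr K \<Gamma> z" "\<lambda>\<gamma>. \<gamma>" \<gamma> j]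
    terr_invariant[OF cycle_full[OF z]] cycle_agrees(2)[OF group_K finite_\<Gamma> w_full z] \<gamma> by auto

lemma cycle_pow_off:
  assumes z: "z \<in> cyc" and \<gamma>: "\<gamma> \<notin> terr K \<Gamma> z"
  shows "(snd z [^]\<^bsub>Sym \<Gamma>\<^esub> (j::int)) \<gamma> = \<gamma>"
proof -
  have "(id [^]\<^bsub>Sym \<Gamma>\<^esub> j) \<gamma> = \<gamma>"
    using group.int_pow_one[OF group_Sym, of \<Gamma> j] by simp
  then show ?thesis
    using int_pow_Sym_intertwine[OF cycle_permutes_\<Gamma>[OF z] permutes_id[of \<Gamma>],
        of "- terr K \<Gamma> z" "\<lambda>\<gamma>. \<gamma>" \<gamma> j]
      terr_invariant[OF cycle_full[OF z]] terr_off(1)[OF cycle_full[OF z]] \<gamma> by auto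
qed

lemma coord_cycle: "z \<in> cyc \<Longrightarrow> (snd z [^]\<^bsub>Sym \<Gamma>\<^esub> j) (pt z) = coord z j"
  unfolding coord_def by (rule cycle_pow(2)[OF _ pt_terr])

lemma coord_terr: "z \<in> cyc \<Longrightarrow> coord z j \<in> terr K \<Gamma> z"
  using cycle_pow(1)[OF _ pt_terr] coord_cycle by metis

lemma coord_terr_w: "z \<in> cyc \<Longrightarrow> coord z j \<in> terr K \<Gamma> w"
  by (rule terr_cycle_in_terr[OF _ coord_terr])

lemma coord_\<Gamma>: "z \<in> cyc \<Longrightarrow> coord z j \<in> \<Gamma>"
  by (rule terr_in_\<Gamma>[OF coord_terr_w])

lemma coord_0: "coord z 0 = pt z"
  by (simp add: coord_def)

lemma pow_coord: "(h [^]\<^bsub>Sym \<Gamma>\<^esub> i) (coord z j) = coord z (j + i)"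
  by (simp add: coord_def int_pow_Sym_add[OF h_permutes])

lemma h_coord: "h (coord z j) = coord z (j + 1)"
  using pow_coord[of 1] by (simp add: int_pow_Sym_one[OF h_permutes])

lemma coord_surj:
  assumes z: "z \<in> cyc" and \<gamma>: "\<gamma> \<in> terr K \<Gamma> z"
  obtains j where "\<gamma> = coord z j"
proof -
  have "\<gamma> \<in> orbit h (pt z)"
    using terr_cycle_orbit[OF group_K finite_\<Gamma> w_full z pt_terr[OF z]] \<gamma> by simp
  then obtain i where "\<gamma> = (h ^^ i) (pt z)"
    unfolding orbit_altdef_permutation[OF top_permutation[OF group_K finite_\<Gamma> w_full]] by blast
  then have "\<gamma> = coord z (int i)"
    by (simp add: coord_def int_pow_int nat_pow_Sym)
  then show thesis by (rule that)
qed

text \<open>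
  A power of a cycle that fixes one point of the territory fixes all of them, since the territory is
  a single orbit; so the period of every point is the order of the cycle.
\<close>

lemma coord_eq_iff_same:
  assumes z: "z \<in> cyc"
  shows "coord z i = coord z j \<longleftrightarrow> int (ord z) dvd (j - i)"
proof -
  have "coord z i = coord z j \<longleftrightarrow> snd z [^]\<^bsub>Sym \<Gamma>\<^esub> i = snd z [^]\<^bsub>Sym \<Gamma>\<^esub> j"
  proof
    assume eq: "coord z i = coord z j"
    show "snd z [^]\<^bsub>Sym \<Gamma>\<^esub> i = snd z [^]\<^bsub>Sym \<Gamma>\<^esub> j"
    proof
      fix \<gamma> show "(snd z [^]\<^bsub>Sym \<Gamma>\<^esub> i) \<gamma> = (snd z [^]\<^bsub>Sym \<Gamma>\<^esub> j) \<gamma>"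
      proof (cases "\<gamma> \<in> terr K \<Gamma> z")
        case True
        then obtain k where k: "\<gamma> = coord z k" using coord_surj[OF z] by blast
        have "(h [^]\<^bsub>Sym \<Gamma>\<^esub> k) (coord z i) = (h [^]\<^bsub>Sym \<Gamma>\<^esub> k) (coord z j)"
          using eq by simp
        then show ?thesis
          using cycle_pow(2)[OF z True] by (simp add: k pow_coord add.commute)
      next
        case False
        then show ?thesis by (simp add: cycle_pow_off[OF z])
      qed
    qed
  next
    assume "snd z [^]\<^bsub>Sym \<Gamma>\<^esub> i = snd z [^]\<^bsub>Sym \<Gamma>\<^esub> j"
    then show "coord z i = coord z j" using coord_cycle[OF z] by metis
  qed
  also have "\<dots> \<longleftrightarrow> int (ord z) dvd (j - i)"
    using group.int_pow_eq[OF group_Sym, of "snd z" \<Gamma> i j] cycle_permutes_\<Gamma>[OF z] by simp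
  finally show ?thesis .
qed

lemma coord_cycle_unique:
  assumes "z \<in> cyc" "z' \<in> cyc" "coord z i = coord z' j" shows "z = z'"
  using cycle_eqI[OF group_K finite_\<Gamma> w_full assms(1,2) coord_terr[OF assms(1)]] coord_terr[OF assms(2)]
    assms(3) by metis

lemma coord_eq_iff:
  assumes "z \<in> cyc" "z' \<in> cyc"
  shows "coord z i = coord z' j \<longleftrightarrow> z = z' \<and> int (ord z) dvd (j - i)"
  using coord_cycle_unique[OF assms] coord_eq_iff_same[OF assms(1)] by metis

lemma terr_w_coord:
  assumes "\<gamma> \<in> terr K \<Gamma> w"
  obtains z j where "z \<in> cyc" "\<gamma> = coord z j"
  using cycle_through[OF group_K finite_\<Gamma> w_full assms] coord_surj by metis

text \<open>
  The coordinates \<open>0, \<dots>, ord z - 1\<close> may be shifted by any integer \<open>e\<close> and still reach every point of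
  the cycle. The parametrisation \<open>\<Phi>\<close> uses the shift by \<open>e\<^sub>z\<close>.
\<close>

lemma coord_shifted:
  assumes z: "z \<in> cyc"
  obtains j where "j < ord z" "coord z i = coord z (int j - e)"
proof
  let ?j = "nat ((i + e) mod int (ord z))"
  have pos: "0 < int (ord z)" using ord_pos[OF z] by simp
  then show "?j < ord z"
    by (simp add: nat_less_iff)
  have "int ?j = (i + e) mod int (ord z)"
    using pos by simp
  then have "int ?j - e - i = - ((i + e) - (i + e) mod int (ord z))" by simp
  then have "int (ord z) dvd (int ?j - e - i)"
    by (simp only: dvd_minus_iff dvd_minus_mod)
  then show "coord z i = coord z (int ?j - e)"
    by (simp add: coord_eq_iff_same[OF z])
qed

lemma nat_coord:
  assumes "z \<in> cyc" "\<gamma> \<in> terr K \<Gamma> z"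
  obtains j where "j < ord z" "\<gamma> = coord z (int j)"
  using coord_surj[OF assms] coord_shifted[OF assms(1), of _ 0] by (metis diff_0_right)

lemma f_coord:
  assumes z: "z \<in> cyc"
  shows "f (coord z j) = (if int (ord z) dvd j then base z else \<one>\<^bsub>K\<^esub>)"
proof (cases "int (ord z) dvd j")
  case True
  then have "coord z j = coord z 0" by (simp add: coord_eq_iff_same[OF z])
  then show ?thesis using True by (simp add: coord_0)
next
  case False
  then have "coord z j \<noteq> coord z 0" by (simp add: coord_eq_iff_same[OF z])
  then have "coord z j \<in> terr K \<Gamma> z - {pt z}" using coord_terr[OF z] by (simp add: coord_0)
  then show ?thesis using choices z False by (auto simp: admissible_choices_def)
qed

lemma base_carrier: "z \<in> cyc \<Longrightarrow> base z \<in> carrier K"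
  using f_carrier coord_\<Gamma>[of z 0] by (simp add: coord_0)

text \<open>
  By sparseness only one factor of the Yade is non-trivial, so the load of a cycle is determined by
  the entry at the chosen point.
\<close>

lemma load_eq:
  assumes z: "z \<in> cyc"
  shows "ld z = (conj_class K (base z), ord z)"
proof -
  define \<alpha> where "\<alpha> = (SOME \<alpha>. \<alpha> \<in> terr K \<Gamma> z)"
  have "\<alpha> \<in> terr K \<Gamma> z" unfolding \<alpha>_def by (rule someI[of "\<lambda>\<alpha>. \<alpha> \<in> terr K \<Gamma> z", OF pt_terr[OF z]])
  then obtain k where k: "k < ord z" "\<alpha> = coord z (int k)" by (rule nat_coord[OF z])
  have entry: "fst z ((snd z [^]\<^bsub>Sym \<Gamma>\<^esub> i) \<alpha>) = (if ord z dvd k + i then base z else \<one>\<^bsub>K\<^esub>)"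
    for i :: nat
  proof -
    have "(snd z [^]\<^bsub>Sym \<Gamma>\<^esub> i) \<alpha> = (snd z [^]\<^bsub>Sym \<Gamma>\<^esub> int i) \<alpha>"
      by (simp add: int_pow_int)
    also have "\<dots> = coord z (int (k + i))"
      using cycle_pow(2)[OF z \<open>\<alpha> \<in> terr K \<Gamma> z\<close>] by (simp add: k pow_coord)
    finally show ?thesis
      using cycle_agrees(1)[OF group_K finite_\<Gamma> w_full z coord_terr[OF z]] f_coord[OF z]
      by (simp only: of_nat_dvd_iff)
  qed
  (* the position at which the orbit starting in \<alpha> meets the chosen point *)
  define i0 where "i0 = (if k = 0 then 0 else ord z - k)"
  have i0: "i0 < ord z" "ord z dvd k + i0"
    using k ord_pos[OF z] by (auto simp: i0_def)
  have "yade K \<Gamma> \<alpha> z = (if ord z dvd k + i0 then base z else \<one>\<^bsub>K\<^esub>)"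
    unfolding yade_def entry
  proof (rule list_prod_single[OF group_K])
    fix i assume i: "i \<in> set [0..<ord z]" "i \<noteq> i0"
    have "\<not> ord z dvd k + i"
    proof
      assume "ord z dvd k + i"
      then have "int (ord z) dvd int (k + i) - int (k + i0)"
        using i0(2) by (intro dvd_diff) (simp_all only: of_nat_dvd_iff)
      then have "int (ord z) dvd int i - int i0" by simp
      moreover have "\<bar>int i - int i0\<bar> < int (ord z)" using i i0 by auto
      ultimately show False using i(2) dvd_imp_le_int[of "int i - int i0" "int (ord z)"] by auto
    qed
    then show "(if ord z dvd k + i then base z else \<one>\<^bsub>K\<^esub>) = \<one>\<^bsub>K\<^esub>" by simp
  qed (use i0 base_carrier[OF z] in auto)
  then show ?thesis
    using i0 by (simp add: load_def \<alpha>_def)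
qed

lemma cyc_ld_iff: "z \<in> cyc_ld L \<longleftrightarrow> z \<in> cyc \<and> ld z = L"
  by (simp add: cycles_of_load_def)

lemma ld_loads: "z \<in> cyc \<Longrightarrow> ld z \<in> loads K \<Gamma> w"
  by (simp add: loads_def)

lemma finite_cyc_ld: "finite (cyc_ld L)"
  by (rule finite_subset[OF _ finite_cyc]) (auto simp: cyc_ld_iff)

lemma ord_load: "ld z = ld z' \<Longrightarrow> ord z = ord z'"
  by (simp add: load_def)

lemma rep_cyc: "L \<in> loads K \<Gamma> w \<Longrightarrow> rep L \<in> cyc"
  using choices by (auto simp: admissible_choices_def cyc_ld_iff)

lemma x_carrier: "z \<in> cyc \<Longrightarrow> x z \<in> carrier K"
  and base_conj: "z \<in> cyc \<Longrightarrow> base z = inv\<^bsub>K\<^esub> x z \<otimes>\<^bsub>K\<^esub> base (rep (ld z)) \<otimes>\<^bsub>K\<^esub> x z"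
proof -
  assume z: "z \<in> cyc"
  then have L: "rep (ld z) \<in> cyc_ld (ld z)" "x (rep (ld z)) = \<one>\<^bsub>K\<^esub>"
    "\<And>y. y \<in> cyc_ld (ld z) - {rep (ld z)} \<Longrightarrow> x y \<in> carrier K \<and>
       base y = inv\<^bsub>K\<^esub> x y \<otimes>\<^bsub>K\<^esub> base (rep (ld z)) \<otimes>\<^bsub>K\<^esub> x y"
    using choices ld_loads[OF z] by (auto simp: admissible_choices_def)
  have "x z \<in> carrier K \<and> base z = inv\<^bsub>K\<^esub> x z \<otimes>\<^bsub>K\<^esub> base (rep (ld z)) \<otimes>\<^bsub>K\<^esub> x z"
  proof (cases "z = rep (ld z)")
    case True
    then have "x z = \<one>\<^bsub>K\<^esub>" "base (rep (ld z)) = base z" using L(2) by auto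
    then show ?thesis using base_carrier[OF z] by simp
  next
    case False
    then show ?thesis using L(3)[of z] z by (simp add: cyc_ld_iff)
  qed
  then show "x z \<in> carrier K" and "base z = inv\<^bsub>K\<^esub> x z \<otimes>\<^bsub>K\<^esub> base (rep (ld z)) \<otimes>\<^bsub>K\<^esub> x z" by auto
qed


section \<open>The stabiliser of the territory decomposition\<close>

definition commutes :: "('g \<Rightarrow> 'g) \<Rightarrow> bool" where
  "commutes t \<longleftrightarrow> (\<forall>\<gamma>. t (h \<gamma>) = h (t \<gamma>))"

text \<open>
  On the territory of \<open>w\<close>, a permutation commuting with \<open>h\<close> is known once the images of the chosen
  points are known. Here \<open>\<sigma>\<close> records the cycle to which each cycle is sent, and \<open>e\<close> the position of
  the image of the chosen point on that cycle.
\<close>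

definition shifts ::
  "('g \<Rightarrow> 'g) \<Rightarrow> (('k, 'g) wr \<Rightarrow> ('k, 'g) wr) \<Rightarrow> (('k, 'g) wr \<Rightarrow> nat) \<Rightarrow> bool" where
  "shifts t \<sigma> e \<longleftrightarrow>
     (\<forall>z\<in>cyc. \<sigma> z \<in> cyc \<and> ld (\<sigma> z) = ld z \<and> e z < ord z \<and> t (pt z) = coord (\<sigma> z) (int (e z)))"

abbreviation St where "St \<equiv> stab_group K \<Gamma> H w"

lemma commutes_coord:
  assumes t: "t permutes \<Gamma>" "commutes t" and "t (pt z) = coord z' i"
  shows "t (coord z j) = coord z' (j + i)"
proof -
  have "t (coord z j) = (h [^]\<^bsub>Sym \<Gamma>\<^esub> j) (t (pt z))"
    unfolding coord_def
    using int_pow_Sym_intertwine[OF h_permutes h_permutes, of UNIV t "pt z" j] t(2)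
    by (auto simp: commutes_def)
  then show ?thesis by (simp add: assms(3) pow_coord add.commute)
qed

lemma shifts_coord:
  assumes "t permutes \<Gamma>" "commutes t" "shifts t \<sigma> e" "z \<in> cyc"
  shows "t (coord z j) = coord (\<sigma> z) (j + int (e z))"
  using commutes_coord[OF assms(1,2)] assms(3,4) by (auto simp: shifts_def)

lemma commutes_terr:
  assumes t: "t permutes \<Gamma>" "commutes t" and z: "z \<in> cyc" "z' \<in> cyc"
    and "t (pt z) \<in> terr K \<Gamma> z'"
  shows "t ` terr K \<Gamma> z = terr K \<Gamma> z'"
proof -
  obtain i where i: "t (pt z) = coord z' i" using coord_surj[OF z(2) assms(5)] .
  note tc = commutes_coord[OF t i]
  show ?thesis
  proof (rule subset_antisym; rule subsetI)
    fix \<gamma> assume "\<gamma> \<in> t ` terr K \<Gamma> z"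
    then obtain j where "\<gamma> = t (coord z j)" using coord_surj[OF z(1)] by blast
    then show "\<gamma> \<in> terr K \<Gamma> z'" using tc coord_terr[OF z(2)] by simp
  next
    fix \<gamma> assume "\<gamma> \<in> terr K \<Gamma> z'"
    then obtain j where "\<gamma> = coord z' j" using coord_surj[OF z(2)] by blast
    then have "\<gamma> = t (coord z (j - i))" using tc by simp
    then show "\<gamma> \<in> t ` terr K \<Gamma> z" using coord_terr[OF z(1)] by blast
  qed
qed

lemma carrier_St_decomp:
  "t \<in> carrier St \<longleftrightarrow> t \<in> H \<and> commutes t \<and>
     (\<forall>L\<in>loads K \<Gamma> w. image t ` terr K \<Gamma> ` cyc_ld L = terr K \<Gamma> ` cyc_ld L)"
proof -
  have "family_act (loads K \<Gamma> w) t (terr_decomp K \<Gamma> w) = terr_decomp K \<Gamma> w \<longleftrightarrow>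
     (\<forall>L\<in>loads K \<Gamma> w. image t ` terr K \<Gamma> ` cyc_ld L = terr K \<Gamma> ` cyc_ld L)"
    (is "?l \<longleftrightarrow> ?r")
  proof -
    have act: "family_act (loads K \<Gamma> w) t (terr_decomp K \<Gamma> w) =
        (\<lambda>L\<in>loads K \<Gamma> w. image t ` terr K \<Gamma> ` cyc_ld L)"
      by (rule ext) (simp add: family_act_def terr_decomp_def restrict_def)
    show ?thesis
    proof
      assume ?l
      show ?r
      proof
        fix L assume "L \<in> loads K \<Gamma> w"
        then show "image t ` terr K \<Gamma> ` cyc_ld L = terr K \<Gamma> ` cyc_ld L"
          using fun_cong[OF \<open>?l\<close>[unfolded act, unfolded terr_decomp_def], of L] by simp
      qed
    next
      assume ?r
      then show ?l
        unfolding act unfolding terr_decomp_def by (intro restrict_ext) (rule bspec)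
    qed
  qed
  then show ?thesis
    by (auto simp: stab_group_def cent_group_def centraliser_def stabilizer_def commutes_def
        fun_eq_iff)
qed

text \<open>
  An injective map of the finite set of territories of a given load into itself permutes it, and as
  \<open>t\<close> commutes with \<open>h\<close>, the image of a territory can be recognised from the image of one point.
\<close>

lemma carrier_St_iff:
  "t \<in> carrier St \<longleftrightarrow> t \<in> H \<and> commutes t \<and>
     (\<forall>z\<in>cyc. \<exists>z'\<in>cyc. ld z' = ld z \<and> t (pt z) \<in> terr K \<Gamma> z')"
  (is "_ \<longleftrightarrow> _ \<and> _ \<and> ?P")
proof -
  have "(\<forall>L\<in>loads K \<Gamma> w. image t ` terr K \<Gamma> ` cyc_ld L = terr K \<Gamma> ` cyc_ld L) \<longleftrightarrow> ?P"
    if t: "t \<in> H" "commutes t"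
  proof
    assume eq: "\<forall>L\<in>loads K \<Gamma> w. image t ` terr K \<Gamma> ` cyc_ld L = terr K \<Gamma> ` cyc_ld L"
    show ?P
    proof
      fix z assume z: "z \<in> cyc"
      then have "t ` terr K \<Gamma> z \<in> image t ` terr K \<Gamma> ` cyc_ld (ld z)"
        by (auto simp: cyc_ld_iff)
      also have "\<dots> = terr K \<Gamma> ` cyc_ld (ld z)" using eq ld_loads[OF z] by blast
      finally obtain z' where "z' \<in> cyc_ld (ld z)" "t ` terr K \<Gamma> z = terr K \<Gamma> z'" by auto
      then show "\<exists>z'\<in>cyc. ld z' = ld z \<and> t (pt z) \<in> terr K \<Gamma> z'"
        using pt_terr[OF z] by (auto simp: cyc_ld_iff)
    qed
  next
    assume P: ?P
    show "\<forall>L\<in>loads K \<Gamma> w. image t ` terr K \<Gamma> ` cyc_ld L = terr K \<Gamma> ` cyc_ld L"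
    proof
      fix L
      show "image t ` terr K \<Gamma> ` cyc_ld L = terr K \<Gamma> ` cyc_ld L"
      proof (rule endo_inj_surj)
        show "finite (terr K \<Gamma> ` cyc_ld L)" using finite_cyc_ld by simp
        have "inj t" using H_permutes[OF t(1)] by (rule permutes_inj)
        then show "inj_on (image t) (terr K \<Gamma> ` cyc_ld L)"
          by (meson inj_image_eq_iff inj_onI)
        show "image t ` terr K \<Gamma> ` cyc_ld L \<subseteq> terr K \<Gamma> ` cyc_ld L"
        proof
          fix T assume "T \<in> image t ` terr K \<Gamma> ` cyc_ld L"
          then obtain z where z: "z \<in> cyc" "ld z = L" "T = t ` terr K \<Gamma> z"
            by (auto simp: cyc_ld_iff)
          then obtain z' where "z' \<in> cyc" "ld z' = L" "t (pt z) \<in> terr K \<Gamma> z'" using P by metis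
          then show "T \<in> terr K \<Gamma> ` cyc_ld L"
            using commutes_terr[OF H_permutes[OF t(1)] t(2) z(1)] z(3) by (auto simp: cyc_ld_iff)
        qed
      qed
    qed
  qed
  then show ?thesis
    unfolding carrier_St_decomp by (intro conj_cong refl)
qed

lemma St_H: "t \<in> carrier St \<Longrightarrow> t \<in> H"
  and St_commutes: "t \<in> carrier St \<Longrightarrow> commutes t"
  and St_image: "t \<in> carrier St \<Longrightarrow>
    \<forall>z\<in>cyc. \<exists>z'\<in>cyc. ld z' = ld z \<and> t (pt z) \<in> terr K \<Gamma> z'"
  by (drule carrier_St_iff[THEN iffD1], elim conjE, assumption)+

lemma St_permutes: "t \<in> carrier St \<Longrightarrow> t permutes \<Gamma>"
  by (rule H_permutes[OF St_H])

lemma St_shifts: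
  assumes t: "t \<in> carrier St" obtains \<sigma> e where "shifts t \<sigma> e"
proof -
  have "\<exists>z'. \<exists>i. z' \<in> cyc \<and> ld z' = ld z \<and> i < ord z \<and> t (pt z) = coord z' (int i)"
    if z: "z \<in> cyc" for z
  proof -
    have "\<exists>z'\<in>cyc. ld z' = ld z \<and> t (pt z) \<in> terr K \<Gamma> z'"
      by (rule bspec[OF St_image[OF t] z])
    then show ?thesis
    proof (elim bexE conjE)
      fix z' assume z': "z' \<in> cyc" "ld z' = ld z" "t (pt z) \<in> terr K \<Gamma> z'"
      obtain i where "i < ord z'" "t (pt z) = coord z' (int i)"
        by (rule nat_coord[OF z'(1,3)])
      then show ?thesis
        using z'(1,2) ord_load[OF z'(2)] by (intro exI[of _ z'] exI[of _ i]) simp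
    qed
  qed
  then have "\<forall>z\<in>cyc. \<exists>z'. \<exists>i. z' \<in> cyc \<and> ld z' = ld z \<and> i < ord z \<and> t (pt z) = coord z' (int i)"
    by (rule ballI)
  then obtain \<sigma> where \<sigma>: "\<forall>z\<in>cyc. \<exists>i. \<sigma> z \<in> cyc \<and> ld (\<sigma> z) = ld z \<and> i < ord z \<and>
      t (pt z) = coord (\<sigma> z) (int i)"
    by (rule bchoice[THEN exE])
  then obtain e where "\<forall>z\<in>cyc. \<sigma> z \<in> cyc \<and> ld (\<sigma> z) = ld z \<and> e z < ord z \<and>
      t (pt z) = coord (\<sigma> z) (int (e z))"
    by (rule bchoice[THEN exE])
  then show thesis by (intro that) (simp only: shifts_def)
qed

lemma shifts_id: "shifts id (\<lambda>z. z) (\<lambda>_. 0)"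
  unfolding shifts_def by (intro ballI) (simp add: coord_0 ord_pos)

lemma shifts_permutes:
  assumes t: "t permutes \<Gamma>" "commutes t" and sh: "shifts t \<sigma> e"
  shows "(\<lambda>z. if z \<in> cyc_ld L then \<sigma> z else z) permutes cyc_ld L"
proof (rule bij_imp_permutes)
  have inj: "inj_on \<sigma> (cyc_ld L)"
  proof (rule inj_onI)
    fix y z assume yz: "y \<in> cyc_ld L" "z \<in> cyc_ld L" "\<sigma> y = \<sigma> z"
    then have y: "y \<in> cyc" and z: "z \<in> cyc" by (auto simp: cyc_ld_iff)
    have "t (coord y (int (e z) - int (e y))) = t (coord z 0)"
      using shifts_coord[OF t sh y] shifts_coord[OF t sh z] yz(3) by simp
    then have "coord y (int (e z) - int (e y)) = coord z 0"
      using permutes_inj[OF t(1)] by (simp add: inj_eq)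
    then show "y = z" by (rule coord_cycle_unique[OF y z])
  qed
  have "\<sigma> ` cyc_ld L \<subseteq> cyc_ld L"
    using sh by (auto simp: shifts_def cyc_ld_iff)
  then have "\<sigma> ` cyc_ld L = cyc_ld L" using inj by (rule endo_inj_surj[OF finite_cyc_ld])
  then show "bij_betw (\<lambda>z. if z \<in> cyc_ld L then \<sigma> z else z) (cyc_ld L) (cyc_ld L)"
    using inj by (auto simp: bij_betw_def inj_on_def)
qed simp

lemma Psi_unfold:
  "Psi K \<Gamma> w pt L \<tau> = (THE p. p permutes \<Gamma> \<and>
     (\<forall>z\<in>cyc_ld L. \<forall>j::int. p (coord z j) = coord (\<tau> z) j) \<and>
     (\<forall>\<gamma>. (\<forall>z\<in>cyc_ld L. \<forall>j::int. \<gamma> \<noteq> coord z j) \<longrightarrow> p \<gamma> = \<gamma>))"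
  if "\<tau> permutes cyc_ld L"
proof -
  have "\<tau> z \<in> cyc" "z \<in> cyc" if "z \<in> cyc_ld L" for z
    using permutes_in_image[OF \<open>\<tau> permutes cyc_ld L\<close>, of z] that by (auto simp: cyc_ld_iff)
  then show ?thesis
    unfolding Psi_def by (simp add: coord_cycle cong: ball_cong)
qed

text \<open>
  Cycles of the same load have the same length, so sending the point with a given coordinate on \<open>z\<close>
  to the point with the same coordinate on \<open>\<tau> z\<close> is well defined.
\<close>

lemma Psi_spec:
  assumes \<tau>: "\<tau> permutes cyc_ld L"
  shows "Psi K \<Gamma> w pt L \<tau> permutes \<Gamma> \<and>
     (\<forall>z\<in>cyc_ld L. \<forall>j::int. Psi K \<Gamma> w pt L \<tau> (coord z j) = coord (\<tau> z) j) \<and>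
     (\<forall>\<gamma>. (\<forall>z\<in>cyc_ld L. \<forall>j::int. \<gamma> \<noteq> coord z j) \<longrightarrow> Psi K \<Gamma> w pt L \<tau> \<gamma> = \<gamma>)"
    (is "?S (Psi K \<Gamma> w pt L \<tau>)")
proof -
  have cl: "z \<in> cyc" "\<tau> z \<in> cyc" "\<tau> z \<in> cyc_ld L" "ord (\<tau> z) = ord z" if "z \<in> cyc_ld L" for z
    using permutes_in_image[OF \<tau>, of z] that ord_load[of "\<tau> z" z] by (auto simp: cyc_ld_iff)
  define on where "on \<gamma> \<longleftrightarrow> (\<exists>z j. z \<in> cyc_ld L \<and> \<gamma> = coord z j)" for \<gamma>
  define p where "p \<gamma> = (if on \<gamma> then
      (THE \<delta>. \<exists>z j. z \<in> cyc_ld L \<and> \<gamma> = coord z j \<and> \<delta> = coord (\<tau> z) j) else \<gamma>)" for \<gamma>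
  have p_coord: "p (coord z j) = coord (\<tau> z) j" if z: "z \<in> cyc_ld L" for z j
  proof -
    have "on (coord z j)" using z on_def by blast
    moreover have "(THE \<delta>. \<exists>z' j'. z' \<in> cyc_ld L \<and> coord z j = coord z' j' \<and> \<delta> = coord (\<tau> z') j')
      = coord (\<tau> z) j"
    proof (rule the_equality)
      show "\<exists>z' j'. z' \<in> cyc_ld L \<and> coord z j = coord z' j' \<and> coord (\<tau> z) j = coord (\<tau> z') j'"
        using z by blast
    next
      fix \<delta> assume "\<exists>z' j'. z' \<in> cyc_ld L \<and> coord z j = coord z' j' \<and> \<delta> = coord (\<tau> z') j'"
      then obtain z' j' where z': "z' \<in> cyc_ld L" "coord z j = coord z' j'" "\<delta> = coord (\<tau> z') j'"
        by blast
      then have "z = z'" "int (ord z) dvd j' - j"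
        using coord_eq_iff[OF cl(1)[OF z] cl(1)[OF z'(1)]] by auto
      then show "\<delta> = coord (\<tau> z) j"
        using coord_eq_iff_same[OF cl(2)[OF z], of j j'] z' cl(4)[OF z] by simp
    qed
    ultimately show ?thesis by (simp add: p_def)
  qed
  have p_off: "p \<gamma> = \<gamma>" if "\<not> on \<gamma>" for \<gamma> using that by (simp add: p_def)
  have on_p: "on (p \<gamma>) \<longleftrightarrow> on \<gamma>" for \<gamma>
  proof (cases "on \<gamma>")
    case True
    then obtain z j where "z \<in> cyc_ld L" "\<gamma> = coord z j" by (auto simp: on_def)
    then have "on (p \<gamma>)" unfolding on_def using p_coord cl(3) by metis
    then show ?thesis using True by simp
  qed (simp add: p_off)
  have "p permutes \<Gamma>"
  proof (rule bij_imp_permutes)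
    have "inj p"
    proof (rule injI)
      fix \<gamma> \<delta> assume eq: "p \<gamma> = p \<delta>"
      show "\<gamma> = \<delta>"
      proof (cases "on \<gamma>")
        case True
        then have "on \<delta>" using on_p eq by metis
        then obtain z j z' j' where z: "z \<in> cyc_ld L" "\<gamma> = coord z j" "z' \<in> cyc_ld L" "\<delta> = coord z' j'"
          using True unfolding on_def by blast
        then have *: "\<tau> z = \<tau> z'" "int (ord (\<tau> z)) dvd j' - j"
          using eq p_coord coord_eq_iff[OF cl(2)[OF z(1)] cl(2)[OF z(3)], of j j'] by auto
        have "z = z'" using *(1) permutes_inj[OF \<tau>] by (simp only: inj_eq)
        moreover have "int (ord z) dvd j' - j" using *(2) cl(4)[OF z(1)] by simp
        ultimately show ?thesis
          using z(2,4) coord_eq_iff[OF cl(1)[OF z(1)] cl(1)[OF z(3)]] by blast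
      next
        case False
        then have "\<not> on \<delta>" using on_p eq by metis
        then show ?thesis using False eq p_off by simp
      qed
    qed
    then have inj: "inj_on p \<Gamma>" by (rule inj_on_subset) simp
    have "p \<gamma> \<in> \<Gamma>" if "\<gamma> \<in> \<Gamma>" for \<gamma>
      using that p_coord coord_\<Gamma> cl p_off unfolding on_def by metis
    then show "bij_betw p \<Gamma> \<Gamma>"
      using endo_inj_surj[OF finite_\<Gamma> _ inj] inj by (auto simp: bij_betw_def)
    show "p \<gamma> = \<gamma>" if "\<gamma> \<notin> \<Gamma>" for \<gamma>
      using that p_off coord_\<Gamma> cl unfolding on_def by metis
  qed
  then have p: "?S p"
    using p_coord p_off unfolding on_def by metis
  have "q = p" if q: "?S q" for q
  proof
    fix \<gamma> show "q \<gamma> = p \<gamma>"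
      using q p by (cases "\<exists>z\<in>cyc_ld L. \<exists>j. \<gamma> = coord z j") auto
  qed
  then have "Psi K \<Gamma> w pt L \<tau> = p"
    unfolding Psi_unfold[OF \<tau>] using p by (intro the_equality) blast+
  then show ?thesis using p by simp
qed

text \<open>
  The product in the definition of \<open>top_factors\<close>, as a function of the factors.
\<close>

definition recompose ::
  "(('k, 'g) wr \<Rightarrow> nat) \<Rightarrow> ('k ld \<Rightarrow> ('k, 'g) wr \<Rightarrow> ('k, 'g) wr) \<Rightarrow> ('g \<Rightarrow> 'g) \<Rightarrow> 'g \<Rightarrow> 'g" where
  "recompose e \<sigma> \<pi>0 = set_prod (Sym \<Gamma>)
     (\<lambda>L. set_prod (Sym \<Gamma>) (\<lambda>z. snd z [^]\<^bsub>Sym \<Gamma>\<^esub> e z) (cyc_ld L) \<otimes>\<^bsub>Sym \<Gamma>\<^esub> Psi K \<Gamma> w pt L (\<sigma> L))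
     (loads K \<Gamma> w) \<otimes>\<^bsub>Sym \<Gamma>\<^esub> \<pi>0"

text \<open>
  Both products run over factors living on disjoint blocks: the single territories for the inner
  one, the unions of the territories of equal load for the outer one. So a point of the territory is
  affected by the power of a single cycle, which adds \<open>e z\<close> to its coordinate, and then by a single
  change of cycle.
\<close>

lemma recompose_apply:
  assumes \<sigma>: "\<And>L. L \<in> loads K \<Gamma> w \<Longrightarrow> \<sigma> L permutes cyc_ld L"
    and \<pi>0: "\<pi>0 permutes (\<Gamma> - terr K \<Gamma> w)"
  shows "z \<in> cyc \<Longrightarrow> recompose e \<sigma> \<pi>0 (coord z j) = coord (\<sigma> (ld z) z) (j + int (e z))"
    and "\<gamma> \<notin> terr K \<Gamma> w \<Longrightarrow> recompose e \<sigma> \<pi>0 \<gamma> = \<pi>0 \<gamma>"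
proof -
  let ?inner = "\<lambda>L. set_prod (Sym \<Gamma>) (\<lambda>z. snd z [^]\<^bsub>Sym \<Gamma>\<^esub> e z) (cyc_ld L)"
  let ?u = "\<lambda>L. ?inner L \<otimes>\<^bsub>Sym \<Gamma>\<^esub> Psi K \<Gamma> w pt L (\<sigma> L)"
  let ?B = "\<lambda>L. \<Union>z\<in>cyc_ld L. terr K \<Gamma> z"
  have pow: "snd z [^]\<^bsub>Sym \<Gamma>\<^esub> e z = snd z [^]\<^bsub>Sym \<Gamma>\<^esub> int (e z)" for z
    by (simp add: int_pow_int)
  have inner: "?inner L permutes \<Gamma>"
    "\<And>z \<gamma>. z \<in> cyc_ld L \<Longrightarrow> \<gamma> \<in> terr K \<Gamma> z \<Longrightarrow> ?inner L \<gamma> = (snd z [^]\<^bsub>Sym \<Gamma>\<^esub> e z) \<gamma>"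
    "\<And>\<gamma>. \<gamma> \<notin> ?B L \<Longrightarrow> ?inner L \<gamma> = \<gamma>" for L
  proof -
    have perm: "(snd z [^]\<^bsub>Sym \<Gamma>\<^esub> e z) permutes \<Gamma>" if "z \<in> cyc_ld L" for z
      using that unfolding pow by (intro int_pow_Sym_permutes cycle_permutes_\<Gamma>) (simp add: cyc_ld_iff)
    have block: "(snd z [^]\<^bsub>Sym \<Gamma>\<^esub> e z) \<gamma> \<in> terr K \<Gamma> z" if "z \<in> cyc_ld L" "\<gamma> \<in> terr K \<Gamma> z" for z \<gamma>
      using that unfolding pow by (intro cycle_pow(1)) (simp_all add: cyc_ld_iff)
    have off: "(snd z [^]\<^bsub>Sym \<Gamma>\<^esub> e z) \<gamma> = \<gamma>" if "z \<in> cyc_ld L" "\<gamma> \<notin> terr K \<Gamma> z" for z \<gamma>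
      using that unfolding pow by (intro cycle_pow_off) (simp_all add: cyc_ld_iff)
    have disj: "terr K \<Gamma> y \<inter> terr K \<Gamma> z = {}" if "y \<in> cyc_ld L" "z \<in> cyc_ld L" "y \<noteq> z" for y z
      using that cycle_eqI[OF group_K finite_\<Gamma> w_full, of y z] by (auto simp: cyc_ld_iff)
    note blocks = set_prod_Sym_blocks[OF finite_cyc_ld perm block off disj]
    show "?inner L permutes \<Gamma>"
      "\<And>z \<gamma>. z \<in> cyc_ld L \<Longrightarrow> \<gamma> \<in> terr K \<Gamma> z \<Longrightarrow> ?inner L \<gamma> = (snd z [^]\<^bsub>Sym \<Gamma>\<^esub> e z) \<gamma>"
      by (rule blocks(1), assumption+) (rule blocks(2), assumption+)
    show "?inner L \<gamma> = \<gamma>" if "\<gamma> \<notin> ?B L" for \<gamma>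
    proof (rule blocks(3))
      show "\<And>z. z \<in> cyc_ld L \<Longrightarrow> \<gamma> \<notin> terr K \<Gamma> z" using that by (simp only: UN_iff) blast
    qed
  qed
  have u_coord: "?u L (coord z j) = coord (\<sigma> L z) (j + int (e z))"
    if L: "L \<in> loads K \<Gamma> w" and z: "z \<in> cyc_ld L" for L z j
  proof -
    have zc: "z \<in> cyc" using z by (simp add: cyc_ld_iff)
    have "?inner L (coord z j) = coord z (j + int (e z))"
      using inner(2)[OF z coord_terr[OF zc]] cycle_pow(2)[OF zc coord_terr[OF zc]]
      by (simp add: pow pow_coord)
    then show ?thesis using Psi_spec[OF \<sigma>[OF L]] z by simp
  qed
  have in_B: "\<exists>z j. z \<in> cyc_ld L \<and> \<gamma> = coord z j" if "\<gamma> \<in> ?B L" for L \<gamma>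
    using that coord_surj by (auto simp: cyc_ld_iff) metis
  have coord_B: "coord z j \<in> ?B L" if "z \<in> cyc_ld L" for z j L
    using that by (intro UN_I[OF that] coord_terr) (simp add: cyc_ld_iff)
  have perm: "?u L permutes \<Gamma>" if "L \<in> loads K \<Gamma> w" for L
    using inner(1)[of L] Psi_spec[OF \<sigma>[OF that]] by (simp add: permutes_compose)
  have block: "?u L \<gamma> \<in> ?B L" if L: "L \<in> loads K \<Gamma> w" and \<gamma>: "\<gamma> \<in> ?B L" for L \<gamma>
  proof -
    obtain z j where z: "z \<in> cyc_ld L" "\<gamma> = coord z j" using in_B[OF \<gamma>] by blast
    have "\<sigma> L z \<in> cyc_ld L"
      using permutes_in_image[OF \<sigma>[OF L]] z(1) by blast
    then show ?thesis unfolding z(2) u_coord[OF L z(1)] by (rule coord_B)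
  qed
  have off: "?u L \<gamma> = \<gamma>" if "L \<in> loads K \<Gamma> w" "\<gamma> \<notin> ?B L" for L \<gamma>
  proof -
    have "\<forall>z\<in>cyc_ld L. \<forall>j. \<gamma> \<noteq> coord z j" using that(2) coord_B by blast
    then show ?thesis using inner(3)[OF that(2)] Psi_spec[OF \<sigma>[OF that(1)]] by simp
  qed
  have disj: "?B L \<inter> ?B L' = {}"
    if "L \<in> loads K \<Gamma> w" "L' \<in> loads K \<Gamma> w" "L \<noteq> L'" for L L'
  proof (rule ccontr)
    assume "?B L \<inter> ?B L' \<noteq> {}"
    then obtain z z' \<gamma> where z: "z \<in> cyc_ld L" "z' \<in> cyc_ld L'"
      and \<gamma>: "\<gamma> \<in> terr K \<Gamma> z" "\<gamma> \<in> terr K \<Gamma> z'" by (auto simp only: ex_in_conv[symmetric] Int_iff UN_iff)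
    have "z = z'"
      using cycle_eqI[OF group_K finite_\<Gamma> w_full _ _ \<gamma>] z by (simp add: cyc_ld_iff)
    then show False using that(3) z by (simp add: cyc_ld_iff)
  qed
  have finL: "finite (loads K \<Gamma> w)" using finite_cyc by (simp add: loads_def)
  have outer_on: "set_prod (Sym \<Gamma>) ?u (loads K \<Gamma> w) \<gamma> = ?u L \<gamma>"
    if "L \<in> loads K \<Gamma> w" "\<gamma> \<in> ?B L" for L \<gamma>
    by (rule set_prod_Sym_blocks(2)[where u = ?u and B = ?B, OF finL perm block off disj that])
  have outer_off: "set_prod (Sym \<Gamma>) ?u (loads K \<Gamma> w) \<gamma> = \<gamma>"
    if "\<And>L. L \<in> loads K \<Gamma> w \<Longrightarrow> \<gamma> \<notin> ?B L" for \<gamma>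
    by (rule set_prod_Sym_blocks(3)[where u = ?u and B = ?B, OF finL perm block off disj that])
  show "recompose e \<sigma> \<pi>0 (coord z j) = coord (\<sigma> (ld z) z) (j + int (e z))" if z: "z \<in> cyc"
  proof -
    have zL: "z \<in> cyc_ld (ld z)" using z by (simp add: cyc_ld_iff)
    have "\<sigma> (ld z) z \<in> cyc"
      using permutes_in_image[OF \<sigma>[OF ld_loads[OF z]], of z] zL by (simp add: cyc_ld_iff)
    then have "coord (\<sigma> (ld z) z) i \<notin> \<Gamma> - terr K \<Gamma> w" for i
      using coord_terr_w by blast
    moreover have "set_prod (Sym \<Gamma>) ?u (loads K \<Gamma> w) (coord z j) = ?u (ld z) (coord z j)"
      by (rule outer_on[OF ld_loads[OF z] coord_B[OF zL]])
    ultimately show ?thesis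
      unfolding recompose_def using u_coord[OF ld_loads[OF z] zL] permutes_not_in[OF \<pi>0] by simp
  qed
  show "recompose e \<sigma> \<pi>0 \<gamma> = \<pi>0 \<gamma>" if "\<gamma> \<notin> terr K \<Gamma> w"
  proof -
    have "\<gamma> \<notin> ?B L" for L
      using that terr_cycle_in_terr by (auto simp: cyc_ld_iff)
    then have "set_prod (Sym \<Gamma>) ?u (loads K \<Gamma> w) \<gamma> = \<gamma>" by (rule outer_off)
    then show ?thesis by (simp add: recompose_def)
  qed
qed

lemma terr_w_invariant:
  assumes t: "t permutes \<Gamma>" "commutes t" and sh: "shifts t \<sigma> e"
  shows "t ` terr K \<Gamma> w = terr K \<Gamma> w"
proof (rule endo_inj_surj)
  show "finite (terr K \<Gamma> w)" using terr_subset[OF w_full] finite_\<Gamma> finite_subset by blast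
  show "t ` terr K \<Gamma> w \<subseteq> terr K \<Gamma> w"
  proof
    fix \<delta> assume "\<delta> \<in> t ` terr K \<Gamma> w"
    then obtain z j where "z \<in> cyc" "\<delta> = t (coord z j)" using terr_w_coord by (metis imageE)
    then show "\<delta> \<in> terr K \<Gamma> w"
      using shifts_coord[OF t sh] coord_terr_w sh by (simp add: shifts_def)
  qed
  show "inj_on t (terr K \<Gamma> w)" using permutes_inj[OF t(1)] inj_on_subset by blast
qed

text \<open>
  Evaluating a factorisation of \<open>t\<close> at the chosen point of \<open>z\<close> yields the point with coordinate
  \<open>e z < ord z\<close> on the cycle \<open>\<sigma> z\<close>, so that \<open>e\<close> and \<open>\<sigma>\<close> are determined by \<open>t\<close>.
\<close>

lemma top_factors_eq:
  assumes t: "t permutes \<Gamma>" "commutes t" and sh: "shifts t \<sigma> e"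
  shows "top_factors K \<Gamma> w pt t =
    (restrict e cyc, (\<lambda>L\<in>loads K \<Gamma> w. \<lambda>z. if z \<in> cyc_ld L then \<sigma> z else z),
     perm_restrict t (\<Gamma> - terr K \<Gamma> w))"
    (is "_ = (?e, ?\<sigma>, ?\<pi>)")
proof -
  let ?Q = "\<lambda>(e, \<sigma>, \<pi>0). e \<in> (\<Pi>\<^sub>E z\<in>cyc. {0..<ord z}) \<and>
     \<sigma> \<in> (\<Pi>\<^sub>E L\<in>loads K \<Gamma> w. carrier (Sym (cyc_ld L))) \<and>
     \<pi>0 \<in> carrier (Sym (\<Gamma> - terr K \<Gamma> w)) \<and> t = recompose e \<sigma> \<pi>0"
  have unfold: "top_factors K \<Gamma> w pt t = The ?Q"
    by (simp add: top_factors_def recompose_def)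
  have \<pi>: "?\<pi> permutes (\<Gamma> - terr K \<Gamma> w)"
  proof (rule bij_imp_permutes)
    have "t ` (\<Gamma> - terr K \<Gamma> w) = \<Gamma> - terr K \<Gamma> w"
      using image_set_diff[OF permutes_inj[OF t(1)], of \<Gamma> "terr K \<Gamma> w"]
        terr_w_invariant[OF t sh] permutes_image[OF t(1)] by simp
    moreover have "inj_on t (\<Gamma> - terr K \<Gamma> w)" using permutes_inj[OF t(1)] inj_on_subset by blast
    ultimately have "bij_betw t (\<Gamma> - terr K \<Gamma> w) (\<Gamma> - terr K \<Gamma> w)" by (simp add: bij_betw_def)
    then show "bij_betw ?\<pi> (\<Gamma> - terr K \<Gamma> w) (\<Gamma> - terr K \<Gamma> w)"
      by (rule bij_betw_cong[THEN iffD1, rotated]) (simp add: perm_restrict_simps)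
  qed (simp add: perm_restrict_simps)
  have \<sigma>: "?\<sigma> L permutes cyc_ld L" if "L \<in> loads K \<Gamma> w" for L
    using shifts_permutes[OF t sh] that by simp
  have "t \<gamma> = recompose ?e ?\<sigma> ?\<pi> \<gamma>" for \<gamma>
  proof (cases "\<gamma> \<in> terr K \<Gamma> w")
    case True
    then obtain z j where z: "z \<in> cyc" "\<gamma> = coord z j" by (rule terr_w_coord)
    then show ?thesis
      using recompose_apply(1)[where \<sigma> = ?\<sigma> and e = ?e, OF \<sigma> \<pi> z(1)] shifts_coord[OF t sh z(1)]
        ld_loads[OF z(1)]
      by (simp add: cyc_ld_iff)
  next
    case False
    then show ?thesis
      using recompose_apply(2)[where \<sigma> = ?\<sigma> and e = ?e, OF \<sigma> \<pi> False] permutes_not_in[OF t(1)]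
      by (simp add: perm_restrict_def)
  qed
  then have "?Q (?e, ?\<sigma>, ?\<pi>)"
    using \<pi> shifts_permutes[OF t sh] sh by (auto simp: shifts_def)
  moreover have "q = (?e, ?\<sigma>, ?\<pi>)" if q: "?Q q" for q
  proof -
    obtain e' \<sigma>' \<pi>' where q': "q = (e', \<sigma>', \<pi>')" by (cases q)
    then have e': "e' \<in> (\<Pi>\<^sub>E z\<in>cyc. {0..<ord z})"
      and \<sigma>': "\<sigma>' \<in> (\<Pi>\<^sub>E L\<in>loads K \<Gamma> w. carrier (Sym (cyc_ld L)))"
      and \<pi>': "\<pi>' permutes (\<Gamma> - terr K \<Gamma> w)" and t': "t = recompose e' \<sigma>' \<pi>'"
      using q by auto
    have \<sigma>'p: "\<sigma>' L permutes cyc_ld L" if "L \<in> loads K \<Gamma> w" for L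
      using \<sigma>' that by auto
    have rec1: "t (coord z j) = coord (\<sigma>' (ld z) z) (j + int (e' z))" if "z \<in> cyc" for z j
      by (subst t', rule recompose_apply(1)[OF \<sigma>'p \<pi>' that])
    have rec2: "t \<gamma> = \<pi>' \<gamma>" if "\<gamma> \<notin> terr K \<Gamma> w" for \<gamma>
      by (subst t', rule recompose_apply(2)[OF \<sigma>'p \<pi>' that])
    have eq: "\<sigma>' (ld z) z = \<sigma> z \<and> e' z = e z" if z: "z \<in> cyc" for z
    proof -
      have \<sigma>'z: "\<sigma>' (ld z) z \<in> cyc" "ld (\<sigma>' (ld z) z) = ld z"
        using permutes_in_image[OF \<sigma>'p[OF ld_loads[OF z]], of z] z by (auto simp: cyc_ld_iff)
      have shz: "\<sigma> z \<in> cyc" "e z < ord z" "t (pt z) = coord (\<sigma> z) (int (e z))"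
        using sh z by (auto simp: shifts_def)
      have "coord (\<sigma>' (ld z) z) (int (e' z)) = coord (\<sigma> z) (int (e z))"
        using rec1[OF z, of 0] shz(3) by (simp add: coord_0)
      then have *: "\<sigma>' (ld z) z = \<sigma> z" "int (ord z) dvd int (e z) - int (e' z)"
        using coord_eq_iff[OF \<sigma>'z(1) shz(1)] ord_load[OF \<sigma>'z(2)] by auto
      have "e' z < ord z" using e' z by auto
      then have "\<bar>int (e z) - int (e' z)\<bar> < int (ord z)" using shz(2) by auto
      then have "e' z = e z"
        using *(2) dvd_imp_le_int[of "int (e z) - int (e' z)" "int (ord z)"]
        by (cases "e z = e' z") auto
      then show ?thesis using * by simp
    qed
    have "e' = ?e"
      using eq e' by (auto simp: fun_eq_iff restrict_def PiE_def extensional_def)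
    moreover have "\<sigma>' = ?\<sigma>"
    proof (rule PiE_ext[OF \<sigma>'])
      show "?\<sigma> \<in> (\<Pi>\<^sub>E L\<in>loads K \<Gamma> w. carrier (Sym (cyc_ld L)))"
        using \<sigma> by auto
      fix L assume L: "L \<in> loads K \<Gamma> w"
      show "\<sigma>' L = ?\<sigma> L"
      proof
        fix z show "\<sigma>' L z = ?\<sigma> L z"
          using L eq[of z] permutes_not_in[OF \<sigma>'p[OF L]] by (auto simp: cyc_ld_iff)
      qed
    qed
    moreover have "\<pi>' = ?\<pi>"
    proof
      fix \<gamma> show "\<pi>' \<gamma> = ?\<pi> \<gamma>"
        using rec2[of \<gamma>] permutes_not_in[OF \<pi>'] by (auto simp: perm_restrict_def)
    qed
    ultimately show ?thesis using q' by simp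
  qed
  ultimately show ?thesis
    unfolding unfold by (intro the_equality) blast+
qed

end


section \<open>Centralisers and group extensions\<close>

lemma list_prod_snoc:
  assumes "group G" "set xs \<subseteq> carrier G" "a \<in> carrier G"
  shows "list_prod G (xs @ [a]) = list_prod G xs \<otimes>\<^bsub>G\<^esub> a"
    and "list_prod G xs \<in> carrier G"
proof -
  interpret group G by fact
  have "list_prod G xs \<in> carrier G \<and> list_prod G (xs @ [a]) = list_prod G xs \<otimes>\<^bsub>G\<^esub> a"
    using assms(2)
    by (induction xs) (use assms(3) in \<open>auto simp: list_prod_def m_assoc\<close>)
  then show "list_prod G (xs @ [a]) = list_prod G xs \<otimes>\<^bsub>G\<^esub> a"
    and "list_prod G xs \<in> carrier G" by auto
qed

text \<open>
  The relation \<open>step\<close> is the commutation relation of a centralising element along an orbit. It is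
  what makes products around an orbit conjugate.
\<close>

lemma list_prod_telescope:
  fixes G (structure) and m :: nat
  assumes "group G" and S: "\<And>j. S j \<in> carrier G" and a: "\<And>j. a j \<in> carrier G"
    and b: "\<And>j. b j \<in> carrier G" and step: "\<And>j. S j \<otimes>\<^bsub>G\<^esub> a j = b j \<otimes>\<^bsub>G\<^esub> S (Suc j)"
  shows "S 0 \<otimes>\<^bsub>G\<^esub> list_prod G (map a [0..<m]) = list_prod G (map b [0..<m]) \<otimes>\<^bsub>G\<^esub> S m"
proof -
  interpret group G by fact
  show ?thesis
  proof (induction m)
    case 0
    then show ?case using S[of 0] by (simp add: list_prod_def)
  next
    case (Suc m)
    have a': "set (map a [0..<m]) \<subseteq> carrier G" and b': "set (map b [0..<m]) \<subseteq> carrier G"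
      using a b by auto
    note A = list_prod_snoc[OF \<open>group G\<close> a' a[of m]] and B = list_prod_snoc[OF \<open>group G\<close> b' b[of m]]
    have "S 0 \<otimes> list_prod G (map a [0..<Suc m]) = (S 0 \<otimes> list_prod G (map a [0..<m])) \<otimes> a m"
      using A S a by (simp add: m_assoc)
    also have "\<dots> = list_prod G (map b [0..<m]) \<otimes> (S m \<otimes> a m)"
      using B S a Suc by (simp add: m_assoc)
    also have "\<dots> = list_prod G (map b [0..<Suc m]) \<otimes> S (Suc m)"
      using B S b step by (simp add: m_assoc)
    finally show ?case .
  qed
qed

lemma subgroup_centraliser:
  fixes G (structure)
  assumes "group G" "a \<in> carrier G" shows "subgroup (centraliser G a) G"
proof -
  interpret group G by fact
  show ?thesis
  proof (rule subgroupI)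
    fix b assume "b \<in> centraliser G a"
    then have b: "b \<in> carrier G" "b \<otimes> a = a \<otimes> b" by (auto simp: centraliser_def)
    have "inv b \<otimes> a = inv b \<otimes> (a \<otimes> b) \<otimes> inv b"
      using b(1) assms(2) by (simp add: m_assoc)
    also have "\<dots> = inv b \<otimes> (b \<otimes> a) \<otimes> inv b" by (simp only: b(2))
    also have "\<dots> = a \<otimes> inv b"
      using b(1) assms(2) by (simp flip: m_assoc)
    finally show "inv b \<in> centraliser G a" using b by (simp add: centraliser_def)
    fix c assume "c \<in> centraliser G a"
    then have c: "c \<in> carrier G" "c \<otimes> a = a \<otimes> c" by (auto simp: centraliser_def)
    have "b \<otimes> c \<otimes> a = b \<otimes> (a \<otimes> c)" using b c assms(2) by (simp add: m_assoc)
    also have "\<dots> = a \<otimes> b \<otimes> c" using b c assms(2) by (simp flip: m_assoc)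
    finally show "b \<otimes> c \<in> centraliser G a"
      using b c assms(2) by (simp add: centraliser_def m_assoc)
  qed (use assms in \<open>auto simp: centraliser_def\<close>)
qed

lemma group_cent_group:
  assumes "group G" "a \<in> carrier G" shows "group (cent_group G a)"
  unfolding cent_group_def
  by (rule subgroup.subgroup_is_group[OF subgroup_centraliser[OF assms] assms(1)])

text \<open>
  An element of the middle group can be corrected by a product of the chosen preimages so that it
  falls into the kernel of \<open>p\<close>, which is generated by the image of \<open>U\<close>.
\<close>

lemma short_exact_generate:
  assumes ex: "short_exact A B C i p"
    and U: "carrier A = generate A U" and V: "carrier C = generate C V"
    and q: "\<And>t. t \<in> V \<Longrightarrow> q t \<in> carrier B" "\<And>t. t \<in> V \<Longrightarrow> p (q t) = t"
  shows "carrier B = generate B (i ` U \<union> q ` V)"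
proof
  interpret i: group_hom A B i using ex by (simp add: short_exact_def)
  interpret p: group_hom B C p using ex by (simp add: short_exact_def)
  have ker: "i ` carrier A = kernel B C p" using ex by (simp add: short_exact_def)
  have Uc: "U \<subseteq> carrier A" using U generate.incl[of _ U A] by blast
  have gen: "i ` U \<union> q ` V \<subseteq> carrier B" using Uc q(1) by auto
  then show "generate B (i ` U \<union> q ` V) \<subseteq> carrier B"
    by (rule i.H.generate_incl)
  have sub: "subgroup (generate B (i ` U \<union> q ` V)) B"
    by (rule i.H.generate_is_subgroup[OF gen])
  have "p ` q ` V = V" using q(2) by (force simp: image_image)
  then have "generate C V = p ` generate B (q ` V)"
    using p.generate_img[of "q ` V"] q(1) by auto
  then have surj: "carrier C \<subseteq> p ` generate B (i ` U \<union> q ` V)"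
    using V i.H.mono_generate[of "q ` V" "i ` U \<union> q ` V"] by blast
  have "kernel B C p = generate B (i ` U)"
    using ker U i.generate_img[OF Uc] by simp
  then have kersub: "kernel B C p \<subseteq> generate B (i ` U \<union> q ` V)"
    using i.H.mono_generate[of "i ` U" "i ` U \<union> q ` V"] by blast
  show "carrier B \<subseteq> generate B (i ` U \<union> q ` V)"
  proof
    fix b assume b: "b \<in> carrier B"
    then have "p b \<in> carrier C" by simp
    then obtain d where d: "d \<in> generate B (i ` U \<union> q ` V)" "p b = p d" using surj by blast
    have dB: "d \<in> carrier B" using d(1) subgroup.subset[OF sub] by blast
    have "b \<otimes>\<^bsub>B\<^esub> inv\<^bsub>B\<^esub> d \<in> kernel B C p"
      using b dB d(2) by (simp add: kernel_def)
    then have "b \<otimes>\<^bsub>B\<^esub> inv\<^bsub>B\<^esub> d \<in> generate B (i ` U \<union> q ` V)" using kersub by blast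
    then have "b \<otimes>\<^bsub>B\<^esub> inv\<^bsub>B\<^esub> d \<otimes>\<^bsub>B\<^esub> d \<in> generate B (i ` U \<union> q ` V)"
      using d(1) subgroup.m_closed[OF sub] by blast
    then show "b \<in> generate B (i ` U \<union> q ` V)"
      using b dB by (simp add: i.H.m_assoc)
  qed
qed

lemma subgroup_wreath:
  assumes K: "group K" and H: "subgroup H (Sym \<Gamma>)"
  shows "subgroup (carrier (wreath K \<Gamma> H)) (wreath_full K \<Gamma>)"
proof -
  interpret W: group "wreath_full K \<Gamma>" by (rule group_wreath_full[OF K])
  have car: "b \<in> carrier (wreath K \<Gamma> H) \<longleftrightarrow> b \<in> carrier (wreath_full K \<Gamma>) \<and> snd b \<in> H" for b
    by (cases b) (simp add: wreath_def)
  have snd_mult: "snd (b \<otimes>\<^bsub>wreath_full K \<Gamma>\<^esub> c) = snd b \<otimes>\<^bsub>Sym \<Gamma>\<^esub> snd c"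
    if "b \<in> carrier (wreath_full K \<Gamma>)" for b c
    using that mult_wreath_full[of "snd b" \<Gamma> K "fst b" "fst c" "snd c"]
    by (auto simp: carrier_wreath_full)
  show ?thesis
  proof (rule W.subgroupI)
    show "carrier (wreath K \<Gamma> H) \<subseteq> carrier (wreath_full K \<Gamma>)"
      using car by blast
    have "\<one>\<^bsub>wreath_full K \<Gamma>\<^esub> \<in> carrier (wreath K \<Gamma> H)"
      unfolding car using subgroup.one_closed[OF H] W.one_closed by (simp add: one_wreath_full)
    then show "carrier (wreath K \<Gamma> H) \<noteq> {}" by blast
  next
    fix b assume b: "b \<in> carrier (wreath K \<Gamma> H)"
    then have bW: "b \<in> carrier (wreath_full K \<Gamma>)" and bH: "snd b \<in> H" using car by auto
    have "snd (inv\<^bsub>wreath_full K \<Gamma>\<^esub> b) \<otimes>\<^bsub>Sym \<Gamma>\<^esub> snd b = \<one>\<^bsub>Sym \<Gamma>\<^esub>"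
      using snd_mult[OF W.inv_closed[OF bW], of b] W.l_inv[OF bW] by (simp add: one_wreath_full)
    moreover have "snd (inv\<^bsub>wreath_full K \<Gamma>\<^esub> b) \<in> carrier (Sym \<Gamma>)" "snd b \<in> carrier (Sym \<Gamma>)"
      using W.inv_closed[OF bW] bW by (auto simp: carrier_wreath_full)
    ultimately have "snd (inv\<^bsub>wreath_full K \<Gamma>\<^esub> b) = inv\<^bsub>Sym \<Gamma>\<^esub> snd b"
      using group.inv_equality[OF group_Sym] by metis
    then show "inv\<^bsub>wreath_full K \<Gamma>\<^esub> b \<in> carrier (wreath K \<Gamma> H)"
      unfolding car using W.inv_closed[OF bW] subgroup.m_inv_closed[OF H bH] by simp
    fix c assume "c \<in> carrier (wreath K \<Gamma> H)"
    then show "b \<otimes>\<^bsub>wreath_full K \<Gamma>\<^esub> c \<in> carrier (wreath K \<Gamma> H)"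
      unfolding car using bW bH W.m_closed subgroup.m_closed[OF H] snd_mult[OF bW] by auto
  qed
qed

lemma group_wreath:
  assumes "group K" "subgroup H (Sym \<Gamma>)" shows "group (wreath K \<Gamma> H)"
proof -
  have "wreath K \<Gamma> H = (wreath_full K \<Gamma>)\<lparr>carrier := carrier (wreath K \<Gamma> H)\<rparr>"
    by (simp add: wreath_def)
  then show ?thesis
    using subgroup.subgroup_is_group[OF subgroup_wreath[OF assms] group_wreath_full[OF assms(1)]]
    by simp
qed


section \<open>The groups of the sequence\<close>

context sparse_wreath
begin

abbreviation Cent where "Cent \<equiv> cent_group (wreath K \<Gamma> H) w"
abbreviation B where "B \<equiv> B_group K \<Gamma> w pt rep"
abbreviation \<Phi> where "\<Phi> \<equiv> Phi K \<Gamma> w pt rep x"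

lemma group_Cent: "group Cent"
  by (rule group_cent_group[OF group_wreath[OF group_K subgroup_H] w_wreath])

lemma carrier_Cent_iff:
  "(s, t) \<in> carrier Cent \<longleftrightarrow> s \<in> \<Gamma> \<rightarrow>\<^sub>E carrier K \<and> t \<in> H \<and> commutes t \<and>
     (\<forall>\<gamma>\<in>\<Gamma>. s \<gamma> \<otimes>\<^bsub>K\<^esub> f (t \<gamma>) = f \<gamma> \<otimes>\<^bsub>K\<^esub> s (h \<gamma>))"
proof -
  have carW: "(s, t) \<in> carrier (wreath K \<Gamma> H) \<longleftrightarrow> s \<in> \<Gamma> \<rightarrow>\<^sub>E carrier K \<and> t \<in> H"
    using H_permutes by (auto simp: wreath_def carrier_wreath_full)
  have comm: "(s, t) \<otimes>\<^bsub>wreath K \<Gamma> H\<^esub> w = w \<otimes>\<^bsub>wreath K \<Gamma> H\<^esub> (s, t) \<longleftrightarrow> commutes t \<and>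
     (\<forall>\<gamma>\<in>\<Gamma>. s \<gamma> \<otimes>\<^bsub>K\<^esub> f (t \<gamma>) = f \<gamma> \<otimes>\<^bsub>K\<^esub> s (h \<gamma>))" if t: "t \<in> H"
  proof -
    have "(s, t) \<otimes>\<^bsub>wreath K \<Gamma> H\<^esub> w = (\<lambda>\<gamma>\<in>\<Gamma>. s \<gamma> \<otimes>\<^bsub>K\<^esub> f (t \<gamma>), h \<circ> t)"
      using mult_wreath_full[OF H_permutes[OF t], of K s f h] by (simp add: wreath_def)
    moreover have "w \<otimes>\<^bsub>wreath K \<Gamma> H\<^esub> (s, t) = (\<lambda>\<gamma>\<in>\<Gamma>. f \<gamma> \<otimes>\<^bsub>K\<^esub> s (h \<gamma>), t \<circ> h)"
      using mult_wreath_full[OF h_permutes, of K f s t] by (simp add: wreath_def)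
    moreover have "restrict u \<Gamma> = restrict v \<Gamma> \<longleftrightarrow> (\<forall>\<gamma>\<in>\<Gamma>. u \<gamma> = v \<gamma>)" for u v :: "'g \<Rightarrow> 'k"
      by (auto simp: restrict_def fun_eq_iff)
    moreover have "h \<circ> t = t \<circ> h \<longleftrightarrow> commutes t"
      by (auto simp: commutes_def fun_eq_iff)
    ultimately show ?thesis by auto
  qed
  show ?thesis
    using carW comm by (auto simp: cent_group_def centraliser_def)
qed

lemma mult_Cent:
  assumes "t \<in> H"
  shows "(s, t) \<otimes>\<^bsub>Cent\<^esub> (s', t') = (\<lambda>\<gamma>\<in>\<Gamma>. s \<gamma> \<otimes>\<^bsub>K\<^esub> s' (t \<gamma>), t' \<circ> t)"
  using mult_wreath_full[OF H_permutes[OF assms], of K s s' t'] by (simp add: cent_group_def wreath_def)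

lemma one_Cent: "\<one>\<^bsub>Cent\<^esub> = (\<lambda>\<gamma>\<in>\<Gamma>. \<one>\<^bsub>K\<^esub>, id)"
  by (simp add: cent_group_def wreath_def one_wreath_full)

lemma mult_St: "p \<otimes>\<^bsub>St\<^esub> q = q \<circ> p" and one_St: "\<one>\<^bsub>St\<^esub> = id"
  by (simp_all add: stab_group_def cent_group_def Let_def)

lemma group_St: "group St"
proof -
  have "subgroup (carrier St) (Sym \<Gamma>)"
  proof (rule group.subgroupI[OF group_Sym])
    show "carrier St \<subseteq> carrier (Sym \<Gamma>)" using St_permutes by auto
    have "id \<in> carrier St"
      unfolding carrier_St_decomp using subgroup.one_closed[OF subgroup_H] by (simp add: commutes_def)
    then show "carrier St \<noteq> {}" by blast
  next
    fix t assume t: "t \<in> carrier St"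
    note t' = St_permutes[OF t] St_H[OF t] St_commutes[OF t]
      and tdec = t[unfolded carrier_St_decomp, THEN conjunct2, THEN conjunct2]
    define v where "v = inv_into UNIV t"
    have v: "t (v \<gamma>) = \<gamma>" "v (t \<gamma>) = \<gamma>" for \<gamma>
      using permutes_inverses[OF t'(1)] by (simp_all add: v_def)
    have "v (h \<gamma>) = h (v \<gamma>)" for \<gamma>
    proof -
      have "t (v (h \<gamma>)) = t (h (v \<gamma>))"
        using t'(3) v by (simp add: commutes_def)
      then show ?thesis using permutes_inj[OF t'(1)] by (simp only: inj_eq)
    qed
    then have "commutes v" by (simp add: commutes_def)
    have v_image: "image v ` Y = Y" if "image t ` Y = Y" for Y :: "'g set set"
    proof -
      have "image v ` (image t ` Y) = Y"
        by (simp add: image_image v)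
      then show ?thesis using that by simp
    qed
    have "v \<in> H"
      using subgroup.m_inv_closed[OF subgroup_H t'(2)] inv_Sym[OF t'(1)] by (simp add: v_def)
    have "v \<in> carrier St"
      unfolding carrier_St_decomp
      by (intro conjI ballI \<open>v \<in> H\<close> \<open>commutes v\<close> v_image bspec[OF tdec])
    then show "inv\<^bsub>Sym \<Gamma>\<^esub> t \<in> carrier St"
      by (simp only: inv_Sym[OF t'(1)] v_def)
    fix u assume u: "u \<in> carrier St"
    note u' = St_H[OF u] St_commutes[OF u]
      and udec = u[unfolded carrier_St_decomp, THEN conjunct2, THEN conjunct2]
    have comp: "image (u \<circ> t) ` Y = image u ` image t ` Y" for Y :: "'g set set"
      by (simp add: image_image image_comp)
    have "u \<circ> t \<in> H" using subgroup.m_closed[OF subgroup_H t'(2) u'(1)] by simp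
    moreover have "commutes (u \<circ> t)" using t'(3) u'(2) by (simp add: commutes_def)
    moreover have "\<forall>L\<in>loads K \<Gamma> w. image (u \<circ> t) ` terr K \<Gamma> ` cyc_ld L = terr K \<Gamma> ` cyc_ld L"
      unfolding comp using tdec udec by simp
    ultimately have "u \<circ> t \<in> carrier St"
      unfolding carrier_St_decomp by (intro conjI)
    then show "t \<otimes>\<^bsub>Sym \<Gamma>\<^esub> u \<in> carrier St" by simp
  qed
  moreover have "St = (Sym \<Gamma>)\<lparr>carrier := carrier St\<rparr>"
    by (simp add: stab_group_def cent_group_def Let_def)
  ultimately show ?thesis
    using subgroup.subgroup_is_group[OF _ group_Sym] by metis
qed

lemma group_B: "group B"
  unfolding B_group_def
  by (intro DirProd_group product_group group_cent_group group_K base_carrier rep_cyc)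

lemma carrier_B_iff:
  "(c, c0) \<in> carrier B \<longleftrightarrow>
     c \<in> (\<Pi>\<^sub>E L\<in>loads K \<Gamma> w. \<Pi>\<^sub>E T\<in>terr K \<Gamma> ` cyc_ld L. centraliser K (base (rep L))) \<and>
     c0 \<in> (\<Gamma> - terr K \<Gamma> w) \<rightarrow>\<^sub>E carrier K"
  by (simp add: B_group_def cent_group_def)

lemma mult_B:
  "(c, c0) \<otimes>\<^bsub>B\<^esub> (d, d0) =
     (\<lambda>L\<in>loads K \<Gamma> w. \<lambda>T\<in>terr K \<Gamma> ` cyc_ld L. c L T \<otimes>\<^bsub>K\<^esub> d L T,
      \<lambda>\<gamma>\<in>\<Gamma> - terr K \<Gamma> w. c0 \<gamma> \<otimes>\<^bsub>K\<^esub> d0 \<gamma>)"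
  by (simp add: B_group_def cent_group_def)

lemma one_B:
  "\<one>\<^bsub>B\<^esub> = (\<lambda>L\<in>loads K \<Gamma> w. \<lambda>T\<in>terr K \<Gamma> ` cyc_ld L. \<one>\<^bsub>K\<^esub>, \<lambda>\<gamma>\<in>\<Gamma> - terr K \<Gamma> w. \<one>\<^bsub>K\<^esub>)"
  by (simp add: B_group_def cent_group_def)

abbreviation comp :: "('k ld \<Rightarrow> 'g set \<Rightarrow> 'k) \<Rightarrow> ('k, 'g) wr \<Rightarrow> 'k" where
  "comp c z \<equiv> c (ld z) (terr K \<Gamma> z)"

lemma comp_centraliser:
  assumes "(c, c0) \<in> carrier B" "z \<in> cyc"
  shows "comp c z \<in> carrier K"
    and "comp c z \<otimes>\<^bsub>K\<^esub> base (rep (ld z)) = base (rep (ld z)) \<otimes>\<^bsub>K\<^esub> comp c z"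
proof -
  have c: "c \<in> (\<Pi>\<^sub>E L\<in>loads K \<Gamma> w. \<Pi>\<^sub>E T\<in>terr K \<Gamma> ` cyc_ld L. centraliser K (base (rep L)))"
    using assms(1) unfolding carrier_B_iff by (rule conjunct1)
  have "terr K \<Gamma> z \<in> terr K \<Gamma> ` cyc_ld (ld z)"
    using assms(2) by (simp add: cyc_ld_iff)
  then have "comp c z \<in> centraliser K (base (rep (ld z)))"
    by (rule PiE_mem[OF PiE_mem[OF c ld_loads[OF assms(2)]]])
  then show "comp c z \<in> carrier K"
    and "comp c z \<otimes>\<^bsub>K\<^esub> base (rep (ld z)) = base (rep (ld z)) \<otimes>\<^bsub>K\<^esub> comp c z"
    by (simp_all add: centraliser_def)
qed


section \<open>The parametrisation\<close>

text \<open>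
  The integers \<open>j - e z\<close> with \<open>0 \<le> j < ord z\<close> represent each residue modulo \<open>ord z\<close> once, so the
  pair \<open>(z, j)\<close> selected in the definition of \<open>\<Phi>\<close> is well defined.
\<close>

lemma Phi_apply:
  assumes t: "t permutes \<Gamma>" "commutes t" and sh: "shifts t \<sigma> e"
  shows "snd (\<Phi> ((c, c0), t)) = t"
    and "fst (\<Phi> ((c, c0), t)) \<in> extensional \<Gamma>"
    and "\<gamma> \<in> \<Gamma> \<Longrightarrow> \<gamma> \<notin> terr K \<Gamma> w \<Longrightarrow> fst (\<Phi> ((c, c0), t)) \<gamma> = c0 \<gamma>"
    and "z \<in> cyc \<Longrightarrow> j < ord z \<Longrightarrow> fst (\<Phi> ((c, c0), t)) (coord z (int j - int (e z))) =
      (let a = inv\<^bsub>K\<^esub> x z \<otimes>\<^bsub>K\<^esub> comp c z \<otimes>\<^bsub>K\<^esub> x (\<sigma> z)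
       in if j = 0 \<or> e z < j then a else a \<otimes>\<^bsub>K\<^esub> base (\<sigma> z))"
proof -
  define E where "E = restrict e cyc"
  define S where "S = (\<lambda>L\<in>loads K \<Gamma> w. \<lambda>z. if z \<in> cyc_ld L then \<sigma> z else z)"
  have E: "E z = e z" and S: "S (ld z) z = \<sigma> z" if "z \<in> cyc" for z
    using that ld_loads[OF that] by (simp_all add: E_def S_def cyc_ld_iff)
  note Phi = Phi_def[of K \<Gamma> w pt rep x] top_factors_eq[OF t sh, folded E_def S_def]
  show "snd (\<Phi> ((c, c0), t)) = t" and "fst (\<Phi> ((c, c0), t)) \<in> extensional \<Gamma>"
    by (simp_all add: Phi)
  show "\<gamma> \<in> \<Gamma> \<Longrightarrow> \<gamma> \<notin> terr K \<Gamma> w \<Longrightarrow> fst (\<Phi> ((c, c0), t)) \<gamma> = c0 \<gamma>"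
    by (simp add: Phi)
  assume z: "z \<in> cyc" and j: "j < ord z"
  have the: "(THE (y, i). y \<in> cyc \<and> i < ord y \<and> coord z (int j - int (e z)) =
      (h [^]\<^bsub>Sym \<Gamma>\<^esub> (int i - int (E y))) (pt y)) = (z, j)"
  proof (rule the_equality)
    show "case (z, j) of (y, i) \<Rightarrow> y \<in> cyc \<and> i < ord y \<and> coord z (int j - int (e z)) =
      (h [^]\<^bsub>Sym \<Gamma>\<^esub> (int i - int (E y))) (pt y)"
      using z j by (simp add: coord_def E)
  next
    fix q assume q: "case q of (y, i) \<Rightarrow> y \<in> cyc \<and> i < ord y \<and> coord z (int j - int (e z)) =
      (h [^]\<^bsub>Sym \<Gamma>\<^esub> (int i - int (E y))) (pt y)"
    obtain y i where yi: "q = (y, i)" by (rule prod.exhaust)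
    have y: "y \<in> cyc" and i: "i < ord y"
      and eq: "coord z (int j - int (e z)) = coord y (int i - int (e y))"
      using q yi by (simp_all add: coord_def E)
    have "z = y" by (rule coord_cycle_unique[OF z y eq])
    then have "int (ord z) dvd int i - int j"
      using eq coord_eq_iff_same[OF z] by simp
    moreover have "\<bar>int i - int j\<bar> < int (ord z)" using i j \<open>z = y\<close> by auto
    ultimately have "i = j"
      using dvd_imp_le_int[of "int i - int j" "int (ord z)"] by (cases "i = j") auto
    then show "q = (z, j)" using yi \<open>z = y\<close> by simp
  qed
  show "fst (\<Phi> ((c, c0), t)) (coord z (int j - int (e z))) =
      (let a = inv\<^bsub>K\<^esub> x z \<otimes>\<^bsub>K\<^esub> comp c z \<otimes>\<^bsub>K\<^esub> x (\<sigma> z)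
       in if j = 0 \<or> e z < j then a else a \<otimes>\<^bsub>K\<^esub> base (\<sigma> z))"
    using coord_\<Gamma>[OF z] coord_terr_w[OF z] by (simp add: Phi the E[OF z] S[OF z] Let_def)
qed

lemma cancel_left:
  assumes "a \<in> carrier K" "b \<in> carrier K"
  shows "a \<otimes>\<^bsub>K\<^esub> (inv\<^bsub>K\<^esub> a \<otimes>\<^bsub>K\<^esub> b) = b" and "inv\<^bsub>K\<^esub> a \<otimes>\<^bsub>K\<^esub> (a \<otimes>\<^bsub>K\<^esub> b) = b"
  using assms by (simp_all flip: K.m_assoc)

text \<open>
  The entries at the chosen points of \<open>z\<close> and \<open>z'\<close> are the conjugates of the entry of the
  representative by \<open>x z\<close> and \<open>x z'\<close>, and \<open>d\<close> centralises the latter entry.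
\<close>

lemma transport_base:
  assumes z: "z \<in> cyc" "z' \<in> cyc" "ld z' = ld z"
    and d: "d \<in> carrier K" "d \<otimes>\<^bsub>K\<^esub> base (rep (ld z)) = base (rep (ld z)) \<otimes>\<^bsub>K\<^esub> d"
  defines "a \<equiv> inv\<^bsub>K\<^esub> x z \<otimes>\<^bsub>K\<^esub> d \<otimes>\<^bsub>K\<^esub> x z'"
  shows "a \<otimes>\<^bsub>K\<^esub> base z' = base z \<otimes>\<^bsub>K\<^esub> a" and "a \<in> carrier K"
proof -
  let ?g = "base (rep (ld z))"
  have car: "x z \<in> carrier K" "x z' \<in> carrier K" "?g \<in> carrier K"
    using x_carrier z base_carrier[OF rep_cyc[OF ld_loads[OF z(1)]]] by auto
  then show "a \<in> carrier K" using d(1) by (simp add: a_def)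
  have "a \<otimes>\<^bsub>K\<^esub> base z' = inv\<^bsub>K\<^esub> x z \<otimes>\<^bsub>K\<^esub> (d \<otimes>\<^bsub>K\<^esub> ?g) \<otimes>\<^bsub>K\<^esub> x z'"
    using car d(1) unfolding base_conj[OF z(2)] z(3) a_def by (simp add: K.m_assoc cancel_left)
  also have "\<dots> = base z \<otimes>\<^bsub>K\<^esub> a"
    using car d(1) unfolding base_conj[OF z(1)] d(2) a_def by (simp add: K.m_assoc cancel_left)
  finally show "a \<otimes>\<^bsub>K\<^esub> base z' = base z \<otimes>\<^bsub>K\<^esub> a" .
qed

text \<open>
  The equation \<open>s(\<gamma>) f(t \<gamma>) = f(\<gamma>) s(h \<gamma>)\<close> is checked at the point with coordinate \<open>j - e z\<close>. Its two
  factors from \<open>f\<close> are non-trivial only for \<open>j = 0\<close> and \<open>j = e z\<close>, and these are the places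
  where the case distinction in \<open>\<Phi>\<close> changes.
\<close>

lemma Phi_Cent:
  assumes c: "(c, c0) \<in> carrier B" and t: "t \<in> carrier St"
  shows "\<Phi> ((c, c0), t) \<in> carrier Cent"
proof -
  note tp = St_permutes[OF t] and tc = St_commutes[OF t]
  obtain \<sigma> e where sh: "shifts t \<sigma> e" by (rule St_shifts[OF t])
  define s where "s = fst (\<Phi> ((c, c0), t))"
  have \<Phi>: "\<Phi> ((c, c0), t) = (s, t)"
    using Phi_apply(1)[OF tp tc sh] by (simp add: s_def prod_eq_iff)
  define a where "a z = inv\<^bsub>K\<^esub> x z \<otimes>\<^bsub>K\<^esub> comp c z \<otimes>\<^bsub>K\<^esub> x (\<sigma> z)" for z
  have s_off: "s \<gamma> = c0 \<gamma>" if "\<gamma> \<in> \<Gamma>" "\<gamma> \<notin> terr K \<Gamma> w" for \<gamma>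
    unfolding s_def by (rule Phi_apply(3)[OF tp tc sh that])
  have s_on: "s (coord z (int j - int (e z))) =
      (if j = 0 \<or> e z < j then a z else a z \<otimes>\<^bsub>K\<^esub> base (\<sigma> z))" if "z \<in> cyc" "j < ord z" for z j
    using Phi_apply(4)[OF tp tc sh that] by (simp add: s_def a_def Let_def)
  have \<sigma>: "\<sigma> z \<in> cyc" "ld (\<sigma> z) = ld z" "e z < ord z" if "z \<in> cyc" for z
    using sh that by (auto simp: shifts_def)
  have a: "a z \<otimes>\<^bsub>K\<^esub> base (\<sigma> z) = base z \<otimes>\<^bsub>K\<^esub> a z" "a z \<in> carrier K" if z: "z \<in> cyc" for z
    unfolding a_def
    using transport_base[OF z \<sigma>(1,2)[OF z] comp_centraliser[OF c z]] by auto
  have c0: "c0 \<gamma> \<in> carrier K" if "\<gamma> \<in> \<Gamma>" "\<gamma> \<notin> terr K \<Gamma> w" for \<gamma>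
    using c that by (auto simp: carrier_B_iff)
  have point: "\<exists>z j. z \<in> cyc \<and> j < ord z \<and> \<gamma> = coord z (int j - int (e z))"
    if \<gamma>: "\<gamma> \<in> terr K \<Gamma> w" for \<gamma>
  proof -
    obtain z i where z: "z \<in> cyc" "\<gamma> = coord z i" by (rule terr_w_coord[OF \<gamma>])
    obtain j where "j < ord z" "coord z i = coord z (int j - int (e z))"
      by (rule coord_shifted[OF z(1)])
    then show ?thesis using z by (intro exI[of _ z] exI[of _ j]) simp
  qed
  have s_car: "s \<gamma> \<in> carrier K" if "\<gamma> \<in> \<Gamma>" for \<gamma>
  proof (cases "\<gamma> \<in> terr K \<Gamma> w")
    case True
    then obtain z j where "z \<in> cyc" "j < ord z" "\<gamma> = coord z (int j - int (e z))"
      using point by blast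
    then show ?thesis using s_on a(2) base_carrier \<sigma>(1) by simp
  next
    case False
    then show ?thesis using s_off c0 that by simp
  qed
  have s_ext: "s \<in> \<Gamma> \<rightarrow>\<^sub>E carrier K"
    using s_car Phi_apply(2)[OF tp tc sh] by (simp add: s_def PiE_iff)
  have "s \<gamma> \<otimes>\<^bsub>K\<^esub> f (t \<gamma>) = f \<gamma> \<otimes>\<^bsub>K\<^esub> s (h \<gamma>)" if \<gamma>: "\<gamma> \<in> \<Gamma>" for \<gamma>
  proof (cases "\<gamma> \<in> terr K \<Gamma> w")
    case False
    have "t \<gamma> \<notin> terr K \<Gamma> w"
      using False terr_w_invariant[OF tp tc sh] permutes_inj[OF tp] by (metis inj_image_mem_iff)
    moreover have "t \<gamma> \<in> \<Gamma>" using permutes_in_image[OF tp] \<gamma> by simp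
    ultimately show ?thesis
      using terr_off[OF w_full] False \<gamma> s_car by simp
  next
    case True
    then obtain z j where z: "z \<in> cyc" "j < ord z" "\<gamma> = coord z (int j - int (e z))"
      using point by blast
    have "\<bar>int j - int (e z)\<bar> < int (ord z)" using z(2) \<sigma>(3)[OF z(1)] by auto
    then have "int (ord z) dvd int j - int (e z) \<longleftrightarrow> j = e z"
      using dvd_imp_le_int[of "int j - int (e z)" "int (ord z)"] by (cases "j = e z") auto
    then have f\<gamma>: "f \<gamma> = (if j = e z then base z else \<one>\<^bsub>K\<^esub>)"
      using f_coord[OF z(1)] z(3) by simp
    have "t \<gamma> = coord (\<sigma> z) (int j)"
      using shifts_coord[OF tp tc sh z(1)] z(3) by simp
    moreover have "ord z dvd j \<longleftrightarrow> j = 0" using z(2) dvd_imp_le[of "ord z" j] by (cases j) auto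
    ultimately have ft\<gamma>: "f (t \<gamma>) = (if j = 0 then base (\<sigma> z) else \<one>\<^bsub>K\<^esub>)"
      using f_coord[OF \<sigma>(1)[OF z(1)]] ord_load[OF \<sigma>(2)[OF z(1)]] by simp
    (* the index of h \<gamma> in the range below ord z, wrapping around at the end of the cycle *)
    define j' where "j' = (if Suc j = ord z then 0 else Suc j)"
    have j': "j' < ord z" using z(2) by (auto simp: j'_def)
    have "h \<gamma> = coord z (int j - int (e z) + 1)" using z(3) h_coord by simp
    also have "\<dots> = coord z (int j' - int (e z))"
    proof -
      have "int j' - int (e z) - (int j - int (e z) + 1) = (if Suc j = ord z then - int (ord z) else 0)"
        by (auto simp: j'_def)
      then show ?thesis unfolding coord_eq_iff_same[OF z(1)] by simp
    qed
    finally have sh\<gamma>: "s (h \<gamma>) = (if j' = 0 \<or> e z < j' then a z else a z \<otimes>\<^bsub>K\<^esub> base (\<sigma> z))"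
      using s_on[OF z(1) j'] by simp
    note s\<gamma> = s_on[OF z(1,2), folded z(3)]
    have e: "e z < ord z" by (rule \<sigma>(3)[OF z(1)])
    have car: "a z \<in> carrier K" "base (\<sigma> z) \<in> carrier K" "base z \<in> carrier K"
      using a(2) base_carrier \<sigma>(1) z(1) by auto
    note eqn = a(1)[OF z(1)]
    consider "j = 0" "e z = 0" | "j = 0" "0 < e z" | "0 < j" "j = e z" | "0 < j" "j < e z" | "e z < j"
      by linarith
    then show ?thesis
    proof cases
      case 1
      then show ?thesis using eqn car by (auto simp: s\<gamma> sh\<gamma> f\<gamma> ft\<gamma>)
    next
      case 2
      then have "j' = 1" using e by (auto simp: j'_def)
      then show ?thesis using 2 car by (simp add: s\<gamma> sh\<gamma> f\<gamma> ft\<gamma>)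
    next
      case 3
      then have "j' = 0 \<or> e z < j'" by (auto simp: j'_def)
      then show ?thesis using 3 eqn car by (simp add: s\<gamma> sh\<gamma> f\<gamma> ft\<gamma>)
    next
      case 4
      then have "j' = Suc j" "\<not> e z < j'" using e by (auto simp: j'_def)
      then show ?thesis using 4 car by (simp add: s\<gamma> sh\<gamma> f\<gamma> ft\<gamma>)
    next
      case 5
      then have "j' = 0 \<or> e z < j'" by (auto simp: j'_def)
      then show ?thesis using 5 car by (simp add: s\<gamma> sh\<gamma> f\<gamma> ft\<gamma>)
    qed
  qed
  then show ?thesis
    unfolding \<Phi> carrier_Cent_iff using s_ext St_H[OF t] tc by blast
qed


section \<open>Exactness\<close>

text \<open>
  Running once around the cycle \<open>z\<close>, the commutation relation telescopes and shows that the Yades at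
  a point and at its image under \<open>t\<close> are conjugate.
\<close>

lemma Cent_top_St:
  assumes st: "(s, t) \<in> carrier Cent" shows "t \<in> carrier St"
proof -
  have s: "\<And>\<gamma>. \<gamma> \<in> \<Gamma> \<Longrightarrow> s \<gamma> \<in> carrier K" and tH: "t \<in> H" and tc: "commutes t"
    and rel: "\<And>\<gamma>. \<gamma> \<in> \<Gamma> \<Longrightarrow> s \<gamma> \<otimes>\<^bsub>K\<^esub> f (t \<gamma>) = f \<gamma> \<otimes>\<^bsub>K\<^esub> s (h \<gamma>)"
    using st unfolding carrier_Cent_iff by (auto dest: PiE_mem)
  have tp: "t permutes \<Gamma>" by (rule H_permutes[OF tH])
  have "\<exists>z'\<in>cyc. ld z' = ld z \<and> t (pt z) \<in> terr K \<Gamma> z'" if z: "z \<in> cyc" for z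
  proof -
    have pt\<Gamma>: "pt z \<in> \<Gamma>" "pt z \<in> terr K \<Gamma> w"
      using coord_\<Gamma>[OF z, of 0] coord_terr_w[OF z, of 0] by (simp_all add: coord_0)
    (* outside the territory h and f are trivial, which would make both trivial at pt z as well *)
    have "t (pt z) \<in> terr K \<Gamma> w"
    proof (rule ccontr)
      assume off: "t (pt z) \<notin> terr K \<Gamma> w"
      have "t (h (pt z)) = t (pt z)"
        using terr_off(1)[OF w_full off] tc by (simp add: commutes_def)
      then have fix_pt: "h (pt z) = pt z" using permutes_inj[OF tp] by (simp add: inj_eq)
      have "f (t (pt z)) = \<one>\<^bsub>K\<^esub>"
        using terr_off(2)[OF w_full off] permutes_in_image[OF tp] pt\<Gamma>(1) by simp
      then have "base z \<otimes>\<^bsub>K\<^esub> s (pt z) = \<one>\<^bsub>K\<^esub> \<otimes>\<^bsub>K\<^esub> s (pt z)"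
        using rel[OF pt\<Gamma>(1)] fix_pt s[OF pt\<Gamma>(1)] by simp
      then have "base z = \<one>\<^bsub>K\<^esub>"
        using s[OF pt\<Gamma>(1)] base_carrier[OF z] by (simp only: K.r_cancel K.one_closed)
      then show False using pt\<Gamma>(2) fix_pt by (simp add: terr_def supp_def)
    qed
    then obtain z' i where z': "z' \<in> cyc" "t (pt z) = coord z' i" by (rule terr_w_coord)
    note tz = commutes_coord[OF tp tc z'(2)]
    have dvd: "int (ord z) dvd k \<longleftrightarrow> int (ord z') dvd k" for k
    proof -
      have "int (ord z) dvd k \<longleftrightarrow> coord z 0 = coord z k"
        by (simp add: coord_eq_iff_same[OF z])
      also have "\<dots> \<longleftrightarrow> t (coord z 0) = t (coord z k)"
        using permutes_inj[OF tp] by (simp only: inj_eq)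
      also have "\<dots> \<longleftrightarrow> int (ord z') dvd k"
        by (simp add: tz coord_eq_iff_same[OF z'(1)])
      finally show ?thesis .
    qed
    have ord: "ord z' = ord z"
      using dvd[of "int (ord z)"] dvd[of "int (ord z')"] by (simp add: dvd_antisym)
    (* t maps the point of z with coordinate r to the chosen point of z' *)
    obtain r where r: "r < ord z" "coord z' (- i) = coord z' (int r - 0)"
      using coord_shifted[OF z'(1)] ord by metis
    then have r_dvd: "int (ord z') dvd int r + i"
      using coord_eq_iff_same[OF z'(1)] by simp
    let ?S = "\<lambda>j. s (coord z (int j))"
    let ?a = "\<lambda>j. f (t (coord z (int j)))" and ?b = "\<lambda>j. f (coord z (int j))"
    have inj_mod: "j = k" if "int (ord z) dvd int j - int k" "j < ord z" "k < ord z" for j k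
      using that dvd_imp_le_int[of "int j - int k" "int (ord z)"] by (cases "j = k") auto
    have t\<Gamma>: "t (coord z j) \<in> \<Gamma>" for j
      using permutes_in_image[OF tp] coord_\<Gamma>[OF z] by simp
    have "?S 0 \<otimes>\<^bsub>K\<^esub> list_prod K (map ?a [0..<ord z]) =
        list_prod K (map ?b [0..<ord z]) \<otimes>\<^bsub>K\<^esub> ?S (ord z)"
    proof (rule list_prod_telescope[OF group_K])
      fix j :: nat
      show "?S j \<otimes>\<^bsub>K\<^esub> ?a j = ?b j \<otimes>\<^bsub>K\<^esub> ?S (Suc j)"
        using rel[OF coord_\<Gamma>[OF z], of "int j"] by (simp add: h_coord add.commute)
    qed (use s f_carrier coord_\<Gamma>[OF z] t\<Gamma> in auto)
    moreover have "list_prod K (map ?b [0..<ord z]) = ?b 0"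
    proof (rule list_prod_single[OF group_K])
      fix j assume "j \<in> set [0..<ord z]" "j \<noteq> 0"
      then have "\<not> int (ord z) dvd int j" using inj_mod[of j 0] ord_pos[OF z] by auto
      then show "?b j = \<one>\<^bsub>K\<^esub>" by (simp only: f_coord[OF z] if_False)
    qed (use ord_pos[OF z] f_carrier coord_\<Gamma>[OF z] in auto)
    moreover have "list_prod K (map ?a [0..<ord z]) = ?a r"
    proof (rule list_prod_single[OF group_K])
      fix j assume j: "j \<in> set [0..<ord z]" "j \<noteq> r"
      have "\<not> int (ord z') dvd int j + i"
      proof
        assume "int (ord z') dvd int j + i"
        then have "int (ord z') dvd (int j + i) - (int r + i)" using r_dvd by (rule dvd_diff)
        then show False using inj_mod[of j r] j r(1) ord by auto
      qed
      then show "?a j = \<one>\<^bsub>K\<^esub>" by (simp only: tz f_coord[OF z'(1)] if_False)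
    qed (use r f_carrier t\<Gamma> in auto)
    moreover have "?a r = base z'" using r_dvd by (simp only: tz f_coord[OF z'(1)] if_True)
    moreover have "coord z (int (ord z)) = coord z 0" by (simp add: coord_eq_iff_same[OF z])
    ultimately have "s (pt z) \<otimes>\<^bsub>K\<^esub> base z' = base z \<otimes>\<^bsub>K\<^esub> s (pt z)"
      by (simp add: coord_0)
    then have "base z' = inv\<^bsub>K\<^esub> s (pt z) \<otimes>\<^bsub>K\<^esub> base z \<otimes>\<^bsub>K\<^esub> s (pt z)"
      using s[OF pt\<Gamma>(1)] base_carrier[OF z] base_carrier[OF z'(1)]
      by (metis K.inv_closed K.m_assoc cancel_left(2))
    then have "conj_class K (base z') = conj_class K (base z)"
      by (rule conj_class_conjugate[OF group_K base_carrier[OF z] s[OF pt\<Gamma>(1)]])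
    then have "ld z' = ld z"
      using load_eq[OF z] load_eq[OF z'(1)] ord by simp
    then show ?thesis using z' coord_terr[OF z'(1)] by metis
  qed
  then show ?thesis unfolding carrier_St_iff using tH tc by blast
qed

lemma id_St: "id \<in> carrier St"
  using group.is_monoid[OF group_St] monoid.one_closed[of St] by (simp add: one_St)

abbreviation \<iota> where "\<iota> c \<equiv> \<Phi> (c, id)"

lemma commutes_id: "commutes id"
  by (simp add: commutes_def)

text \<open>
  For \<open>t = id\<close> all \<open>e z\<close> vanish, the second case in the definition of \<open>\<Phi>\<close> does not occur, and the
  base component is constant on each cycle.
\<close>

lemma iota_apply:
  shows "\<iota> (c, c0) = (fst (\<iota> (c, c0)), id)"
    and "fst (\<iota> (c, c0)) \<in> extensional \<Gamma>"
    and "\<gamma> \<in> \<Gamma> \<Longrightarrow> \<gamma> \<notin> terr K \<Gamma> w \<Longrightarrow> fst (\<iota> (c, c0)) \<gamma> = c0 \<gamma>"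
    and "z \<in> cyc \<Longrightarrow> fst (\<iota> (c, c0)) (coord z j) = inv\<^bsub>K\<^esub> x z \<otimes>\<^bsub>K\<^esub> comp c z \<otimes>\<^bsub>K\<^esub> x z"
proof -
  note P = Phi_apply[OF permutes_id commutes_id shifts_id]
  show "\<iota> (c, c0) = (fst (\<iota> (c, c0)), id)" "fst (\<iota> (c, c0)) \<in> extensional \<Gamma>"
    using P(1,2) by (simp_all add: prod_eq_iff)
  show "\<gamma> \<in> \<Gamma> \<Longrightarrow> \<gamma> \<notin> terr K \<Gamma> w \<Longrightarrow> fst (\<iota> (c, c0)) \<gamma> = c0 \<gamma>" by (rule P(3))
  assume z: "z \<in> cyc"
  obtain i where "i < ord z" "coord z j = coord z (int i - int 0)" by (rule coord_shifted[OF z])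
  then show "fst (\<iota> (c, c0)) (coord z j) = inv\<^bsub>K\<^esub> x z \<otimes>\<^bsub>K\<^esub> comp c z \<otimes>\<^bsub>K\<^esub> x z"
    using P(4)[OF z, of i c c0] by (cases "i = 0") (simp_all add: Let_def)
qed

lemma base_component_ext:
  assumes "s \<in> extensional \<Gamma>" "s' \<in> extensional \<Gamma>"
    and "\<And>z j. z \<in> cyc \<Longrightarrow> s (coord z j) = s' (coord z j)"
    and "\<And>\<gamma>. \<gamma> \<in> \<Gamma> \<Longrightarrow> \<gamma> \<notin> terr K \<Gamma> w \<Longrightarrow> s \<gamma> = s' \<gamma>"
  shows "s = s'"
proof (rule extensionalityI[OF assms(1,2)])
  fix \<gamma> assume "\<gamma> \<in> \<Gamma>"
  show "s \<gamma> = s' \<gamma>"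
  proof (cases "\<gamma> \<in> terr K \<Gamma> w")
    case True
    then obtain z j where "z \<in> cyc" "\<gamma> = coord z j" by (rule terr_w_coord)
    then show ?thesis using assms(3) by simp
  qed (rule assms(4)[OF \<open>\<gamma> \<in> \<Gamma>\<close>])
qed

lemma group_hom_iota: "group_hom B Cent \<iota>"
proof (intro group_hom.intro group_hom_axioms.intro group_B group_Cent homI)
  fix c assume "c \<in> carrier B"
  then show "\<iota> c \<in> carrier Cent" using Phi_Cent[OF _ id_St] by (cases c) simp
next
  fix b d assume b: "b \<in> carrier B" and d: "d \<in> carrier B"
  obtain c c0 where c: "b = (c, c0)" by (rule prod.exhaust)
  obtain d' d0 where d': "d = (d', d0)" by (rule prod.exhaust)
  have cB: "(c, c0) \<in> carrier B" and dB: "(d', d0) \<in> carrier B" using b d c d' by simp_all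
  have prod: "\<iota> b \<otimes>\<^bsub>Cent\<^esub> \<iota> d = (\<lambda>\<gamma>\<in>\<Gamma>. fst (\<iota> (c, c0)) \<gamma> \<otimes>\<^bsub>K\<^esub> fst (\<iota> (d', d0)) \<gamma>, id)"
    unfolding c d' using iota_apply(1)[of c c0] iota_apply(1)[of d' d0]
      mult_Cent[OF St_H[OF id_St], of "fst (\<iota> (c, c0))" "fst (\<iota> (d', d0))" id] by simp
  obtain m m0 where m: "b \<otimes>\<^bsub>B\<^esub> d = (m, m0)" by (rule prod.exhaust)
  then have m': "m = (\<lambda>L\<in>loads K \<Gamma> w. \<lambda>T\<in>terr K \<Gamma> ` cyc_ld L. c L T \<otimes>\<^bsub>K\<^esub> d' L T)"
    "m0 = (\<lambda>\<gamma>\<in>\<Gamma> - terr K \<Gamma> w. c0 \<gamma> \<otimes>\<^bsub>K\<^esub> d0 \<gamma>)"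
    using mult_B[of c c0 d' d0] c d' by simp_all
  have "fst (\<iota> (m, m0)) = (\<lambda>\<gamma>\<in>\<Gamma>. fst (\<iota> (c, c0)) \<gamma> \<otimes>\<^bsub>K\<^esub> fst (\<iota> (d', d0)) \<gamma>)"
  proof (rule base_component_ext[OF iota_apply(2)])
    fix z j assume z: "z \<in> cyc"
    have "comp m z = comp c z \<otimes>\<^bsub>K\<^esub> comp d' z"
      using ld_loads[OF z] z by (simp add: m' cyc_ld_iff)
    moreover have "x z \<in> carrier K" "comp c z \<in> carrier K" "comp d' z \<in> carrier K"
      using x_carrier z comp_centraliser(1)[OF cB] comp_centraliser(1)[OF dB] by auto
    ultimately show "fst (\<iota> (m, m0)) (coord z j) =
        (\<lambda>\<gamma>\<in>\<Gamma>. fst (\<iota> (c, c0)) \<gamma> \<otimes>\<^bsub>K\<^esub> fst (\<iota> (d', d0)) \<gamma>) (coord z j)"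
      using coord_\<Gamma>[OF z] by (simp add: iota_apply(4)[OF z] K.m_assoc cancel_left)
  next
    fix \<gamma> assume "\<gamma> \<in> \<Gamma>" "\<gamma> \<notin> terr K \<Gamma> w"
    then show "fst (\<iota> (m, m0)) \<gamma> =
        (\<lambda>\<gamma>\<in>\<Gamma>. fst (\<iota> (c, c0)) \<gamma> \<otimes>\<^bsub>K\<^esub> fst (\<iota> (d', d0)) \<gamma>) \<gamma>"
      by (simp add: iota_apply(3) m'(2))
  qed simp
  then show "\<iota> (b \<otimes>\<^bsub>B\<^esub> d) = \<iota> b \<otimes>\<^bsub>Cent\<^esub> \<iota> d"
    unfolding prod m using iota_apply(1)[of m m0] by simp
qed

lemma group_hom_rho: "group_hom Cent St (\<lambda>(s, t). t)"
proof (intro group_hom.intro group_hom_axioms.intro group_St group_Cent homI)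
  fix b assume "b \<in> carrier Cent"
  then show "(case b of (s, t) \<Rightarrow> t) \<in> carrier St" using Cent_top_St by (cases b) simp
next
  fix b d assume "b \<in> carrier Cent" "d \<in> carrier Cent"
  moreover obtain s t where "b = (s, t)" by (rule prod.exhaust)
  moreover obtain s' t' where "d = (s', t')" by (rule prod.exhaust)
  ultimately show "(case b \<otimes>\<^bsub>Cent\<^esub> d of (s, t) \<Rightarrow> t) =
      (case b of (s, t) \<Rightarrow> t) \<otimes>\<^bsub>St\<^esub> (case d of (s, t) \<Rightarrow> t)"
    using mult_Cent[OF St_H[OF Cent_top_St]] by (simp add: mult_St)
qed

lemma kernel_iota: "kernel B Cent \<iota> = {\<one>\<^bsub>B\<^esub>}"
proof -
  interpret i: group_hom B Cent \<iota> by (rule group_hom_iota)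
  have "b = \<one>\<^bsub>B\<^esub>" if "b \<in> carrier B" "\<iota> b = \<one>\<^bsub>Cent\<^esub>" for b
  proof -
    obtain c c0 where c: "b = (c, c0)" by (rule prod.exhaust)
    have cB: "(c, c0) \<in> carrier B" using that(1) c by simp
    have one: "fst (\<iota> (c, c0)) \<gamma> = \<one>\<^bsub>K\<^esub>" if "\<gamma> \<in> \<Gamma>" for \<gamma>
      using \<open>\<iota> b = \<one>\<^bsub>Cent\<^esub>\<close> that by (simp add: c one_Cent)
    have comp: "comp c z = \<one>\<^bsub>K\<^esub>" if z: "z \<in> cyc" for z
    proof -
      have car: "x z \<in> carrier K" "comp c z \<in> carrier K"
        using x_carrier[OF z] comp_centraliser(1)[OF cB z] by auto
      have "inv\<^bsub>K\<^esub> x z \<otimes>\<^bsub>K\<^esub> comp c z \<otimes>\<^bsub>K\<^esub> x z = \<one>\<^bsub>K\<^esub>"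
        using one[OF coord_\<Gamma>[OF z]] iota_apply(4)[OF z] by simp
      then have "x z \<otimes>\<^bsub>K\<^esub> (inv\<^bsub>K\<^esub> x z \<otimes>\<^bsub>K\<^esub> (comp c z \<otimes>\<^bsub>K\<^esub> x z)) = x z \<otimes>\<^bsub>K\<^esub> \<one>\<^bsub>K\<^esub>"
        using car by (simp only: K.m_assoc K.inv_closed K.m_closed)
      then have "comp c z \<otimes>\<^bsub>K\<^esub> x z = \<one>\<^bsub>K\<^esub> \<otimes>\<^bsub>K\<^esub> x z"
        using car by (simp add: cancel_left)
      then show ?thesis using car by (simp only: K.r_cancel K.one_closed)
    qed
    have cE: "c \<in> (\<Pi>\<^sub>E L\<in>loads K \<Gamma> w. \<Pi>\<^sub>E T\<in>terr K \<Gamma> ` cyc_ld L. centraliser K (base (rep L)))"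
      and c0E: "c0 \<in> (\<Gamma> - terr K \<Gamma> w) \<rightarrow>\<^sub>E carrier K"
      using cB by (simp_all only: carrier_B_iff)
    have "c = (\<lambda>L\<in>loads K \<Gamma> w. \<lambda>T\<in>terr K \<Gamma> ` cyc_ld L. \<one>\<^bsub>K\<^esub>)"
    proof (rule extensionalityI)
      show "c \<in> extensional (loads K \<Gamma> w)" using cE by (simp add: PiE_def)
      fix L assume L: "L \<in> loads K \<Gamma> w"
      have "c L = (\<lambda>T\<in>terr K \<Gamma> ` cyc_ld L. \<one>\<^bsub>K\<^esub>)"
      proof (rule extensionalityI)
        show "c L \<in> extensional (terr K \<Gamma> ` cyc_ld L)" using PiE_mem[OF cE L] by (simp add: PiE_def)
        fix T assume T: "T \<in> terr K \<Gamma> ` cyc_ld L"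
        then obtain z where z: "z \<in> cyc" "ld z = L" "T = terr K \<Gamma> z" by (auto simp: cyc_ld_iff)
        then show "c L T = (\<lambda>T\<in>terr K \<Gamma> ` cyc_ld L. \<one>\<^bsub>K\<^esub>) T"
          using comp[OF z(1)] T by simp
      qed simp
      then show "c L = (\<lambda>L\<in>loads K \<Gamma> w. \<lambda>T\<in>terr K \<Gamma> ` cyc_ld L. \<one>\<^bsub>K\<^esub>) L" using L by simp
    qed simp
    moreover have "c0 = (\<lambda>\<gamma>\<in>\<Gamma> - terr K \<Gamma> w. \<one>\<^bsub>K\<^esub>)"
    proof (rule extensionalityI)
      show "c0 \<in> extensional (\<Gamma> - terr K \<Gamma> w)" using c0E by (simp add: PiE_def)
      fix \<gamma> assume "\<gamma> \<in> \<Gamma> - terr K \<Gamma> w"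
      then show "c0 \<gamma> = (\<lambda>\<gamma>\<in>\<Gamma> - terr K \<Gamma> w. \<one>\<^bsub>K\<^esub>) \<gamma>"
        using one iota_apply(3)[of \<gamma> c c0] by simp
    qed simp
    ultimately show ?thesis by (simp add: c one_B)
  qed
  moreover have "\<one>\<^bsub>B\<^esub> \<in> kernel B Cent \<iota>"
    unfolding kernel_def using i.hom_one i.G.one_closed by (simp only: mem_Collect_eq)
  ultimately show ?thesis
    unfolding kernel_def by (intro subset_antisym subsetI) (simp_all only: mem_Collect_eq singleton_iff)
qed

text \<open>
  If \<open>(s, id)\<close> centralises \<open>w\<close>, then \<open>s\<close> can only jump at the chosen point of a cycle. Since the
  cycle closes up, there is no jump at all, and the constant value commutes with the entry of \<open>w\<close> at
  the chosen point.
\<close>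

lemma Cent_id_constant:
  assumes sC: "(s, id) \<in> carrier Cent" and z: "z \<in> cyc"
  shows "s (coord z j) = s (pt z)" and "s (pt z) \<otimes>\<^bsub>K\<^esub> base z = base z \<otimes>\<^bsub>K\<^esub> s (pt z)"
proof -
  have s: "s (coord z j) \<in> carrier K" for j
    using sC coord_\<Gamma>[OF z] by (auto simp: carrier_Cent_iff)
  have rel: "s (coord z j) \<otimes>\<^bsub>K\<^esub> f (coord z j) = f (coord z j) \<otimes>\<^bsub>K\<^esub> s (coord z (j + 1))" for j
    using sC coord_\<Gamma>[OF z] h_coord by (simp add: carrier_Cent_iff)
  have const: "s (coord z (int (Suc i))) = s (coord z 1)" if "i < ord z" for i
    using that
  proof (induction i)
    case (Suc i)
    then have "\<not> int (ord z) dvd int (Suc i)"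
      by (auto simp only: of_nat_dvd_iff dest: dvd_imp_le)
    then have "f (coord z (int (Suc i))) = \<one>\<^bsub>K\<^esub>" by (simp only: f_coord[OF z] if_False)
    then have "s (coord z (int (Suc i) + 1)) = s (coord z (int (Suc i)))"
      using rel[of "int (Suc i)"] s by simp
    then show ?case using Suc by (simp add: add.commute)
  qed simp
  have "coord z (int (ord z)) = coord z 0" by (simp add: coord_eq_iff_same[OF z])
  then have one: "s (coord z 1) = s (pt z)"
    using const[of "ord z - 1"] ord_pos[OF z] by (simp add: coord_0)
  show "s (coord z j) = s (pt z)"
  proof -
    (* the coordinates 1, ..., ord z, between which s does not jump *)
    obtain i where "i < ord z" "coord z j = coord z (int i - (- 1))" by (rule coord_shifted[OF z])
    then show ?thesis using const one by (simp add: add.commute)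
  qed
  show "s (pt z) \<otimes>\<^bsub>K\<^esub> base z = base z \<otimes>\<^bsub>K\<^esub> s (pt z)"
    using rel[of 0] one by (simp add: coord_0)
qed

lemma image_iota: "\<iota> ` carrier B = kernel Cent St (\<lambda>(s, t). t)"
proof (rule subset_antisym; rule subsetI)
  fix b assume "b \<in> \<iota> ` carrier B"
  then obtain c c0 where c: "(c, c0) \<in> carrier B" "b = \<iota> (c, c0)" by (auto simp del: split_paired_All)
  then have "b \<in> carrier Cent" using Phi_Cent[OF c(1) id_St] by simp
  moreover have "snd b = id" unfolding c(2) by (subst iota_apply(1)) simp
  ultimately show "b \<in> kernel Cent St (\<lambda>(s, t). t)"
    by (simp add: kernel_def one_St case_prod_beta)
next
  fix b assume "b \<in> kernel Cent St (\<lambda>(s, t). t)"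
  then obtain s where b: "b = (s, id)" and sC: "(s, id) \<in> carrier Cent"
    by (cases b) (auto simp: kernel_def one_St)
  have s: "s \<in> \<Gamma> \<rightarrow>\<^sub>E carrier K" using sC by (simp only: carrier_Cent_iff)
  define cz where "cz z = x z \<otimes>\<^bsub>K\<^esub> s (pt z) \<otimes>\<^bsub>K\<^esub> inv\<^bsub>K\<^esub> x z" for z
  define c where "c = (\<lambda>L\<in>loads K \<Gamma> w. \<lambda>T\<in>terr K \<Gamma> ` cyc_ld L. cz (inv_into cyc (terr K \<Gamma>) T))"
  define c0 where "c0 = restrict s (\<Gamma> - terr K \<Gamma> w)"
  have comp: "comp c z = cz z" if z: "z \<in> cyc" for z
    using ld_loads[OF z] z inv_into_f_f[OF inj_on_terr[OF group_K finite_\<Gamma> w_full] z]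
    by (simp add: c_def cyc_ld_iff)
  have car: "x z \<in> carrier K" "s (pt z) \<in> carrier K" if z: "z \<in> cyc" for z
    using x_carrier[OF z] s coord_\<Gamma>[OF z, of 0] by (auto simp: coord_0)
  have cz: "cz z \<in> centraliser K (base (rep (ld z)))" if z: "z \<in> cyc" for z
  proof -
    let ?g = "base (rep (ld z))"
    have g: "?g \<in> carrier K" by (rule base_carrier[OF rep_cyc[OF ld_loads[OF z]]])
    have "base z = inv\<^bsub>K\<^esub> x z \<otimes>\<^bsub>K\<^esub> ?g \<otimes>\<^bsub>K\<^esub> x z" by (rule base_conj[OF z])
    then have "s (pt z) \<otimes>\<^bsub>K\<^esub> (inv\<^bsub>K\<^esub> x z \<otimes>\<^bsub>K\<^esub> ?g \<otimes>\<^bsub>K\<^esub> x z) =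
        inv\<^bsub>K\<^esub> x z \<otimes>\<^bsub>K\<^esub> ?g \<otimes>\<^bsub>K\<^esub> x z \<otimes>\<^bsub>K\<^esub> s (pt z)"
      using Cent_id_constant(2)[OF sC z] by simp
    then have "x z \<otimes>\<^bsub>K\<^esub> (s (pt z) \<otimes>\<^bsub>K\<^esub> (inv\<^bsub>K\<^esub> x z \<otimes>\<^bsub>K\<^esub> ?g \<otimes>\<^bsub>K\<^esub> x z)) \<otimes>\<^bsub>K\<^esub> inv\<^bsub>K\<^esub> x z =
        x z \<otimes>\<^bsub>K\<^esub> (inv\<^bsub>K\<^esub> x z \<otimes>\<^bsub>K\<^esub> ?g \<otimes>\<^bsub>K\<^esub> x z \<otimes>\<^bsub>K\<^esub> s (pt z)) \<otimes>\<^bsub>K\<^esub> inv\<^bsub>K\<^esub> x z"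
      by simp
    then have "cz z \<otimes>\<^bsub>K\<^esub> ?g = ?g \<otimes>\<^bsub>K\<^esub> cz z"
      using car[OF z] g by (simp add: cz_def K.m_assoc cancel_left)
    then show ?thesis using car[OF z] by (simp add: centraliser_def cz_def)
  qed
  have "(c, c0) \<in> carrier B"
    unfolding carrier_B_iff
  proof (intro conjI PiE_I)
    fix L T assume L: "L \<in> loads K \<Gamma> w" and T: "T \<in> terr K \<Gamma> ` cyc_ld L"
    then obtain z where z: "z \<in> cyc" "ld z = L" "T = terr K \<Gamma> z" by (auto simp: cyc_ld_iff)
    then show "c L T \<in> centraliser K (base (rep L))" using comp[OF z(1)] cz[OF z(1)] by simp
  next
    show "c0 \<gamma> \<in> carrier K" if "\<gamma> \<in> \<Gamma> - terr K \<Gamma> w" for \<gamma>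
      using s that by (auto simp: c0_def)
  qed (auto simp: c_def c0_def)
  moreover have "\<iota> (c, c0) = b"
  proof -
    have "fst (\<iota> (c, c0)) = s"
    proof (rule base_component_ext[OF iota_apply(2)])
      show "s \<in> extensional \<Gamma>" using s by (simp add: PiE_def)
      show "fst (\<iota> (c, c0)) (coord z j) = s (coord z j)" if z: "z \<in> cyc" for z j
        using car[OF z] comp[OF z] Cent_id_constant(1)[OF sC z]
        by (simp add: iota_apply(4)[OF z] cz_def K.m_assoc cancel_left)
      show "fst (\<iota> (c, c0)) \<gamma> = s \<gamma>" if "\<gamma> \<in> \<Gamma>" "\<gamma> \<notin> terr K \<Gamma> w" for \<gamma>
        using that by (simp add: iota_apply(3) c0_def)
    qed
    then show ?thesis using iota_apply(1)[of c c0] b by simp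
  qed
  ultimately show "b \<in> \<iota> ` carrier B" by (metis imageI)
qed

lemma section_Phi:
  assumes "t \<in> carrier St"
  shows "\<Phi> (\<one>\<^bsub>B\<^esub>, t) \<in> carrier Cent" and "(case \<Phi> (\<one>\<^bsub>B\<^esub>, t) of (s, t) \<Rightarrow> t) = t"
proof -
  obtain c c0 where c: "\<one>\<^bsub>B\<^esub> = (c, c0)" by (rule prod.exhaust)
  have "(c, c0) \<in> carrier B" using monoid.one_closed[OF group.is_monoid[OF group_B]] c by simp
  then show "\<Phi> (\<one>\<^bsub>B\<^esub>, t) \<in> carrier Cent" unfolding c by (rule Phi_Cent[OF _ assms])
  obtain \<sigma> e where "shifts t \<sigma> e" by (rule St_shifts[OF assms])
  then show "(case \<Phi> (\<one>\<^bsub>B\<^esub>, t) of (s, t) \<Rightarrow> t) = t"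
    unfolding c using Phi_apply(1)[OF St_permutes[OF assms] St_commutes[OF assms], of \<sigma> e c c0]
    by (simp add: case_prod_beta)
qed

lemma short_exact_centraliser: "short_exact B Cent St \<iota> (\<lambda>(s, t). t)"
proof -
  have "(\<lambda>(s, t). t) ` carrier Cent = carrier St"
  proof (rule subset_antisym; rule subsetI)
    fix t assume "t \<in> (\<lambda>(s, t). t) ` carrier Cent"
    then show "t \<in> carrier St" using Cent_top_St by auto
  next
    fix t assume "t \<in> carrier St"
    then show "t \<in> (\<lambda>(s, t). t) ` carrier Cent"
      using section_Phi by (metis (no_types, lifting) image_eqI)
  qed
  then show ?thesis
    unfolding short_exact_def
    using group_hom_iota group_hom_rho kernel_iota image_iota by blast
qed

end

theorem corollary48:
  fixes K :: "('k, 'm) monoid_scheme" and \<Gamma> :: "'g set" and H :: "('g \<Rightarrow> 'g) set"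
    and w :: "('k, 'g) wr"
    and pt :: "('k, 'g) wr \<Rightarrow> 'g" and rep :: "'k ld \<Rightarrow> ('k, 'g) wr" and x :: "('k, 'g) wr \<Rightarrow> 'k"
  assumes "group K"
    and "finite \<Gamma>"
    and "subgroup H (Sym \<Gamma>)"
    and "w \<in> carrier (wreath K \<Gamma> H)"
    and "sparse_decomposition K \<Gamma> w"
    and "admissible_choices K \<Gamma> w pt rep x"
  shows "let B = B_group K \<Gamma> w pt rep;
             C = cent_group (wreath K \<Gamma> H) w;
             St = stab_group K \<Gamma> H w;
             \<Phi> = Phi K \<Gamma> w pt rep x;
             \<iota> = (\<lambda>c. \<Phi> (c, \<one>\<^bsub>Sym \<Gamma>\<^esub>));
             \<rho> = (\<lambda>(s, t). t)
         in short_exact B C St \<iota> \<rho> \<and>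
            (\<forall>U V. carrier B = generate B U \<and> carrier St = generate St V \<longrightarrow>
               carrier C = generate C (\<iota> ` U \<union> {\<Phi> (\<one>\<^bsub>B\<^esub>, t) | t. t \<in> V}))"
proof -
  interpret sparse_wreath K \<Gamma> H w pt rep x
    using assms(1-4,6) by (rule sparse_wreath.intro)
  have "carrier Cent = generate Cent (\<iota> ` U \<union> {\<Phi> (\<one>\<^bsub>B\<^esub>, t) | t. t \<in> V})"
    if U: "carrier B = generate B U" and V: "carrier St = generate St V" for U V
  proof -
    have V_St: "t \<in> carrier St" if "t \<in> V" for t
      unfolding V using that by (rule generate.incl)
    have "carrier Cent = generate Cent (\<iota> ` U \<union> (\<lambda>t. \<Phi> (\<one>\<^bsub>B\<^esub>, t)) ` V)"
      by (rule short_exact_generate[OF short_exact_centraliser U V])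
        (use section_Phi V_St in auto)
    then show ?thesis by (simp only: Setcompr_eq_image)
  qed
  then show ?thesis
    unfolding Let_def one_Sym using short_exact_centraliser by blast
qed

end
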